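(* Let $\Gamma_{(3)}$ be the Gupta-Sidki $3$-group and let $(\gamma_n(\Gamma_{(3)}))_{n\geq 1}$ be its lower central series. Then $$\operatorname{diam}\big(\Gamma_{(3)}/\gamma_n(\Gamma_{(3)})\big) = O\big(n^{\log(111)/\log(1+\sqrt{2})}\big)$$ and $$\operatorname{diam}\big(\Gamma_{(3)}/\gamma_n(\Gamma_{(3)})\big) = O\Big(\big(\log|\Gamma_{(3)}:\gamma_n(\Gamma_{(3)})|\big)^{\log(111)/\log(3)}\Big),$$ where the implied constants are absolute (independent of $n$).
   Context: Diameter: for a finite group $G$ and a generating set $S\subseteq G$, $B_S(n)$ is the closed ball of radius $n$ about the identity in the word metric of $S$, i.e. the set of products of at most $n$ elements of $S\cup S^{-1}$; $\operatorname{diam}(G,S)=\min\{n\in\mathbb{N}: B_S(n)=G\}$; and $\operatorname{diam}(G)$ is the maximum of $\operatorname{diam}(G,S)$ over all generating sets $S$ of $G$. Lower central series: $\gamma_1(G)=G$ and $\gamma_{n+1}(G)=[\gamma_n(G),G]$. Tree: let $\mathcal{A}=\{0,1,2\}$ and let $\mathcal{A}^*$ be the set of finite words over $\mathcal{A}$, viewed as the vertex set of the ternary rooted tree $\mathcal{T}_3$. $\operatorname{Aut}(\mathcal{T}_3)$ is the group of permutations of $\mathcal{A}^*$ preserving the prefix relation. An element $\phi\in\operatorname{Aut}(\mathcal{T}_3)$ fixing each of the words $0,1,2$ is identified with the tuple $(\phi_0,\phi_1,\phi_2)\in\operatorname{Aut}(\mathcal{T}_3)^3$ such that $\phi(iw)=i\,\phi_i(w)$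 for all $i\in\mathcal{A}$, $w\in\mathcal{A}^*$. The Gupta-Sidki $3$-group $\Gamma_{(3)}$ is the subgroup of $\operatorname{Aut}(\mathcal{T}_3)$ generated by $a$ and $b$, where $a(0w)=1w$, $a(1w)=2w$, $a(2w)=0w$, and $b$ is defined recursively by $b=(a,a^{-1},b)$. *)

theory Defs
  imports Complex_Main "HOL-Library.Sublist" "HOL-Algebra.Algebra"
begin

section \<open>Diameter of a finite group\<close>

definition word_ball :: "('a, 'b) monoid_scheme \<Rightarrow> 'a set \<Rightarrow> nat \<Rightarrow> 'a set" where
  "word_ball G S n =
    {foldr (\<otimes>\<^bsub>G\<^esub>) xs \<one>\<^bsub>G\<^esub> | xs. length xs \<le> n \<and> set xs \<subseteq> S \<union> (\<lambda>s. inv\<^bsub>G\<^esub> s) ` S}"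

text \<open>The next two definitions are meant for a finite group and a generating set \<open>S\<close> of it:
  then the minimum exists and the maximum ranges over a finite nonempty set.\<close>

definition diam_wrt :: "('a, 'b) monoid_scheme \<Rightarrow> 'a set \<Rightarrow> nat" where
  "diam_wrt G S = (LEAST n. word_ball G S n = carrier G)"

definition diam :: "('a, 'b) monoid_scheme \<Rightarrow> nat" where
  "diam G = Max {diam_wrt G S | S. S \<subseteq> carrier G \<and> generate G S = carrier G}"


section \<open>Lower central series\<close>

text \<open>The series is indexed from \<open>1\<close>; the value at \<open>0\<close> is a dummy.\<close>

fun lower_central :: "('a, 'b) monoid_scheme \<Rightarrow> nat \<Rightarrow> 'a set" where
  "lower_central G 0 = carrier G"
| "lower_central G (Suc 0) = carrier G"
| "lower_central G (Suc (Suc n)) =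
    generate G (\<Union>x \<in> lower_central G (Suc n). \<Union>y \<in> carrier G.
      {x \<otimes>\<^bsub>G\<^esub> y \<otimes>\<^bsub>G\<^esub> inv\<^bsub>G\<^esub> x \<otimes>\<^bsub>G\<^esub> inv\<^bsub>G\<^esub> y})"


section \<open>The ternary rooted tree and the Gupta-Sidki 3-group\<close>

datatype letter = L0 | L1 | L2

type_synonym vertex = "letter list"

definition AutT3 :: "(vertex \<Rightarrow> vertex) monoid" where
  "AutT3 = (BijGroup UNIV)\<lparr>carrier := {f. bij f \<and> (\<forall>u v. prefix (f u) (f v) \<longleftrightarrow> prefix u v)}\<rparr>"

fun gs_a :: "vertex \<Rightarrow> vertex" where
  "gs_a [] = []"
| "gs_a (L0 # w) = L1 # w"
| "gs_a (L1 # w) = L2 # w"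
| "gs_a (L2 # w) = L0 # w"

fun gs_b :: "vertex \<Rightarrow> vertex" where
  "gs_b [] = []"
| "gs_b (L0 # w) = L0 # gs_a w"
| "gs_b (L1 # w) = L1 # (inv\<^bsub>AutT3\<^esub> gs_a) w"
| "gs_b (L2 # w) = L2 # gs_b w"

definition gupta_sidki :: "(vertex \<Rightarrow> vertex) monoid" where
  "gupta_sidki = subgroup_generated AutT3 {gs_a, gs_b}"


section \<open>Well-definedness\<close>

lemma subgroup_AutT3: "subgroup (carrier AutT3) (BijGroup UNIV)"
proof (rule group.subgroupI[OF group_BijGroup])
  show "carrier AutT3 \<subseteq> carrier (BijGroup UNIV)"
    by (auto simp: AutT3_def BijGroup_def Bij_def)
  show "carrier AutT3 \<noteq> {}"
    by (auto simp: AutT3_def intro: exI[of _ id])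
next
  fix f assume f: "f \<in> carrier AutT3"
  then have b: "bij f" and p: "\<And>u v. prefix (f u) (f v) \<longleftrightarrow> prefix u v"
    by (auto simp: AutT3_def)
  have "prefix (inv_into UNIV f u) (inv_into UNIV f v) \<longleftrightarrow> prefix u v" for u v
    by (metis b p bij_inv_eq_iff)
  then show "inv\<^bsub>BijGroup UNIV\<^esub> f \<in> carrier AutT3"
    using b by (simp add: AutT3_def inv_BijGroup Bij_def bij_imp_bij_inv)
next
  fix f g assume "f \<in> carrier AutT3" "g \<in> carrier AutT3"
  then show "f \<otimes>\<^bsub>BijGroup UNIV\<^esub> g \<in> carrier AutT3"
    by (auto simp: AutT3_def BijGroup_def Bij_def compose_def intro: bij_comp[unfolded comp_def])
qed

lemma group_AutT3: "group AutT3"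
  using subgroup.subgroup_is_group[OF subgroup_AutT3 group_BijGroup]
  by (simp add: AutT3_def)

lemma AutT3_mult: "f \<in> carrier AutT3 \<Longrightarrow> g \<in> carrier AutT3 \<Longrightarrow> f \<otimes>\<^bsub>AutT3\<^esub> g = f \<circ> g"
  by (auto simp: AutT3_def BijGroup_def Bij_def compose_def)

lemma AutT3_inv: "f \<in> carrier AutT3 \<Longrightarrow> inv\<^bsub>AutT3\<^esub> f = inv_into UNIV f"
  using group.m_inv_consistent[OF group_BijGroup subgroup_AutT3, of f]
  by (auto simp: AutT3_def inv_BijGroup Bij_def restrict_def)

lemma gs_a_cube: "gs_a (gs_a (gs_a w)) = w"
  by (cases w rule: gs_a.cases) auto

lemma gs_a_in_AutT3: "gs_a \<in> carrier AutT3"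
proof -
  have "bij gs_a"
    by (rule o_bij[of "gs_a \<circ> gs_a"]) (auto simp: gs_a_cube)
  moreover have "prefix (gs_a u) (gs_a v) \<longleftrightarrow> prefix u v" for u v
    by (cases u rule: gs_a.cases; cases v rule: gs_a.cases) auto
  ultimately show ?thesis
    by (simp add: AutT3_def)
qed

lemma gs_b_in_AutT3: "gs_b \<in> carrier AutT3"
proof -
  let ?c = "inv\<^bsub>AutT3\<^esub> gs_a"
  have c: "?c \<in> carrier AutT3"
    by (rule group.inv_closed[OF group_AutT3 gs_a_in_AutT3])
  have pa: "prefix (gs_a u) (gs_a v) \<longleftrightarrow> prefix u v" for u v
    using gs_a_in_AutT3 by (simp add: AutT3_def)
  have pc: "prefix (?c u) (?c v) \<longleftrightarrow> prefix u v" for u v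
    using c unfolding AutT3_def by simp
  have pb: "prefix (gs_b u) (gs_b v) \<longleftrightarrow> prefix u v" for u v
  proof (induction u arbitrary: v rule: gs_b.induct)
    case 1 then show ?case by simp
  next
    case (2 w) then show ?case by (cases v rule: gs_b.cases) (auto simp: pa)
  next
    case (3 w) then show ?case by (cases v rule: gs_b.cases) (auto simp: pc)
  next
    case (4 w) then show ?case by (cases v rule: gs_b.cases) auto
  qed
  have "inj gs_b"
    by (rule injI) (metis pb prefix_order.eq_iff)
  moreover have "\<exists>u. gs_b u = v" for v
  proof (induction v rule: gs_b.induct)
    case 1 then show ?case by (intro exI[of _ "[]"]) simp
  next
    case (2 w)
    have "gs_b (L0 # gs_a (gs_a w)) = L0 # w" by (simp add: gs_a_cube)
    then show ?case by blast
  next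
    case (3 w)
    obtain u where "?c u = w"
      by (metis AutT3_inv gs_a_in_AutT3 gs_a_cube inv_into_f_f injI UNIV_I)
    then have "gs_b (L1 # u) = L1 # w" by simp
    then show ?case by blast
  next
    case (4 w)
    then obtain u where "gs_b u = w" by blast
    then have "gs_b (L2 # u) = L2 # w" by simp
    then show ?case by blast
  qed
  ultimately have "bij gs_b"
    by (metis bijI surjI)
  with pb show ?thesis
    by (simp add: AutT3_def)
qed

lemma group_gupta_sidki: "group gupta_sidki"
  by (simp add: gupta_sidki_def group_AutT3 group.group_subgroup_generated)

lemma carrier_gupta_sidki: "carrier gupta_sidki = generate AutT3 {gs_a, gs_b}"
  by (simp add: gupta_sidki_def carrier_subgroup_generated gs_a_in_AutT3 gs_b_in_AutT3)

end

theory Submission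
  imports Defs
begin

text \<open>Write \<open>G\<close> for the Gupta-Sidki group, \<open>a\<close>, \<open>b\<close> for its generators, \<open>c = [a, b]\<close>
  and \<open>u = [a, c]\<close>. The geometric powers \<open>K\<^sub>m = \<gamma>\<^sub>2(G)\<^bsup>3^m\<^esup>\<close> and \<open>J\<^sub>m = \<gamma>\<^sub>3(G)\<^bsup>3^m\<^esup>\<close> at level \<open>m\<close> of the tree
  form a chain \<open>K\<^sub>0 \<supseteq> J\<^sub>0 \<supseteq> K\<^sub>1 \<supseteq> J\<^sub>1 \<supseteq> \<dots>\<close> of normal subgroups of finite index. Every element of a layer of this
  chain is a product of at most two commutators of elements of earlier layers, and only the classes
  of these elements modulo the next layer matter. So a system of words representing the layers of
  level \<open>m\<close>, in any generating set, yields such words for level \<open>m + 1\<close> that are at most \<open>13\<close> times as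
  long, and every element of \<open>G\<close> is represented modulo \<open>K\<^sub>m\<close> by a word of length \<open>O(13^m)\<close>.

  The same commutators show that \<open>K\<^sub>m\<close> lies in \<open>\<gamma>\<^sub>d(G)\<close> for some \<open>d \<ge> 1.83^m\<close> (\<open>d\<close> grows like the tribonacci
  numbers). Since the lower central series is strictly decreasing, \<open>log |G : \<gamma>\<^sub>n(G)|\<close> is bounded below by
  a multiple of \<open>n\<close>. Both estimates follow because
  \<open>log 13 / log 1.83 < 4.28 < log 111 / log 3 < log 111 / log (1 + \<surd>2)\<close>.\<close>

section \<open>Subgroups and lower central series in additive notation\<close>

text \<open>About a generating set only one thing is used: it generates \<open>Gam\<close> modulo
  \<open>Gam2\<close>. A short word hits a prescribed element only up to an error in the next layer,
  so each step is stated for elements known coarsely, and later choices may depend on earlier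
  errors. Both steps are proved once at the root; they lift to level m one coordinate at a time.

  Modulo \<open>tri3 Gam2\<close> the layer \<open>Gam3\<close> is described by one exponent, that
  of u = [a, c], so one commutator reaches it. The layer \<open>tri3 Gam2\<close> modulo
  \<open>tri3 Gam3\<close> has three exponents, while the commutators of b with c and u supply only
  two directions; the second commutator adds the diagonal. The resulting recursion for word lengths
  grows at the rate x with x = 12 + 12/x + 4/x^2, about 12.95, which is rounded up to 13.

  The strict decrease serves twice: for the index, and for \<open>Gam2\<close> not lying in
  \<open>Gam3\<close>, which forces two generators to be independent modulo \<open>Gam2\<close>. It
  is derived from residual nilpotence: each level stabiliser contains a term of the series.\<close>

definition comm :: "'a::group_add \<Rightarrow> 'a \<Rightarrow> 'a" where
  "comm x y = x + y - x - y"

lemmas grp_norm = diff_conv_add_uminus add.assoc minus_add minus_minus add_minus_cancel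
  minus_add_cancel left_minus right_minus add_0_left add_0_right minus_zero

definition is_subgrp :: "'a::group_add set \<Rightarrow> bool" where
  "is_subgrp H \<longleftrightarrow> 0 \<in> H \<and> (\<forall>x\<in>H. \<forall>y\<in>H. x + y \<in> H) \<and> (\<forall>x\<in>H. - x \<in> H)"

lemma is_subI: "0 \<in> H \<Longrightarrow> (\<And>x y. x \<in> H \<Longrightarrow> y \<in> H \<Longrightarrow> x + y \<in> H) \<Longrightarrow> (\<And>x. x \<in> H \<Longrightarrow> - x \<in> H) \<Longrightarrow> is_subgrp H"
  by (simp add: is_subgrp_def)

lemma is_subgrp_zero: "is_subgrp H \<Longrightarrow> 0 \<in> H"
  and is_subgrp_add: "is_subgrp H \<Longrightarrow> x \<in> H \<Longrightarrow> y \<in> H \<Longrightarrow> x + y \<in> H"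
  and is_subgrp_neg: "is_subgrp H \<Longrightarrow> x \<in> H \<Longrightarrow> - x \<in> H"
  by (simp_all add: is_subgrp_def)

lemma is_subgrp_diff: "is_subgrp H \<Longrightarrow> x \<in> H \<Longrightarrow> y \<in> H \<Longrightarrow> x - y \<in> H"
  by (metis diff_conv_add_uminus is_subgrp_add is_subgrp_neg)

lemmas is_subgrp_rules = is_subgrp_zero is_subgrp_add is_subgrp_neg is_subgrp_diff

lemma is_subgrp_comm: "is_subgrp H \<Longrightarrow> x \<in> H \<Longrightarrow> y \<in> H \<Longrightarrow> comm x y \<in> H"
  unfolding comm_def by (intro is_subgrp_rules)

inductive_set gen :: "'a::group_add set \<Rightarrow> 'a set" for A where
  zero: "0 \<in> gen A"
| incl: "x \<in> A \<Longrightarrow> x \<in> gen A"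
| add: "x \<in> gen A \<Longrightarrow> y \<in> gen A \<Longrightarrow> x + y \<in> gen A"
| neg: "x \<in> gen A \<Longrightarrow> - x \<in> gen A"

lemma is_subgrp_gen: "is_subgrp (gen A)"
  by (simp add: is_subgrp_def gen.zero gen.add gen.neg)

lemma gen_least:
  assumes "is_subgrp H" "A \<subseteq> H" shows "gen A \<subseteq> H"
proof
  fix x assume "x \<in> gen A" then show "x \<in> H"
    by induction (use assms in \<open>auto simp: is_subgrp_def\<close>)
qed

lemma gen_mono: "A \<subseteq> B \<Longrightarrow> gen A \<subseteq> gen B"
  by (intro gen_least is_subgrp_gen) (auto intro: gen.incl)

definition normal_sub :: "'a::group_add set \<Rightarrow> 'a set \<Rightarrow> bool" where
  "normal_sub G N \<longleftrightarrow> is_subgrp N \<and> N \<subseteq> G \<and> (\<forall>g\<in>G. \<forall>n\<in>N. g + n - g \<in> N)"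

lemma normal_sub_sub: "normal_sub G N \<Longrightarrow> is_subgrp N" and normal_sub_subset: "normal_sub G N \<Longrightarrow> N \<subseteq> G"
  and normal_sub_conj: "normal_sub G N \<Longrightarrow> g \<in> G \<Longrightarrow> n \<in> N \<Longrightarrow> g + n - g \<in> N"
  by (simp_all add: normal_sub_def)

lemma normal_sub_conj': "normal_sub G N \<Longrightarrow> is_subgrp G \<Longrightarrow> g \<in> G \<Longrightarrow> n \<in> N \<Longrightarrow> - g + n + g \<in> N"
  using normal_sub_conj[of G N "- g" n] by (simp add: is_subgrp_neg)

lemma comm_add_left: "comm (x + y) z = (x + comm y z - x) + comm x z"
  by (simp only: comm_def grp_norm)

lemma comm_add_right: "comm x (y + z) = comm x y + (y + comm x z - y)"
  by (simp only: comm_def grp_norm)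

lemma comm_neg_left: "comm (- x) y = - x + - comm x y + x"
  by (simp only: comm_def grp_norm)

lemma comm_neg_right: "comm x (- y) = - y + - comm x y + y"
  by (simp only: comm_def grp_norm)

lemma comm_swap: "comm y x = - comm x y"
  by (simp only: comm_def grp_norm)

lemma conj_comm: "g + comm x y - g = comm (g + x - g) (g + y - g)"
  by (simp only: comm_def grp_norm)

lemma conj_eq_comm: "g + x - g = comm g x + x"
  by (simp only: comm_def grp_norm)

text \<open>The conjugate is [g, x] + x, and the summand x drops out. So the commutator of an
  element with its own conjugate has weight three; this is how elements of \<open>Gam3\<close> are
  found below.\<close>

lemma comm_conj_right: "comm x (g + x - g) = comm x (comm g x)"
  by (simp only: comm_def grp_norm)

lemma comm_zero [simp]: "comm 0 x = 0" "comm x 0 = 0" "comm x x = 0"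
  by (simp_all add: comm_def)

lemma hall_witt:
  "comm (comm x y) (y + z - y) + comm (comm y z) (z + x - z) + comm (comm z x) (x + y - x) = 0"
  by (simp only: comm_def grp_norm)

lemma normal_sub_gen:
  assumes "is_subgrp G" "A \<subseteq> G" "\<And>g x. g \<in> G \<Longrightarrow> x \<in> A \<Longrightarrow> g + x - g \<in> gen A"
  shows "normal_sub G (gen A)"
proof -
  have "g + x - g \<in> gen A" if g: "g \<in> G" and x: "x \<in> gen A" for g x
    using x
  proof induction
    case (add x y)
    have "g + (x + y) - g = (g + x - g) + (g + y - g)" by (simp only: grp_norm)
    then show ?case using add by (simp add: gen.add)
  next
    case (neg x)
    have "g + - x - g = - (g + x - g)" by (simp only: grp_norm)
    then show ?case using neg gen.neg by metis
  qed (use g assms in \<open>auto intro: gen.intros\<close>)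
  then show ?thesis
    using assms gen_least[of G A] by (auto simp: normal_sub_def is_subgrp_gen)
qed

text \<open>Modulo the normal subgroup \<open>N\<close> the map \<open>comm x\<close> respects sums
  up to conjugation, so that its vanishing can be checked on generators.\<close>

lemma is_subgrp_centr_right:
  assumes G: "is_subgrp G" and N: "normal_sub G N"
  shows "is_subgrp {y \<in> G. \<forall>x\<in>A. comm x y \<in> N}"
proof (rule is_subI)
  show "0 \<in> {y \<in> G. \<forall>x\<in>A. comm x y \<in> N}"
    using G N by (auto simp: is_subgrp_zero normal_sub_sub)
next
  fix y z assume "y \<in> {y \<in> G. \<forall>x\<in>A. comm x y \<in> N}" "z \<in> {y \<in> G. \<forall>x\<in>A. comm x y \<in> N}"
  then show "y + z \<in> {y \<in> G. \<forall>x\<in>A. comm x y \<in> N}"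
    using G N by (auto simp: comm_add_right intro!: is_subgrp_add normal_sub_conj normal_sub_sub)
next
  fix y assume "y \<in> {y \<in> G. \<forall>x\<in>A. comm x y \<in> N}"
  then show "- y \<in> {y \<in> G. \<forall>x\<in>A. comm x y \<in> N}"
    using G N normal_sub_conj'[OF N G] is_subgrp_neg[OF normal_sub_sub[OF N]]
    by (auto simp: comm_neg_right is_subgrp_neg simp del: add_uminus_conv_diff)
qed

lemma is_subgrp_centr_left:
  assumes G: "is_subgrp G" and N: "normal_sub G N"
  shows "is_subgrp {x \<in> G. \<forall>y\<in>Y. comm x y \<in> N}"
proof -
  have "{x \<in> G. \<forall>y\<in>Y. comm x y \<in> N} = {x \<in> G. \<forall>y\<in>Y. comm y x \<in> N}"
    using normal_sub_sub[OF N] by (metis comm_swap is_subgrp_neg)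
  then show ?thesis using is_subgrp_centr_right[OF G N, of Y] by simp
qed

lemma normal_sub_self: "is_subgrp G \<Longrightarrow> normal_sub G G"
  by (auto simp: normal_sub_def intro!: is_subgrp_diff is_subgrp_add)

section \<open>The lower central series and normal subgroups of two-generator groups\<close>

fun lcs :: "'a::group_add set \<Rightarrow> nat \<Rightarrow> 'a set" where
  "lcs G 0 = G"
| "lcs G (Suc 0) = G"
| "lcs G (Suc (Suc n)) = gen {comm x y |x y. x \<in> lcs G (Suc n) \<and> y \<in> G}"

lemma normal_sub_lcs: assumes G: "is_subgrp G" shows "normal_sub G (lcs G n)"
proof (induction n rule: induct_nat_012)
  case (ge2 n)
  let ?A = "{comm x y |x y. x \<in> lcs G (Suc n) \<and> y \<in> G}"
  have N: "normal_sub G (lcs G (Suc n))" by fact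
  have "normal_sub G (gen ?A)"
  proof (rule normal_sub_gen[OF G])
    show "?A \<subseteq> G" using normal_sub_subset[OF N] G by (auto intro: is_subgrp_comm)
    fix g z assume g: "g \<in> G" and "z \<in> ?A"
    then obtain x y where "z = comm x y" "x \<in> lcs G (Suc n)" "y \<in> G" by auto
    then show "g + z - g \<in> gen ?A"
      using g normal_sub_conj[OF N g] normal_sub_conj[OF normal_sub_self[OF G] g] unfolding \<open>z = _\<close> conj_comm
      by (intro gen.incl CollectI exI[of _ "g + x - g"] exI[of _ "g + y - g"]) auto
  qed
  then show ?case by simp
qed (use G in \<open>simp_all add: normal_sub_self\<close>)

lemma lcs_subset: "is_subgrp G \<Longrightarrow> lcs G n \<subseteq> G"
  using normal_sub_lcs normal_sub_subset by blast

lemma is_subgrp_lcs: "is_subgrp G \<Longrightarrow> is_subgrp (lcs G n)"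
  using normal_sub_lcs normal_sub_sub by blast

lemma lcs_Suc_subset: assumes G: "is_subgrp G" shows "lcs G (Suc n) \<subseteq> lcs G n"
proof (cases n)
  case (Suc k)
  have "comm x y \<in> lcs G (Suc k)" if "x \<in> lcs G (Suc k)" "y \<in> G" for x y
  proof -
    have "y + - x - y \<in> lcs G (Suc k)"
      using that normal_sub_lcs[OF G, of "Suc k"] by (intro normal_sub_conj) (auto intro: is_subgrp_neg normal_sub_sub)
    moreover have "comm x y = x + (y + - x - y)" by (simp only: comm_def grp_norm)
    ultimately show ?thesis using that is_subgrp_add[OF is_subgrp_lcs[OF G]] by metis
  qed
  then show ?thesis
    unfolding Suc lcs.simps using is_subgrp_lcs[OF G, of "Suc k"]
    by (intro gen_least) auto
qed simp

lemma lcs_antimono: "is_subgrp G \<Longrightarrow> m \<le> n \<Longrightarrow> lcs G n \<subseteq> lcs G m"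
  by (rule lift_Suc_antimono_le[of "lcs G"]) (auto simp: lcs_Suc_subset)

lemma comm_lcs_Suc:
  "x \<in> lcs G i \<Longrightarrow> y \<in> G \<Longrightarrow> i \<ge> 1 \<Longrightarrow> comm x y \<in> lcs G (Suc i)"
  by (cases i) (auto intro: gen.incl)

text \<open>The three subgroups argument, by induction on \<open>j\<close>: the Hall-Witt identity
  replaces [x, [z, g]] by commutators in which x meets g and z separately.\<close>

lemma comm_lcs:
  assumes G: "is_subgrp G" and "i \<ge> 1" "j \<ge> 1" "x \<in> lcs G i" "y \<in> lcs G j"
  shows "comm x y \<in> lcs G (i + j)"
  using assms(3,2,4,5)
proof (induction j arbitrary: i x y rule: dec_induct)
  case base
  then show ?case using comm_lcs_Suc[of x G i y] by simp
next
  case (step j)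
  let ?M = "lcs G (i + Suc j)"
  let ?C = "{y \<in> G. \<forall>x\<in>lcs G i. comm x y \<in> ?M}"
  have M: "normal_sub G ?M" by (rule normal_sub_lcs[OF G])
  have "{comm z g |z g. z \<in> lcs G j \<and> g \<in> G} \<subseteq> ?C"
  proof clarify
    fix z g assume z: "z \<in> lcs G j" and g: "g \<in> G"
    have zG: "z \<in> G" using z lcs_subset[OF G] by blast
    have "comm x (comm z g) \<in> ?M" if x: "x \<in> lcs G i" for x
    proof -
      \<comment> \<open>Chosen such that \<open>g + ?c - g\<close> is \<open>x\<close>: the first
        term of \<open>hall_witt\<close> for \<open>z\<close>, \<open>g\<close>, \<open>?c\<close>
        is then [[z, g], x].\<close>
      let ?c = "- g + x + g"
      have c: "?c \<in> lcs G i" by (rule normal_sub_conj'[OF normal_sub_lcs[OF G] G g x])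
      then have cG: "?c \<in> G" using lcs_subset[OF G] by blast
      have x: "x = g + ?c - g" by (simp only: grp_norm)
      have "comm g ?c \<in> lcs G (Suc i)"
        using comm_lcs_Suc[OF c g \<open>1 \<le> i\<close>] is_subgrp_neg[OF is_subgrp_lcs[OF G]] by (metis comm_swap)
      then have 1: "comm (comm g ?c) (?c + z - ?c) \<in> ?M"
        using step.IH[of "Suc i"] normal_sub_conj[OF normal_sub_lcs[OF G] cG z] by simp
      have "comm ?c z \<in> lcs G (i + j)" using step.IH c z step.prems by blast
      then have 2: "comm (comm ?c z) (z + g - z) \<in> ?M"
        using comm_lcs_Suc[of _ G "i + j"] G zG g step.prems by (simp add: is_subgrp_rules)
      have "comm (comm z g) x + comm (comm g ?c) (?c + z - ?c) + comm (comm ?c z) (z + g - z) = 0"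
        using hall_witt[of z g ?c] x by metis
      then have "comm x (comm z g) = comm (comm g ?c) (?c + z - ?c) + comm (comm ?c z) (z + g - z)"
        unfolding comm_swap[of "comm z g"] add.assoc by (metis add_eq_0_iff minus_minus)
      then show ?thesis using 1 2 is_subgrp_add[OF normal_sub_sub[OF M]] by metis
    qed
    then show "comm z g \<in> G \<and> (\<forall>x\<in>lcs G i. comm x (comm z g) \<in> ?M)"
      using G zG g by (auto intro: is_subgrp_comm)
  qed
  then have "gen {comm z g |z g. z \<in> lcs G j \<and> g \<in> G} \<subseteq> ?C"
    by (intro gen_least is_subgrp_centr_right[OF G M])
  moreover have "lcs G (Suc j) = gen {comm z g |z g. z \<in> lcs G j \<and> g \<in> G}"
    using \<open>1 \<le> j\<close> by (cases j) auto
  ultimately show ?case using step.prems by blast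
qed


lemma normal_sub_centre_mod:
  assumes G: "is_subgrp G" and N: "normal_sub G N"
  shows "normal_sub G {x \<in> G. \<forall>y\<in>G. comm x y \<in> N}"
proof -
  have "comm (g + x - g) y \<in> N" if "g \<in> G" "x \<in> G" "\<forall>y\<in>G. comm x y \<in> N" "y \<in> G" for g x y
  proof -
    have "comm (g + x - g) y = g + comm x (- g + y + g) - g" by (simp only: comm_def grp_norm)
    moreover have "- g + y + g \<in> G" using normal_sub_conj'[OF normal_sub_self[OF G] G] that by blast
    ultimately show ?thesis using that normal_sub_conj[OF N] by simp
  qed
  then show ?thesis
    unfolding normal_sub_def using is_subgrp_centr_left[OF G N, of G] normal_sub_conj[OF normal_sub_self[OF G]] by auto
qed

lemma comm_gen2_in:
  assumes N: "normal_sub (gen {a, b}) N" and c: "comm a b \<in> N"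
    and x: "x \<in> gen {a, b}" and y: "y \<in> gen {a, b}"
  shows "comm x y \<in> N"
proof -
  let ?G = "gen {a, b}"
  have 0: "0 \<in> N" using N normal_sub_sub is_subgrp_zero by blast
  have c': "comm b a \<in> N" using c N comm_swap[of b a] by (simp add: is_subgrp_neg normal_sub_sub)
  have "?G \<subseteq> {y \<in> ?G. \<forall>x\<in>{a, b}. comm x y \<in> N}"
    by (intro gen_least is_subgrp_centr_right is_subgrp_gen N) (use c c' 0 in \<open>auto intro: gen.incl\<close>)
  then have "?G \<subseteq> {x \<in> ?G. \<forall>y\<in>?G. comm x y \<in> N}"
    by (intro gen_least is_subgrp_centr_left is_subgrp_gen N) (auto intro: gen.incl)
  then show ?thesis using x y by blast
qed

lemma lc2_gen2_subset:
  assumes N: "normal_sub (gen {a, b}) N" and c: "comm a b \<in> N"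
  shows "lcs (gen {a, b}) 2 \<subseteq> N"
  unfolding numeral_2_eq_2 lcs.simps
  using comm_gen2_in[OF N c] by (intro gen_least normal_sub_sub[OF N]) auto

text \<open>The preimage of the centre modulo \<open>N\<close> is normal and contains [a, b], so by
  \<open>lc2_gen2_subset\<close> it contains the second term of the series.\<close>

lemma lc3_gen2_subset:
  assumes N: "normal_sub (gen {a, b}) N" and c: "comm (comm a b) a \<in> N" "comm (comm a b) b \<in> N"
  shows "lcs (gen {a, b}) 3 \<subseteq> N"
proof -
  let ?G = "gen {a, b}"
  have G: "is_subgrp ?G" by (rule is_subgrp_gen)
  have ab: "comm a b \<in> ?G" by (intro is_subgrp_comm G) (auto intro: gen.incl)
  have "?G \<subseteq> {y \<in> ?G. \<forall>x\<in>{comm a b}. comm x y \<in> N}"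
    by (intro gen_least is_subgrp_centr_right G N) (use c in \<open>auto intro: gen.incl\<close>)
  then have "lcs ?G 2 \<subseteq> {x \<in> ?G. \<forall>y\<in>?G. comm x y \<in> N}"
    using ab by (intro lc2_gen2_subset normal_sub_centre_mod G N) auto
  then show ?thesis
    unfolding numeral_3_eq_3 numeral_2_eq_2 lcs.simps(3)[of _ "Suc 0"]
    by (intro gen_least normal_sub_sub[OF N]) auto
qed

text \<open>Since \<open>- x\<close> is \<open>x + x\<close>, conjugation by \<open>- x\<close> is
  conjugation by \<open>x\<close> applied twice.\<close>

lemma normal_sub_gen_order3:
  assumes "is_subgrp N" "N \<subseteq> gen A" and conj: "\<And>x n. x \<in> A \<Longrightarrow> n \<in> N \<Longrightarrow> x + n - x \<in> N"
    and order: "\<And>x. x \<in> A \<Longrightarrow> x + (x + x) = 0"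
  shows "normal_sub (gen A) N"
proof -
  have "(\<forall>n\<in>N. g + n - g \<in> N) \<and> (\<forall>n\<in>N. - g + n + g \<in> N)" if "g \<in> gen A" for g
    using that
  proof induction
    case (incl x)
    have "- x = x + x" using order[OF incl] by (rule minus_unique)
    then have "- x + n + x = (x + x) + n - (x + x)" for n
      by (simp only: \<open>- x = x + x\<close>[symmetric] diff_minus_eq_add)
    moreover have "(x + x) + n - (x + x) = x + (x + n - x) - x" for n by (simp only: grp_norm)
    ultimately have "- x + n + x = x + (x + n - x) - x" for n by simp
    then show ?case using conj[OF incl] by simp
  next
    case (add x y)
    have "x + y + n - (x + y) = x + (y + n - y) - x" "- (x + y) + n + (x + y) = - y + (- x + n + x) + y" for n
      by (simp_all only: grp_norm)
    then show ?case using add by simp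
  qed simp_all
  then show ?thesis using assms by (simp add: normal_sub_def)
qed

text \<open>Multiples by integers rather than residues, to match the integer exponents of the class
  relations below.\<close>

definition zm :: "int \<Rightarrow> 'a::group_add \<Rightarrow> 'a" where
  "zm n g = (if n \<ge> 0 then ((+) g ^^ nat n) 0 else - (((+) g ^^ nat (- n)) 0))"

lemma zm_0 [simp]: "zm 0 g = 0" and zm_1 [simp]: "zm 1 g = g"
  by (simp_all add: zm_def)

lemma zm_succ: "zm (n + 1) g = g + zm n g"
proof (cases "n \<ge> 0")
  case True
  then have "nat (n + 1) = Suc (nat n)" by simp
  then show ?thesis using True by (simp add: zm_def)
next
  case False
  let ?Y = "((+) g ^^ nat (- (n + 1))) 0"
  have Y: "((+) g ^^ k) 0 + g = g + ((+) g ^^ k) 0" for k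
    by (induction k) (simp_all add: add.assoc)
  have "nat (- n) = Suc (nat (- (n + 1)))" using False by simp
  then have n: "zm n g = - (g + ?Y)" using False by (simp add: zm_def)
  have "zm (n + 1) g = - ?Y" using False by (cases "n = -1") (auto simp: zm_def)
  also have "\<dots> = g + - (?Y + g)" by (simp only: grp_norm)
  finally show ?thesis using n Y by simp
qed

lemma zm_add: "zm (m + n) g = zm m g + zm n g"
proof (induction m rule: int_induct[of _ 0])
  case (step1 i)
  have "zm (i + 1 + n) g = g + zm (i + n) g" by (metis add.assoc add.commute zm_succ)
  then show ?case using step1 by (simp add: zm_succ add.assoc)
next
  case (step2 i)
  have "zm (i + n) g = g + zm (i - 1 + n) g" using zm_succ[of "i - 1 + n" g] by (simp add: algebra_simps)
  moreover have "zm i g = g + zm (i - 1) g" using zm_succ[of "i - 1" g] by simp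
  ultimately show ?case using step2 by (simp add: add.assoc)
qed simp

lemma zm_neg: "zm (- n) g = - zm n g"
  using zm_add[of n "- n" g] by (simp add: minus_unique)

lemma zm_in: "is_subgrp H \<Longrightarrow> g \<in> H \<Longrightarrow> zm n g \<in> H"
proof (induction n rule: int_induct[of _ 0])
  case (step2 i)
  have "zm (i - 1) g = - g + zm i g" using zm_succ[of "i - 1" g] by simp
  then show ?case using step2 by (simp add: is_subgrp_rules)
qed (simp_all add: zm_succ is_subgrp_rules)

section \<open>Automorphisms of the ternary tree\<close>

text \<open>The automorphisms form a non-abelian group in additive notation: this makes the
  group axioms type class facts, without carrier side conditions.\<close>

typedef tree_aut = "carrier AutT3" morphisms app Abs_tree_aut
  using gs_a_in_AutT3 by blast

setup_lifting type_definition_tree_aut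

lemma AutT3_simps: "f \<in> carrier AutT3 \<longleftrightarrow> bij f \<and> (\<forall>u v. prefix (f u) (f v) \<longleftrightarrow> prefix u v)"
  by (simp add: AutT3_def)

instantiation tree_aut :: group_add
begin

lift_definition zero_tree_aut :: tree_aut is "id"
  by (simp add: AutT3_simps)

lift_definition plus_tree_aut :: "tree_aut \<Rightarrow> tree_aut \<Rightarrow> tree_aut" is "(\<circ>)"
  by (auto simp: AutT3_simps intro: bij_comp)

lift_definition uminus_tree_aut :: "tree_aut \<Rightarrow> tree_aut" is "\<lambda>f. inv\<^bsub>AutT3\<^esub> f"
  by (rule group.inv_closed[OF group_AutT3])

definition minus_tree_aut :: "tree_aut \<Rightarrow> tree_aut \<Rightarrow> tree_aut" where
  "x - y = x + - (y :: tree_aut)"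

instance
proof
  fix x y z :: tree_aut
  show "x + y + z = x + (y + z)" by transfer (simp add: comp_assoc)
  show "0 + x = x" by transfer simp
  show "x + 0 = x" by transfer simp
  show "- x + x = 0"
    by transfer (auto simp: AutT3_inv AutT3_simps bij_is_inj)
  show "x + - y = x - y" by (simp add: minus_tree_aut_def)
qed

end

lemma app_add: "app (x + y) w = app x (app y w)" and app_zero: "app 0 w = w"
  by (transfer, simp)+

lemma app_neg: "app (- x) (app x w) = w"
  by (metis app_add app_zero left_minus)

lemma tree_aut_eqI: "(\<And>w. app x w = app y w) \<Longrightarrow> x = y"
  by (metis app_inject ext)

text \<open>The prefixes of w form a strict chain with strictly increasing images, so no word gets
  shorter; the inverse gives the other inequality.\<close>

lemma length_app [simp]: "length (app x w) = length w"
proof -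
  have le: "length w \<le> length (app x w)" for x w
  proof (induction w rule: rev_induct)
    case (snoc l w)
    have "prefix (app x w) (app x (w @ [l]))" "app x w \<noteq> app x (w @ [l])"
      using app[of x] by (auto simp: AutT3_simps dest: bij_is_inj injD)
    then have "strict_prefix (app x w) (app x (w @ [l]))" by auto
    then show ?case using snoc prefix_length_less by fastforce
  qed simp
  show ?thesis using le[of w x] le[of "app x w" "- x"] by (simp add: app_neg)
qed

lemma app_Nil [simp]: "app x [] = []"
  using length_app[of x "[]"] by (simp del: length_app)

section \<open>Automorphisms fixing the first level, as triples\<close>

fun tri_fun :: "(vertex \<Rightarrow> vertex) \<Rightarrow> (vertex \<Rightarrow> vertex) \<Rightarrow> (vertex \<Rightarrow> vertex) \<Rightarrow> vertex \<Rightarrow> vertex" where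
  "tri_fun f g h [] = []"
| "tri_fun f g h (L0 # w) = L0 # f w"
| "tri_fun f g h (L1 # w) = L1 # g w"
| "tri_fun f g h (L2 # w) = L2 # h w"

lemma tri_fun_comp: "tri_fun f g h (tri_fun f' g' h' w) = tri_fun (f \<circ> f') (g \<circ> g') (h \<circ> h') w"
  by (cases "(f', g', h', w)" rule: tri_fun.cases) auto

lemma tri_fun_id: "tri_fun id id id w = w"
  by (cases "(id :: vertex \<Rightarrow> vertex, id :: vertex \<Rightarrow> vertex, id :: vertex \<Rightarrow> vertex, w)" rule: tri_fun.cases) (auto simp: id_def)

lift_definition tri :: "tree_aut \<Rightarrow> tree_aut \<Rightarrow> tree_aut \<Rightarrow> tree_aut" is tri_fun
proof -
  fix f g h assume fgh: "f \<in> carrier AutT3" "g \<in> carrier AutT3" "h \<in> carrier AutT3"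
  then have "bij f" "bij g" "bij h" by (auto simp: AutT3_simps)
  then have "tri_fun f g h \<circ> tri_fun (inv_into UNIV f) (inv_into UNIV g) (inv_into UNIV h) = id"
    "tri_fun (inv_into UNIV f) (inv_into UNIV g) (inv_into UNIV h) \<circ> tri_fun f g h = id"
    by (auto simp: fun_eq_iff tri_fun_comp tri_fun_id bij_is_inj surj_iff[THEN iffD1] bij_is_surj)
  then have "bij (tri_fun f g h)" using o_bij by blast
  moreover have "prefix (tri_fun f g h u) (tri_fun f g h v) \<longleftrightarrow> prefix u v" for u v
    using fgh
    by (cases "(f, g, h, u)" rule: tri_fun.cases; cases "(f, g, h, v)" rule: tri_fun.cases)
      (auto simp: AutT3_simps)
  ultimately show "tri_fun f g h \<in> carrier AutT3" by (simp add: AutT3_simps)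
qed

lemma app_tri [simp]:
  "app (tri x y z) (L0 # w) = L0 # app x w"
  "app (tri x y z) (L1 # w) = L1 # app y w"
  "app (tri x y z) (L2 # w) = L2 # app z w"
  by (transfer; simp)+

lemma vertex_cases: obtains "w = []" | v where "w = L0 # v" | v where "w = L1 # v" | v where "w = L2 # v"
  by (cases w rule: gs_b.cases) auto

lemma tri_add: "tri x y z + tri x' y' z' = tri (x + x') (y + y') (z + z')"
  by (transfer, simp add: fun_eq_iff tri_fun_comp)

lemma tri_zero [simp]: "tri 0 0 0 = 0"
  by (transfer, simp add: fun_eq_iff tri_fun_id)

lemma tri_neg: "- tri x y z = tri (- x) (- y) (- z)"
  by (rule minus_unique) (simp add: tri_add)

lemma tri_diff: "tri x y z - tri x' y' z' = tri (x - x') (y - y') (z - z')"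
  by (simp only: diff_conv_add_uminus tri_neg tri_add)

lemma tri_comm: "comm (tri x y z) (tri x' y' z') = tri (comm x x') (comm y y') (comm z z')"
  by (simp only: comm_def tri_add tri_diff)

lemma tri_inject [simp]: "tri x y z = tri x' y' z' \<longleftrightarrow> x = x' \<and> y = y' \<and> z = z'"
proof
  assume *: "tri x y z = tri x' y' z'"
  show "x = x' \<and> y = y' \<and> z = z'"
    using arg_cong[OF *, of "\<lambda>t. app t (L0 # _)"] arg_cong[OF *, of "\<lambda>t. app t (L1 # _)"]
      arg_cong[OF *, of "\<lambda>t. app t (L2 # _)"]
    by (auto intro!: tree_aut_eqI)
qed auto

lift_definition ga :: tree_aut is gs_a by (rule gs_a_in_AutT3)
lift_definition gb :: tree_aut is gs_b by (rule gs_b_in_AutT3)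

lemma app_ga [simp]: "app ga (L0 # w) = L1 # w" "app ga (L1 # w) = L2 # w" "app ga (L2 # w) = L0 # w"
  by (transfer, simp)+

lemma gb_eq: "gb = tri ga (- ga) gb"
proof (rule tree_aut_eqI)
  fix w show "app gb w = app (tri ga (- ga) gb) w"
    by (rule vertex_cases[of w]) (auto simp: gb.rep_eq ga.rep_eq uminus_tree_aut.rep_eq)
qed

lemma ga_order: "ga + (ga + ga) = 0"
proof (rule tree_aut_eqI)
  fix w show "app (ga + (ga + ga)) w = app 0 w"
    by (rule vertex_cases[of w]) (auto simp: app_add app_zero)
qed

lemma ga_double: "ga + ga = - ga"
  using ga_order by (metis minus_unique minus_minus)

text \<open>The recursion for b gives 3 b = (0, 0, 3 b), and induction on the word shows that such
  an element is trivial.\<close>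

lemma gb_order: "gb + (gb + gb) = 0"
proof (rule tree_aut_eqI)
  have *: "gb + (gb + gb) = tri 0 0 (gb + (gb + gb))"
    by (subst (1 2 3) gb_eq) (simp only: tri_add ga_order minus_add[symmetric] ga_double minus_zero left_minus right_minus minus_minus)
  fix w show "app (gb + (gb + gb)) w = app 0 w"
  proof (induction w)
    case (Cons l w)
    then show ?case by (subst *) (cases l, auto simp: app_zero)
  qed simp
qed

lemma ga_tri_conj: "ga + tri x y z - ga = tri z x y"
proof -
  have "ga + tri x y z = tri z x y + ga"
  proof (rule tree_aut_eqI)
    fix w show "app (ga + tri x y z) w = app (tri z x y + ga) w"
      by (rule vertex_cases[of w]) (auto simp: app_add)
  qed
  then show ?thesis by (simp add: add.assoc)
qed

definition tri3 :: "tree_aut set \<Rightarrow> tree_aut set" where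
  "tri3 A = {tri x y z |x y z. x \<in> A \<and> y \<in> A \<and> z \<in> A}"

lemma tri3I: "x \<in> A \<Longrightarrow> y \<in> A \<Longrightarrow> z \<in> A \<Longrightarrow> tri x y z \<in> tri3 A"
  by (auto simp: tri3_def)

lemma tri_in_tri3 [simp]: "tri x y z \<in> tri3 A \<longleftrightarrow> x \<in> A \<and> y \<in> A \<and> z \<in> A"
  by (auto simp: tri3_def)

lemma tri3E: "t \<in> tri3 A \<Longrightarrow> (\<And>x y z. t = tri x y z \<Longrightarrow> x \<in> A \<Longrightarrow> y \<in> A \<Longrightarrow> z \<in> A \<Longrightarrow> P) \<Longrightarrow> P"
  by (auto simp: tri3_def)

lemma is_subgrp_tri3: "is_subgrp A \<Longrightarrow> is_subgrp (tri3 A)"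
proof (rule is_subI)
  assume A: "is_subgrp A"
  show "0 \<in> tri3 A" using tri3I[of 0 A 0 0] is_subgrp_zero[OF A] by simp
  show "x + y \<in> tri3 A" if "x \<in> tri3 A" "y \<in> tri3 A" for x y
    using that A by (auto elim!: tri3E simp: tri_add is_subgrp_add)
  show "- x \<in> tri3 A" if "x \<in> tri3 A" for x
    using that A by (auto elim!: tri3E simp: tri_neg is_subgrp_neg)
qed

section \<open>Branch structure of the Gupta-Sidki group\<close>

definition Gam :: "tree_aut set" where "Gam = gen {ga, gb}"
definition Gam2 :: "tree_aut set" where "Gam2 = lcs Gam 2"
definition Gam3 :: "tree_aut set" where "Gam3 = lcs Gam 3"

lemma is_subgrp_Gam: "is_subgrp Gam" by (simp add: Gam_def is_subgrp_gen)
lemma ga_Gam: "ga \<in> Gam" and gb_Gam: "gb \<in> Gam" by (auto simp: Gam_def intro: gen.incl)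
lemma normal_sub_Gam2: "normal_sub Gam Gam2" and normal_sub_Gam3: "normal_sub Gam Gam3"
  by (simp_all add: Gam2_def Gam3_def normal_sub_lcs is_subgrp_Gam)
lemmas is_subgrp_Gam2 = normal_sub_sub[OF normal_sub_Gam2] and is_subgrp_Gam3 = normal_sub_sub[OF normal_sub_Gam3]
lemma Gam2_Gam: "x \<in> Gam2 \<Longrightarrow> x \<in> Gam" using normal_sub_subset[OF normal_sub_Gam2] by blast
lemma Gam3_Gam2: "x \<in> Gam3 \<Longrightarrow> x \<in> Gam2"
  using lcs_antimono[OF is_subgrp_Gam, of 2 3] by (auto simp: Gam2_def Gam3_def)
lemma Gam3_Gam: "x \<in> Gam3 \<Longrightarrow> x \<in> Gam" by (simp add: Gam2_Gam Gam3_Gam2)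
lemma comm_Gam: "x \<in> Gam \<Longrightarrow> y \<in> Gam \<Longrightarrow> comm x y \<in> Gam2"
  using comm_lcs_Suc[of x Gam 1 y] by (simp add: Gam2_def numeral_2_eq_2)
lemma comm_Gam2: "x \<in> Gam2 \<Longrightarrow> y \<in> Gam \<Longrightarrow> comm x y \<in> Gam3"
  using comm_lcs_Suc[of x Gam 2 y] by (simp add: Gam2_def Gam3_def numeral_2_eq_2 numeral_3_eq_3)
lemma comm_Gam2': "x \<in> Gam \<Longrightarrow> y \<in> Gam2 \<Longrightarrow> comm x y \<in> Gam3"
  using comm_Gam2[of y x] is_subgrp_neg[OF is_subgrp_Gam3] by (metis comm_swap)
lemma Gam3_eq: "Gam3 = gen {comm x y |x y. x \<in> Gam2 \<and> y \<in> Gam}"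
  unfolding Gam3_def Gam2_def numeral_3_eq_3 numeral_2_eq_2 by simp

lemma normal_sub_GamI:
  assumes "is_subgrp N" "N \<subseteq> Gam" "\<And>n. n \<in> N \<Longrightarrow> ga + n - ga \<in> N" "\<And>n. n \<in> N \<Longrightarrow> gb + n - gb \<in> N"
  shows "normal_sub Gam N"
  using assms unfolding Gam_def by (intro normal_sub_gen_order3) (auto simp: ga_order gb_order)

lemma Gam2_subset: "normal_sub Gam N \<Longrightarrow> comm ga gb \<in> N \<Longrightarrow> Gam2 \<subseteq> N"
  unfolding Gam2_def Gam_def by (rule lc2_gen2_subset)

lemma Gam_least: "is_subgrp H \<Longrightarrow> ga \<in> H \<Longrightarrow> gb \<in> H \<Longrightarrow> Gam \<subseteq> H"
  unfolding Gam_def by (rule gen_least) auto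

section \<open>The elements c and u, and subgroups supported on one coordinate\<close>

definition gc :: tree_aut where "gc = comm ga gb"
definition gu :: tree_aut where "gu = comm ga gc"

lemma gc_Gam2: "gc \<in> Gam2" by (simp add: gc_def comm_Gam ga_Gam gb_Gam)
lemma gu_Gam3: "gu \<in> Gam3" by (simp add: gu_def comm_Gam2' ga_Gam gc_Gam2)

lemma gb_conj: "ga + gb - ga = tri gb ga (- ga)"
  by (subst gb_eq) (rule ga_tri_conj)

lemma gc_eq: "gc = tri (gb - ga) (ga + ga) (- ga - gb)"
proof -
  have "gc = tri gb ga (- ga) - tri ga (- ga) gb"
    using gb_eq by (simp add: gc_def comm_def gb_conj)
  then show ?thesis by (simp add: tri_diff)
qed

lemma gu_eq: "gu = tri (- ga - gb - (gb - ga)) gb (ga + ga - (- ga - gb))"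
proof -
  have "gb - ga - (ga + ga) = gb - (ga + (ga + ga))" by (simp only: grp_norm)
  then have "gb - ga - (ga + ga) = gb" by (simp add: ga_order)
  moreover have "gu = (ga + gc - ga) - gc" by (simp add: gu_def comm_def)
  ultimately show ?thesis by (simp add: gc_eq ga_tri_conj tri_diff)
qed

lemma rot_in: "normal_sub Gam N \<Longrightarrow> tri x y z \<in> N \<Longrightarrow> tri z x y \<in> N"
  using normal_sub_conj[of Gam N ga "tri x y z"] ga_Gam by (simp add: ga_tri_conj)

text \<open>Conjugation by a rotates the coordinates, so one coordinate yields all three.\<close>

lemma tri3_subset_if_first:
  assumes N: "normal_sub Gam N" and A: "\<And>t. t \<in> A \<Longrightarrow> tri t 0 0 \<in> N"
  shows "tri3 A \<subseteq> N"
proof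
  fix g assume "g \<in> tri3 A"
  then obtain x y z where g: "g = tri x y z" "x \<in> A" "y \<in> A" "z \<in> A" by (elim tri3E)
  have "tri 0 y 0 \<in> N" using rot_in[OF N A[OF \<open>y \<in> A\<close>]] .
  moreover have "tri 0 0 z \<in> N" using rot_in[OF N rot_in[OF N A[OF \<open>z \<in> A\<close>]]] .
  moreover have "g = tri x 0 0 + (tri 0 y 0 + tri 0 0 z)" using g by (simp add: tri_add)
  ultimately show "g \<in> N" using A[OF \<open>x \<in> A\<close>] is_subgrp_add[OF normal_sub_sub[OF N]] by simp
qed

lemma is_subgrp_first_proj: "is_subgrp N \<Longrightarrow> is_subgrp {x. \<exists>y z. tri x y z \<in> N}"
proof (rule is_subI)
  assume N: "is_subgrp N"
  show "0 \<in> {x. \<exists>y z. tri x y z \<in> N}" using is_subgrp_zero[OF N] by (auto intro!: exI[of _ 0])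
  show "x + x' \<in> {x. \<exists>y z. tri x y z \<in> N}"
    if "x \<in> {x. \<exists>y z. tri x y z \<in> N}" "x' \<in> {x. \<exists>y z. tri x y z \<in> N}" for x x'
    using that is_subgrp_add[OF N] tri_add by (smt (verit) mem_Collect_eq)
  show "- x \<in> {x. \<exists>y z. tri x y z \<in> N}" if "x \<in> {x. \<exists>y z. tri x y z \<in> N}" for x
    using that is_subgrp_neg[OF N] tri_neg by (smt (verit) mem_Collect_eq)
qed

text \<open>The triple b = (a, - a, b) and its rotation (b, a, - a) have the first coordinates a and
  b.\<close>

lemma first_proj_onto:
  assumes N: "normal_sub Gam N" and "gb \<in> N" and x: "x \<in> Gam"
  shows "\<exists>y z. tri x y z \<in> N"
proof -
  have "tri ga (- ga) gb \<in> N" using assms gb_eq by simp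
  then have "Gam \<subseteq> {x. \<exists>y z. tri x y z \<in> N}"
    using rot_in[OF N] by (intro Gam_least is_subgrp_first_proj normal_sub_sub[OF N]) blast+
  then show ?thesis using x by blast
qed

text \<open>By \<open>first_proj_onto\<close>, every g in \<open>Gam\<close> is the first coordinate
  of an element of \<open>Gam\<close>; conjugating (x, 0, 0) by that element conjugates x by
  g.\<close>

lemma normal_sub_first_factor:
  assumes M: "normal_sub Gam M"
  shows "normal_sub Gam {x \<in> Gam. tri x 0 0 \<in> M}"
proof -
  have "is_subgrp {x \<in> Gam. tri x 0 0 \<in> M}"
  proof (rule is_subI)
    show "x + y \<in> {x \<in> Gam. tri x 0 0 \<in> M}"
      if "x \<in> {x \<in> Gam. tri x 0 0 \<in> M}" "y \<in> {x \<in> Gam. tri x 0 0 \<in> M}" for x y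
      using that is_subgrp_add[OF normal_sub_sub[OF M], of "tri x 0 0" "tri y 0 0"] is_subgrp_add[OF is_subgrp_Gam]
      by (simp add: tri_add)
    show "- x \<in> {x \<in> Gam. tri x 0 0 \<in> M}" if "x \<in> {x \<in> Gam. tri x 0 0 \<in> M}" for x
      using that is_subgrp_neg[OF normal_sub_sub[OF M], of "tri x 0 0"] is_subgrp_neg[OF is_subgrp_Gam]
      by (simp add: tri_neg)
  qed (use is_subgrp_zero[OF normal_sub_sub[OF M]] is_subgrp_zero[OF is_subgrp_Gam] in simp)
  moreover have "g + x - g \<in> {x \<in> Gam. tri x 0 0 \<in> M}"
    if g: "g \<in> Gam" and x: "x \<in> {x \<in> Gam. tri x 0 0 \<in> M}" for g x
  proof -
    obtain y z where "tri g y z \<in> Gam"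
      using first_proj_onto[OF normal_sub_self[OF is_subgrp_Gam] gb_Gam g] by blast
    then have "tri g y z + tri x 0 0 - tri g y z \<in> M" using normal_sub_conj[OF M] x by blast
    then show ?thesis using normal_sub_conj[OF normal_sub_self[OF is_subgrp_Gam] g] x by (simp add: tri_add tri_diff)
  qed
  ultimately show ?thesis by (auto simp: normal_sub_def)
qed

text \<open>The sum of b and its conjugate by a is (a + b, 0, b - a). Because of the zero, its
  commutator with its own rotation is ([a + b, b - a], 0, 0), and \<open>comm_conj_right\<close>
  puts this into \<open>Gam3\<close>. As a + b and b - a generate \<open>Gam\<close>, their
  commutator generates \<open>Gam2\<close> as a normal subgroup.\<close>

lemma tri3_Gam2_Gam3: "tri3 Gam2 \<subseteq> Gam3"
proof -
  let ?p = "gb + (ga + gb - ga)"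
  let ?x = "ga + gb" and ?y = "gb - ga"
  have p: "?p = tri ?x 0 ?y"
    by (subst (1) gb_eq, subst gb_conj) (simp add: tri_add)
  have pG: "?p \<in> Gam" using is_subgrp_Gam ga_Gam gb_Gam by (simp add: is_subgrp_rules)
  have "comm ?p (ga + ?p - ga) = comm ?p (comm ga ?p)"
    by (rule comm_conj_right)
  also have "\<dots> \<in> Gam3" using pG ga_Gam by (intro comm_Gam2' comm_Gam)
  finally have "tri (comm ?x ?y) 0 0 \<in> Gam3"
    unfolding p ga_tri_conj tri_comm by simp
  moreover have xy: "?x \<in> Gam" "?y \<in> Gam" using is_subgrp_Gam ga_Gam gb_Gam by (simp_all add: is_subgrp_rules)
  ultimately have c: "comm ?x ?y \<in> {x \<in> Gam. tri x 0 0 \<in> Gam3}"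
    using comm_Gam Gam2_Gam by blast
  have eq: "gen {?x, ?y} = Gam"
  proof
    show "gen {?x, ?y} \<subseteq> Gam" using xy by (intro gen_least is_subgrp_Gam) auto
    have S: "is_subgrp (gen {?x, ?y})" by (rule is_subgrp_gen)
    have x: "?x \<in> gen {?x, ?y}" and y: "?y \<in> gen {?x, ?y}" by (auto intro: gen.incl)
    have "?y + ?x = gb + gb" by (simp only: grp_norm)
    moreover have "- (gb + gb) = gb" using gb_order by (metis minus_unique minus_minus add.assoc)
    ultimately have b: "gb \<in> gen {?x, ?y}" using is_subgrp_neg[OF S is_subgrp_add[OF S y x]] by simp
    then have "ga \<in> gen {?x, ?y}" using is_subgrp_diff[OF S x b] by simp
    with b show "Gam \<subseteq> gen {?x, ?y}" by (intro Gam_least S)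
  qed
  have "Gam2 \<subseteq> {x \<in> Gam. tri x 0 0 \<in> Gam3}"
    using lc2_gen2_subset[of ?x ?y "{x \<in> Gam. tri x 0 0 \<in> Gam3}", OF _ c] normal_sub_first_factor[OF normal_sub_Gam3]
    by (simp only: eq Gam2_def)
  then show ?thesis by (intro tri3_subset_if_first normal_sub_Gam3) auto
qed

lemma tri3_Gam2_Gam2: "tri3 Gam2 \<subseteq> Gam2"
  using tri3_Gam2_Gam3 Gam3_Gam2 by blast

section \<open>Exponents modulo the terms of the lower central series\<close>

text \<open>\<open>ab_class p x y\<close> says \<open>p \<equiv> x a + y b\<close> modulo \<open>Gam2\<close>, \<open>c_class p x\<close> says \<open>p \<equiv> x c\<close> modulo \<open>Gam3\<close>, and
  \<open>cu_class g i k\<close> says \<open>g \<equiv> i c + k u\<close> modulo \<open>tri3 Gam2\<close>, the last one expressed through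
  \<open>c \<equiv> (b - a, - a, - a - b)\<close> and \<open>u \<equiv> (b, b, b)\<close>. These are relations because the integer exponents are
  only determined modulo \<open>3\<close>.\<close>

inductive ab_class :: "tree_aut \<Rightarrow> int \<Rightarrow> int \<Rightarrow> bool" where
  a: "ab_class ga 1 0"
| b: "ab_class gb 0 1"
| comm: "g \<in> Gam2 \<Longrightarrow> ab_class g 0 0"
| add: "ab_class p x y \<Longrightarrow> ab_class q x' y' \<Longrightarrow> ab_class (p + q) (x + x') (y + y')"
| neg: "ab_class p x y \<Longrightarrow> ab_class (- p) (- x) (- y)"

inductive c_class :: "tree_aut \<Rightarrow> int \<Rightarrow> bool" where
  c: "c_class gc 1"
| comm: "g \<in> Gam3 \<Longrightarrow> c_class g 0"
| add: "c_class p x \<Longrightarrow> c_class q x' \<Longrightarrow> c_class (p + q) (x + x')"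
| neg: "c_class p x \<Longrightarrow> c_class (- p) (- x)"

definition cu_class :: "tree_aut \<Rightarrow> int \<Rightarrow> int \<Rightarrow> bool" where
  "cu_class g i k \<longleftrightarrow> (\<exists>p q r. g = tri p q r \<and> ab_class p (- i) (i + k) \<and> ab_class q (- i) k \<and> ab_class r (- i) (k - i))"

lemma ab_class_cong: "ab_class p x y \<Longrightarrow> x = x' \<Longrightarrow> y = y' \<Longrightarrow> ab_class p x' y'"
  and c_class_cong: "c_class q x \<Longrightarrow> x = x' \<Longrightarrow> c_class q x'"
  by simp_all

lemma ab_class_diff: "ab_class p x y \<Longrightarrow> ab_class q x' y' \<Longrightarrow> ab_class (p - q) (x - x') (y - y')"
  using ab_class.add[OF _ ab_class.neg, of p x y q x' y'] by simp

lemma c_class_diff: "c_class p x \<Longrightarrow> c_class q x' \<Longrightarrow> c_class (p - q) (x - x')"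
  using c_class.add[OF _ c_class.neg, of p x q x'] by simp

lemma ab_class_Gam: "ab_class p x y \<Longrightarrow> p \<in> Gam"
  by (induction rule: ab_class.induct) (auto simp: ga_Gam gb_Gam Gam2_Gam is_subgrp_rules[OF is_subgrp_Gam])

lemma c_class_Gam2: "c_class p x \<Longrightarrow> p \<in> Gam2"
  by (induction rule: c_class.induct) (auto simp: gc_Gam2 Gam3_Gam2 is_subgrp_rules[OF is_subgrp_Gam2])

lemma ab_class_zero_elem: "ab_class 0 0 0"
  by (simp add: ab_class.comm is_subgrp_zero[OF is_subgrp_Gam2])

lemma ab_class_ex: assumes "p \<in> Gam" shows "\<exists>x y. ab_class p x y"
  using assms unfolding Gam_def
proof induction
  case zero
  then show ?case using ab_class_zero_elem by blast
next
  case (incl x)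
  then show ?case using ab_class.a ab_class.b by blast
next
  case (add x y)
  then show ?case by (elim exE) (rule exI, rule exI, rule ab_class.add)
next
  case (neg x)
  then show ?case by (elim exE) (rule exI, rule exI, rule ab_class.neg)
qed

lemma ab_class_conj: assumes "ab_class p x y" "h \<in> Gam" shows "ab_class (h + p - h) x y"
  using ab_class.add[OF ab_class.comm[OF comm_Gam[OF assms(2) ab_class_Gam[OF assms(1)]]] assms(1)]
  by (simp add: conj_eq_comm)

lemma c_class_conj: assumes "c_class p x" "h \<in> Gam" shows "c_class (h + p - h) x"
  using c_class.add[OF c_class.comm[OF comm_Gam2'[OF assms(2) c_class_Gam2[OF assms(1)]]] assms(1)]
  by (simp add: conj_eq_comm)

lemma ab_class_3_0: "ab_class 0 3 0" and ab_class_0_3: "ab_class 0 0 3"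
  using ab_class.add[OF ab_class.a ab_class.add[OF ab_class.a ab_class.a]] ab_class.add[OF ab_class.b ab_class.add[OF ab_class.b ab_class.b]]
  by (simp_all add: ga_order gb_order)

lemma ab_class_shift: "ab_class p x y \<Longrightarrow> ab_class p (x + 3 * m) (y + 3 * n)"
proof -
  assume p: "ab_class p x y"
  have 1: "ab_class 0 (3 * m) 0" for m
  proof (induction m rule: int_induct[of _ 0])
    case (step1 i) show ?case by (rule ab_class_cong[OF ab_class.add[OF step1(2) ab_class_3_0, unfolded add_0_left]]) auto
  next
    case (step2 i) show ?case by (rule ab_class_cong[OF ab_class_diff[OF step2(2) ab_class_3_0, unfolded diff_0_right]]) auto
  qed (use ab_class_zero_elem in simp)
  have 2: "ab_class 0 0 (3 * m)" for m
  proof (induction m rule: int_induct[of _ 0])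
    case (step1 i) show ?case by (rule ab_class_cong[OF ab_class.add[OF step1(2) ab_class_0_3, unfolded add_0_left]]) auto
  next
    case (step2 i) show ?case by (rule ab_class_cong[OF ab_class_diff[OF step2(2) ab_class_0_3, unfolded diff_0_right]]) auto
  qed (use ab_class_zero_elem in simp)
  show ?thesis using ab_class.add[OF ab_class.add[OF p 1] 2] by simp
qed

lemma ab_class_mod: assumes "ab_class p x y" "3 dvd x' - x" "3 dvd y' - y" shows "ab_class p x' y'"
proof -
  obtain m n where "x' - x = 3 * m" "y' - y = 3 * n" using assms by (elim dvdE)
  then show ?thesis by (intro ab_class_cong[OF ab_class_shift[OF assms(1), of m n]]) auto
qed

text \<open>Soundness of the relation: each of its rules respects the normal form x a + y b modulo
  \<open>Gam2\<close>. In particular the exponents (0, 0) force membership in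
  \<open>Gam2\<close>.\<close>

lemma ab_class_zm: assumes "ab_class p x y" shows "- (zm x ga + zm y gb) + p \<in> Gam2"
proof -
  let ?A = "\<lambda>x. zm x ga" and ?B = "\<lambda>y. zm y gb"
  define R where "R p q \<longleftrightarrow> - p + q \<in> Gam2" for p q
  note G = is_subgrp_rules[OF is_subgrp_Gam]
  have AB: "?A x \<in> Gam" "?B x \<in> Gam" for x
    by (simp_all add: zm_in is_subgrp_Gam ga_Gam gb_Gam)
  have refl: "R p p" for p by (simp add: R_def is_subgrp_zero[OF is_subgrp_Gam2])
  have trans: "R p r" if "R p q" "R q r" for p q r
    using is_subgrp_add[OF is_subgrp_Gam2 that[unfolded R_def]] by (simp add: R_def add.assoc)
  have R_add: "R (p + q) (p' + q')" if "R p p'" "R q q'" "q \<in> Gam" for p q p' q'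
  proof -
    have "- (p + q) + (p' + q') = (- q + (- p + p') + q) + (- q + q')" by (simp only: grp_norm)
    then show ?thesis
      using that normal_sub_conj'[OF normal_sub_Gam2 is_subgrp_Gam] is_subgrp_add[OF is_subgrp_Gam2] by (simp add: R_def)
  qed
  have R_neg: "R (- p) (- p')" if "R p p'" "p \<in> Gam" for p p'
  proof -
    have "- (- p) + - p' = p + - (- p + p') - p" by (simp only: grp_norm)
    then show ?thesis
      using that normal_sub_conj[OF normal_sub_Gam2] is_subgrp_neg[OF is_subgrp_Gam2] unfolding R_def by metis
  qed
  have R_comm: "R (p + q) (q + p)" if "p \<in> Gam" "q \<in> Gam" for p q
  proof -
    have "- (p + q) + (q + p) = comm (- q) (- p)" by (simp only: comm_def grp_norm)
    then show ?thesis using that by (simp add: R_def comm_Gam G)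
  qed
  have "R (?A x + ?B y) p"
    using assms
  proof induction
    case (add p x y q x' y')
    have "R (?A x + ((?A x' + ?B y) + ?B y')) (?A x + ((?B y + ?A x') + ?B y'))"
      by (rule R_add[OF refl R_add[OF R_comm refl]]) (simp_all add: G AB)
    then have "R (?A (x + x') + ?B (y + y')) ((?A x + ?B y) + (?A x' + ?B y'))"
      by (simp only: zm_add add.assoc)
    moreover have "R ((?A x + ?B y) + (?A x' + ?B y')) (p + q)"
      by (rule R_add[OF add.IH]) (simp add: G AB)
    ultimately show ?case by (rule trans)
  next
    case (neg p x y)
    have "R (- ?A x + - ?B y) (- ?B y + - ?A x)" by (intro R_comm) (simp_all add: G AB)
    then have "R (- ?A x + - ?B y) (- (?A x + ?B y))" by (simp only: minus_add)
    moreover have "R (- (?A x + ?B y)) (- p)" using neg.IH by (intro R_neg) (simp_all add: G AB)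
    ultimately show ?case unfolding zm_neg by (rule trans)
  qed (simp_all add: R_def is_subgrp_zero[OF is_subgrp_Gam2])
  then show ?thesis by (simp add: R_def)
qed

lemma ab_class_zero: "ab_class p 0 0 \<Longrightarrow> p \<in> Gam2"
  using ab_class_zm[of p 0 0] by simp

lemma ab_class_unique: "ab_class p x y \<Longrightarrow> ab_class q x y \<Longrightarrow> - p + q \<in> Gam2"
  using ab_class.add[OF ab_class.neg, of p x y q x y] by (simp add: ab_class_zero)

lemma c_class_zm: assumes "c_class p x" shows "- zm x gc + p \<in> Gam3"
  using assms
proof induction
  case (add p x q x')
  let ?n = "- zm x gc + p" and ?m = "- zm x' gc + q"
  have q: "- zm x' gc \<in> Gam" by (simp add: zm_in is_subgrp_Gam gc_Gam2 Gam2_Gam is_subgrp_neg)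
  have "- zm (x + x') gc + (p + q) = (- zm x' gc + ?n - - zm x' gc) + ?m"
    unfolding zm_add by (simp only: grp_norm)
  then show ?case using add.IH normal_sub_conj[OF normal_sub_Gam3 q] is_subgrp_add[OF is_subgrp_Gam3] by metis
next
  case (neg p x)
  let ?n = "- zm x gc + p"
  have q: "zm x gc \<in> Gam" by (simp add: zm_in is_subgrp_Gam gc_Gam2 Gam2_Gam)
  have "- zm (- x) gc + - p = zm x gc + - ?n - zm x gc"
    unfolding zm_neg by (simp only: grp_norm)
  then show ?case using neg.IH normal_sub_conj[OF normal_sub_Gam3 q] is_subgrp_neg[OF is_subgrp_Gam3] by metis
qed (simp_all add: is_subgrp_zero[OF is_subgrp_Gam3])

lemma c_class_zero: "c_class p 0 \<Longrightarrow> p \<in> Gam3"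
  using c_class_zm[of p 0] by simp

lemma c_class_ex: assumes "p \<in> Gam2" shows "\<exists>x. c_class p x"
proof -
  have "normal_sub Gam {p. \<exists>x. c_class p x}"
  proof (rule normal_sub_GamI)
    show "is_subgrp {p. \<exists>x. c_class p x}"
    proof (rule is_subI; clarify)
      show "\<exists>x. c_class 0 x" using c_class.comm is_subgrp_zero[OF is_subgrp_Gam3] by blast
      show "\<exists>x. c_class (p + q) x" if "c_class p x" "c_class q y" for p q x y using c_class.add[OF that] by blast
      show "\<exists>x. c_class (- p) x" if "c_class p x" for p x using c_class.neg[OF that] by blast
    qed
    show "{p. \<exists>x. c_class p x} \<subseteq> Gam" using c_class_Gam2 Gam2_Gam by blast
  qed (use c_class_conj ga_Gam gb_Gam in blast)+
  then show ?thesis using Gam2_subset c_class.c assms unfolding gc_def by blast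
qed

lemma c_class_comm_ga: "ab_class q x y \<Longrightarrow> c_class (comm ga q) y"
proof (induction rule: ab_class.induct)
  case (add p x y q x' y')
  then show ?case using c_class.add[OF _ c_class_conj] ab_class_Gam by (auto simp: comm_add_right)
next
  case (neg p x y)
  then show ?case using c_class_conj[OF c_class.neg[OF neg.IH], of "- p"] ab_class_Gam[OF neg.hyps]
    by (simp add: comm_neg_right is_subgrp_neg[OF is_subgrp_Gam])
qed (use c_class.c c_class.comm is_subgrp_zero[OF is_subgrp_Gam3] comm_Gam2' ga_Gam in \<open>auto simp: gc_def\<close>)

lemma c_class_comm_gb: "ab_class q x y \<Longrightarrow> c_class (comm gb q) (- x)"
proof (induction rule: ab_class.induct)
  case a
  then show ?case using c_class.neg[OF c_class.c] by (simp add: gc_def comm_swap[of gb ga])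
next
  case (add p x y q x' y')
  then show ?case using c_class.add[OF add.IH(1) c_class_conj[OF add.IH(2)]] ab_class_Gam by (auto simp: comm_add_right)
next
  case (neg p x y)
  then show ?case using c_class_conj[OF c_class.neg[OF neg.IH], of "- p"] ab_class_Gam[OF neg.hyps]
    by (simp add: comm_neg_right is_subgrp_neg[OF is_subgrp_Gam])
qed (use c_class.comm is_subgrp_zero[OF is_subgrp_Gam3] comm_Gam2' gb_Gam in auto)

text \<open>Modulo \<open>Gam3\<close> the commutator is bilinear and alternating with [a, b] = c,
  so the exponent is a determinant.\<close>

lemma c_class_comm: "ab_class p x y \<Longrightarrow> ab_class q x' y' \<Longrightarrow> c_class (comm p q) (x * y' - y * x')"
proof (induction rule: ab_class.induct)
  case a then show ?case using c_class_comm_ga by simp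
next
  case b then show ?case using c_class_comm_gb by simp
next
  case comm then show ?case using comm_Gam2 ab_class_Gam c_class.comm by simp
next
  case (add p x y p' x'' y'')
  have "c_class (p + comm p' q - p + comm p q) ((x'' * y' - y'' * x') + (x * y' - y * x'))"
    using add ab_class_Gam by (intro c_class.add c_class_conj) auto
  then show ?case unfolding comm_add_left by (rule c_class_cong) (simp add: algebra_simps)
next
  case (neg p x y)
  have "c_class (- p + - comm p q - - p) (- (x * y' - y * x'))"
    using neg ab_class_Gam by (intro c_class.neg c_class_conj is_subgrp_neg[OF is_subgrp_Gam]) auto
  then show ?case unfolding comm_neg_left diff_minus_eq_add by (rule c_class_cong) simp
qed


lemma cu_classE:
  assumes "cu_class g i k"
  obtains p q r where "g = tri p q r" "ab_class p (- i) (i + k)" "ab_class q (- i) k" "ab_class r (- i) (k - i)"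
  using assms by (auto simp: cu_class_def)

lemma cu_classI:
  "g = tri p q r \<Longrightarrow> ab_class p (- i) (i + k) \<Longrightarrow> ab_class q (- i) k \<Longrightarrow> ab_class r (- i) (k - i) \<Longrightarrow> cu_class g i k"
  by (auto simp: cu_class_def)

lemma cu_class_add: assumes "cu_class g i k" "cu_class g' i' k'" shows "cu_class (g + g') (i + i') (k + k')"
proof -
  obtain p q r where g: "g = tri p q r" "ab_class p (- i) (i + k)" "ab_class q (- i) k" "ab_class r (- i) (k - i)"
    using assms(1) by (rule cu_classE)
  obtain p' q' r' where g': "g' = tri p' q' r'" "ab_class p' (- i') (i' + k')" "ab_class q' (- i') k'" "ab_class r' (- i') (k' - i')"
    using assms(2) by (rule cu_classE)
  show ?thesis
    by (rule cu_classI[OF _ ab_class_cong[OF ab_class.add[OF g(2) g'(2)]] ab_class_cong[OF ab_class.add[OF g(3) g'(3)]]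
      ab_class_cong[OF ab_class.add[OF g(4) g'(4)]]]) (simp_all add: g(1) g'(1) tri_add)
qed

lemma cu_class_neg: assumes "cu_class g i k" shows "cu_class (- g) (- i) (- k)"
proof -
  obtain p q r where g: "g = tri p q r" "ab_class p (- i) (i + k)" "ab_class q (- i) k" "ab_class r (- i) (k - i)"
    using assms(1) by (rule cu_classE)
  show ?thesis
    by (rule cu_classI[OF _ ab_class_cong[OF ab_class.neg[OF g(2)]] ab_class_cong[OF ab_class.neg[OF g(3)]] ab_class_cong[OF ab_class.neg[OF g(4)]]])
      (simp_all add: g(1) tri_neg)
qed

lemma cu_class_diff: "cu_class g i k \<Longrightarrow> cu_class g' i' k' \<Longrightarrow> cu_class (g - g') (i - i') (k - k')"
  using cu_class_add[OF _ cu_class_neg, of g i k g' i' k'] by simp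

text \<open>Conjugation by a sends c to c + u and fixes u modulo \<open>tri3 Gam2\<close>. The
  coordinate that wraps around from the last place to the first fits because 3 b = 0.\<close>

lemma cu_class_rot: assumes "cu_class g i k" shows "cu_class (ga + g - ga) i (k + i)"
proof -
  obtain p q r where g: "g = tri p q r" "ab_class p (- i) (i + k)" "ab_class q (- i) k" "ab_class r (- i) (k - i)"
    using assms by (auto simp: cu_class_def)
  have r: "ab_class r (- i) (i + (k + i))" by (rule ab_class_cong[OF ab_class_shift[OF g(4), of 0 i]]) auto
  show ?thesis
    by (rule cu_classI[OF _ r ab_class_cong[OF g(2)] ab_class_cong[OF g(3)]]) (simp_all add: g(1) ga_tri_conj)
qed

lemma cu_class_conj_tri:
  assumes "cu_class g i k" "s = tri x y z" "x \<in> Gam" "y \<in> Gam" "z \<in> Gam"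
  shows "cu_class (s + g - s) i k"
proof -
  obtain p q r where g: "g = tri p q r" "ab_class p (- i) (i + k)" "ab_class q (- i) k" "ab_class r (- i) (k - i)"
    using assms(1) by (auto simp: cu_class_def)
  then show ?thesis using assms by (auto simp: cu_class_def tri_add tri_diff intro!: ab_class_conj)
qed

lemma cu_class_conj_gb: "cu_class g i k \<Longrightarrow> cu_class (gb + g - gb) i k"
  by (erule cu_class_conj_tri[OF _ gb_eq]) (simp_all add: ga_Gam gb_Gam is_subgrp_neg[OF is_subgrp_Gam])

lemma cu_class_gc: "cu_class gc 1 0"
proof -
  have "ab_class (gb - ga) (-1) 1" using ab_class_diff[OF ab_class.b ab_class.a] by simp
  moreover have "ab_class (ga + ga) (-1) 0" using ab_class_shift[OF ab_class.add[OF ab_class.a ab_class.a], of "-1" 0] by simp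
  moreover have "ab_class (- ga - gb) (-1) (-1)" using ab_class_diff[OF ab_class.neg[OF ab_class.a] ab_class.b] by simp
  ultimately show ?thesis by (auto simp: cu_class_def gc_eq)
qed

lemma cu_class_gu: "cu_class gu 0 1"
  using cu_class_diff[OF cu_class_rot[OF cu_class_gc] cu_class_gc] by (simp add: gu_def comm_def)

lemma cu_class_zero_iff: "cu_class g 0 0 \<longleftrightarrow> g \<in> tri3 Gam2"
proof
  assume "cu_class g 0 0"
  then show "g \<in> tri3 Gam2" by (rule cu_classE) (simp add: ab_class_zero)
next
  assume "g \<in> tri3 Gam2"
  then show "cu_class g 0 0" by (elim tri3E) (intro cu_classI, auto intro: ab_class.comm)
qed

lemma cu_class_zero: "cu_class 0 0 0"
  unfolding cu_class_def using ab_class_zero_elem by (intro exI[of _ 0]) simp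

text \<open>Both arguments are triples over \<open>Gam\<close>, so their commutator has all
  coordinates in \<open>Gam2\<close>.\<close>

lemma comm_cu_class_tri:
  assumes "cu_class e i k" "s = tri x y z" "x \<in> Gam" "y \<in> Gam" "z \<in> Gam"
  shows "cu_class (comm s e) 0 0"
proof -
  obtain p q r where e: "e = tri p q r" "ab_class p (- i) (i + k)" "ab_class q (- i) k" "ab_class r (- i) (k - i)"
    using assms(1) by (auto simp: cu_class_def)
  then show ?thesis using assms ab_class_Gam by (auto simp: cu_class_zero_iff tri_comm intro!: comm_Gam)
qed

lemma comm_cu_class_gb: "cu_class e i k \<Longrightarrow> cu_class (comm gb e) 0 0"
  by (erule comm_cu_class_tri[OF _ gb_eq]) (simp_all add: ga_Gam gb_Gam is_subgrp_neg[OF is_subgrp_Gam])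

lemma comm_cu_class_cu_class: assumes "cu_class e i k" "cu_class t i' k'" shows "cu_class (comm t e) 0 0"
proof -
  obtain p q r where "t = tri p q r" "p \<in> Gam" "q \<in> Gam" "r \<in> Gam"
    using assms(2) ab_class_Gam by (elim cu_classE) blast
  then show ?thesis using comm_cu_class_tri[OF assms(1)] by blast
qed

lemma cu_class_ex: assumes "g \<in> Gam2" shows "\<exists>i k. cu_class g i k"
proof -
  let ?N = "{g \<in> Gam. \<exists>i k. cu_class g i k}"
  have "normal_sub Gam ?N"
  proof (rule normal_sub_GamI)
    show "is_subgrp ?N"
    proof (rule is_subI)
      show "0 \<in> ?N" using cu_class_zero is_subgrp_zero[OF is_subgrp_Gam] by blast
      show "x + y \<in> ?N" if "x \<in> ?N" "y \<in> ?N" for x y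
        using that cu_class_add[of x _ _ y] is_subgrp_add[OF is_subgrp_Gam] by (simp, blast)
      show "- x \<in> ?N" if "x \<in> ?N" for x
        using that cu_class_neg[of x] is_subgrp_neg[OF is_subgrp_Gam] by auto
    qed
    show "ga + n - ga \<in> ?N" if "n \<in> ?N" for n
      using that cu_class_rot[of n] normal_sub_conj[OF normal_sub_self[OF is_subgrp_Gam] ga_Gam] by auto
    show "gb + n - gb \<in> ?N" if "n \<in> ?N" for n
      using that cu_class_conj_gb[of n] normal_sub_conj[OF normal_sub_self[OF is_subgrp_Gam] gb_Gam] by auto
  qed simp
  moreover have "comm ga gb \<in> ?N"
    using cu_class_gc gc_Gam2 Gam2_Gam unfolding gc_def by auto
  ultimately have "Gam2 \<subseteq> ?N" by (rule Gam2_subset)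
  then show ?thesis using assms by blast
qed

text \<open>\<open>Gam3\<close> is generated as a normal subgroup by [c, a] = - u and by [c, b],
  which vanishes modulo \<open>tri3 Gam2\<close>; neither involves c.\<close>

lemma cu_class_ex_Gam3: assumes "g \<in> Gam3" shows "\<exists>k. cu_class g 0 k"
proof -
  let ?N = "{g \<in> Gam. \<exists>k. cu_class g 0 k}"
  have "normal_sub Gam ?N"
  proof (rule normal_sub_GamI)
    show "is_subgrp ?N"
    proof (rule is_subI)
      show "0 \<in> ?N" using cu_class_zero is_subgrp_zero[OF is_subgrp_Gam] by blast
      show "x + y \<in> ?N" if "x \<in> ?N" "y \<in> ?N" for x y
        using that cu_class_add[of x 0 _ y 0] is_subgrp_add[OF is_subgrp_Gam] by auto
      show "- x \<in> ?N" if "x \<in> ?N" for x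
        using that cu_class_neg[of x 0] is_subgrp_neg[OF is_subgrp_Gam] by auto
    qed
    show "ga + n - ga \<in> ?N" if "n \<in> ?N" for n
      using that cu_class_rot[of n 0] normal_sub_conj[OF normal_sub_self[OF is_subgrp_Gam] ga_Gam] by auto
    show "gb + n - gb \<in> ?N" if "n \<in> ?N" for n
      using that cu_class_conj_gb[of n 0] normal_sub_conj[OF normal_sub_self[OF is_subgrp_Gam] gb_Gam] by auto
  qed simp
  moreover have "comm gc ga \<in> ?N"
    using cu_class_neg[OF cu_class_gu] gu_Gam3 Gam3_Gam is_subgrp_neg[OF is_subgrp_Gam]
    by (auto simp: comm_swap[of gc ga] gu_def)
  moreover have "comm gc gb \<in> ?N"
    using cu_class_neg[OF comm_cu_class_gb[OF cu_class_gc]] comm_Gam[OF Gam2_Gam[OF gc_Gam2] gb_Gam] Gam2_Gam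
    by (auto simp: comm_swap[of gc gb])
  ultimately have "Gam3 \<subseteq> ?N"
    unfolding Gam3_def Gam_def gc_def by (intro lc3_gen2_subset)
  then show ?thesis using assms by blast
qed

text \<open>Multiples of u are central modulo \<open>tri3 Gam2\<close>: rotation fixes (b, b, b),
  and b is itself a triple over \<open>Gam\<close>. Conjugation by \<open>- h\<close> is carried
  along so that the admissible h form a subgroup.\<close>

lemma cu_class0_conj: assumes "h \<in> Gam" "cu_class g 0 k" shows "cu_class (h + g - h) 0 k"
proof -
  let ?H = "{h. \<forall>g. cu_class g 0 k \<longrightarrow> cu_class (h + g - h) 0 k \<and> cu_class (- h + g + h) 0 k}"
  have inv: "- x + g + x = x + (x + g - x) - x" if "x + (x + x) = 0" for x g :: tree_aut
  proof -
    have "- x = x + x" using that by (rule minus_unique)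
    then have "- x + g + x = (x + x) + g - (x + x)"
      by (simp only: \<open>- x = x + x\<close>[symmetric] diff_minus_eq_add)
    also have "\<dots> = x + (x + g - x) - x" by (simp only: grp_norm)
    finally show ?thesis .
  qed
  have "is_subgrp ?H"
  proof (rule is_subI; clarify)
    fix g assume "cu_class g 0 k"
    then show "cu_class (0 + g - 0) 0 k \<and> cu_class (- 0 + g + 0) 0 k" by simp
  next
    fix x y g
    assume x: "\<forall>g. cu_class g 0 k \<longrightarrow> cu_class (x + g - x) 0 k \<and> cu_class (- x + g + x) 0 k"
      and y: "\<forall>g. cu_class g 0 k \<longrightarrow> cu_class (y + g - y) 0 k \<and> cu_class (- y + g + y) 0 k" and g: "cu_class g 0 k"
    have "cu_class (x + (y + g - y) - x) 0 k" "cu_class (- y + (- x + g + x) + y) 0 k" using x y g by blast+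
    moreover have "x + y + g - (x + y) = x + (y + g - y) - x"
      "- (x + y) + g + (x + y) = - y + (- x + g + x) + y"
      by (simp_all only: grp_norm)
    ultimately show "cu_class (x + y + g - (x + y)) 0 k \<and> cu_class (- (x + y) + g + (x + y)) 0 k" by metis
  next
    fix x g
    assume "\<forall>g. cu_class g 0 k \<longrightarrow> cu_class (x + g - x) 0 k \<and> cu_class (- x + g + x) 0 k" "cu_class g 0 k"
    then have "cu_class (x + g - x) 0 k" "cu_class (- x + g + x) 0 k" by blast+
    then show "cu_class (- x + g - - x) 0 k \<and> cu_class (- (- x) + g + - x) 0 k"
      by (simp only: diff_conv_add_uminus minus_minus simp_thms)
  qed
  moreover have "ga \<in> ?H" using inv[OF ga_order] cu_class_rot[of _ 0 k] by simp
  moreover have "gb \<in> ?H" using inv[OF gb_order] cu_class_conj_gb[of _ 0 k] by simp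
  ultimately have "Gam \<subseteq> ?H" by (rule Gam_least)
  then show ?thesis using assms by blast
qed

lemma cu_class_comm_ga: "c_class e j \<Longrightarrow> cu_class (comm ga e) 0 j"
proof (induction rule: c_class.induct)
  case c then show ?case using cu_class_gu by (simp add: gu_def)
next
  case (comm g)
  then obtain k where "cu_class g 0 k" using cu_class_ex_Gam3 by blast
  then show ?case using cu_class_diff[OF cu_class_rot, of g 0 k g 0 k] by (simp add: comm_def)
next
  case (add p x q x')
  then show ?case using cu_class_add[OF add.IH(1) cu_class0_conj[OF _ add.IH(2)]] c_class_Gam2 Gam2_Gam
    by (auto simp: comm_add_right)
next
  case (neg p x)
  then show ?case using cu_class0_conj[OF _ cu_class_neg[OF neg.IH, simplified], of "- p"] c_class_Gam2[OF neg.hyps] Gam2_Gam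
    by (simp add: comm_neg_right is_subgrp_neg[OF is_subgrp_Gam])
qed

text \<open>Only [a, c] = u contributes, because b and the elements of \<open>Gam2\<close> are
  triples over \<open>Gam\<close> and commute with \<open>e\<close> modulo
  \<open>tri3 Gam2\<close>.\<close>

lemma cu_class_comm: "ab_class v x y \<Longrightarrow> c_class e j \<Longrightarrow> cu_class (comm v e) 0 (x * j)"
proof (induction rule: ab_class.induct)
  case a then show ?case using cu_class_comm_ga by simp
next
  case b then show ?case using comm_cu_class_gb cu_class_ex[OF c_class_Gam2] by fastforce
next
  case (comm g) then show ?case using comm_cu_class_cu_class cu_class_ex c_class_Gam2 by (metis mult_zero_left)
next
  case (add p x y p' x'' y'')
  have "cu_class (p + comm p' e - p + comm p e) (0 + 0) (x'' * j + x * j)"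
    using add ab_class_Gam by (intro cu_class_add cu_class0_conj) auto
  then show ?case unfolding comm_add_left by (simp only: add_0_left distrib_right add.commute[of "x'' * j"])
next
  case (neg p x y)
  have "cu_class (- p + - comm p e - - p) 0 (- (x * j))"
    using neg ab_class_Gam cu_class_neg[of "comm p e" 0] by (intro cu_class0_conj is_subgrp_neg[OF is_subgrp_Gam]) auto
  then show ?case by (simp add: comm_neg_left)
qed

lemma c_class_zm_gc: "c_class (zm j gc) j"
proof (induction j rule: int_induct[of _ 0])
  case (step2 i)
  have "zm (i - 1) gc = - gc + zm i gc" using zm_succ[of "i - 1" gc] by simp
  then show ?case using c_class.add[OF c_class.neg[OF c_class.c] step2(2)] by simp
next
  case (step1 i)
  then show ?case using c_class.add[OF c_class.c step1(2)] by (simp add: zm_succ add.commute[of 1])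
qed (simp add: c_class.comm is_subgrp_zero[OF is_subgrp_Gam3])

lemma cu_class_zm: "cu_class g i k \<Longrightarrow> cu_class (zm j g) (j * i) (j * k)"
proof (induction j rule: int_induct[of _ 0])
  case (step2 j)
  have "zm (j - 1) g = - g + zm j g" using zm_succ[of "j - 1" g] by simp
  then show ?case using cu_class_add[OF cu_class_neg[OF step2(3)] step2(2)[OF step2(3)]] by (simp add: left_diff_distrib)
next
  case (step1 j)
  then show ?case unfolding zm_succ
    using cu_class_add[OF step1(3) step1(2)[OF step1(3)]] by (simp add: distrib_right add.commute)
qed (simp add: cu_class_zero)

section \<open>One step of the approximation\<close>

text \<open>The elements whose a-exponent is invertible modulo 3: the commutator with such an
  element carries the exponent of c bijectively to the exponent of u.\<close>

definition a_units :: "tree_aut set" where "a_units = {v. \<exists>y. ab_class v 1 y \<or> ab_class v (- 1) y}"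
definition b_coset :: "tree_aut set" where "b_coset = {v. ab_class v 0 1}"

text \<open>Membership of \<open>- g + z\<close> in \<open>K'\<close> means that z is g modulo
  \<open>K'\<close>. The choice of \<open>e\<close> precedes its error \<open>t\<close>, as a word
  reaches \<open>e\<close> only modulo \<open>J\<close>.\<close>

definition J_step :: "tree_aut set \<Rightarrow> tree_aut set \<Rightarrow> tree_aut set \<Rightarrow> tree_aut set \<Rightarrow> tree_aut set \<Rightarrow> bool" where
  "J_step P Q K J K' \<longleftrightarrow> (\<forall>v\<in>P. \<forall>g\<in>Q. \<exists>e\<in>K. \<forall>t\<in>J. - g + comm v (e + t) \<in> K')"

text \<open>The quantifiers follow the order in which words are found: \<open>e\<close> with an
  error in \<open>K'\<close>, then \<open>w\<close> with an error in the coarser \<open>J\<close>,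
  then \<open>f\<close> with an error in \<open>K'\<close>. Each later element may depend on the
  earlier errors.\<close>

definition K_step :: "tree_aut set \<Rightarrow> tree_aut set \<Rightarrow> tree_aut set \<Rightarrow> tree_aut set \<Rightarrow> tree_aut set \<Rightarrow> bool" where
  "K_step P K J K' J' \<longleftrightarrow> (\<forall>v\<in>P. \<forall>g\<in>K'. \<exists>e\<in>K. \<forall>t\<in>K'. \<exists>w\<in>K. \<forall>s\<in>J. \<exists>f\<in>J. \<forall>r\<in>K'.
     - g + (comm v (e + t) + comm (w + s) (f + r)) \<in> J')"

lemma cu_class_add_tri3: "cu_class g i k \<Longrightarrow> t \<in> tri3 Gam2 \<Longrightarrow> cu_class (g + t) i k"
  using cu_class_add[of g i k t 0 0] by (simp add: cu_class_zero_iff)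

text \<open>If \<open>v\<close> has the a-exponent x, which is 1 or -1, then \<open>e\<close> with
  c-exponent x k gives the u-exponent x x k = k. An error in \<open>Gam3\<close> leaves the
  c-exponent of \<open>e\<close> unchanged.\<close>

lemma J_step_base: "J_step a_units Gam3 Gam2 Gam3 (tri3 Gam2)"
  unfolding J_step_def
proof (intro ballI)
  fix v g assume "v \<in> a_units" "g \<in> Gam3"
  obtain x y where v: "ab_class v x y" "x * x = 1"
    using \<open>v \<in> a_units\<close> unfolding a_units_def by force
  obtain k where k: "cu_class g 0 k" using cu_class_ex_Gam3[OF \<open>g \<in> Gam3\<close>] by blast
  let ?e = "zm (x * k) gc"
  show "\<exists>e\<in>Gam2. \<forall>t\<in>Gam3. - g + comm v (e + t) \<in> tri3 Gam2"
  proof (intro bexI[of _ ?e] ballI)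
    show "?e \<in> Gam2" by (simp add: zm_in is_subgrp_Gam2 gc_Gam2)
    fix t assume "t \<in> Gam3"
    then have "c_class (?e + t) (x * k)" using c_class.add[OF c_class_zm_gc c_class.comm] by fastforce
    then have "cu_class (comm v (?e + t)) 0 (x * (x * k))" using cu_class_comm v by blast
    moreover have "x * (x * k) = k" using v(2) by (metis mult.assoc mult_1_left)
    ultimately have "cu_class (- g + comm v (?e + t)) 0 0" using cu_class_add[OF cu_class_neg[OF k]] by fastforce
    then show "- g + comm v (?e + t) \<in> tri3 Gam2" by (simp add: cu_class_zero_iff)
  qed
qed

text \<open>Modulo \<open>tri3 Gam3\<close>, the commutator of \<open>b + i c + l u\<close> and \<open>j c + k u\<close> has the \<open>c\<close>-exponents
  \<open>(j + k, - k, j) + (l j - i k) (1, 1, 1)\<close>, and the commutator of \<open>c + k' u\<close> and \<open>m u\<close> has the exponents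
  \<open>- m (1, 1, 1)\<close>. These span all triples.\<close>

lemma K_step_base: "K_step b_coset Gam2 Gam3 (tri3 Gam2) (tri3 Gam3)"
  unfolding K_step_def
proof (intro ballI)
  fix v g assume v: "v \<in> b_coset" and g: "g \<in> tri3 Gam2"
  have "ab_class (- gb + v) 0 0" using ab_class.add[OF ab_class.neg[OF ab_class.b], of v 0 1] v by (simp add: b_coset_def)
  then obtain i l where "cu_class (- gb + v) i l" using ab_class_zero cu_class_ex by blast
  then obtain p q r where "- gb + v = tri p q r"
    and d: "ab_class p (- i) (i + l)" "ab_class q (- i) l" "ab_class r (- i) (l - i)" by (rule cu_classE)
  then have "v = gb + tri p q r" by (metis add_minus_cancel)
  also have "\<dots> = tri (ga + p) (- ga + q) (gb + r)" by (subst gb_eq) (simp only: tri_add)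
  finally have v_eq: "v = tri (ga + p) (- ga + q) (gb + r)" .
  have v0: "ab_class (ga + p) (1 - i) (i + l)" by (rule ab_class_cong[OF ab_class.add[OF ab_class.a d(1)]]) auto
  have v1: "ab_class (- ga + q) (- 1 - i) l" by (rule ab_class_cong[OF ab_class.add[OF ab_class.neg[OF ab_class.a] d(2)]]) auto
  have v2: "ab_class (gb + r) (- i) (1 + l - i)" by (rule ab_class_cong[OF ab_class.add[OF ab_class.b d(3)]]) auto
  obtain g0 g1 g2 where g_eq: "g = tri g0 g1 g2" and "g0 \<in> Gam2" "g1 \<in> Gam2" "g2 \<in> Gam2"
    using g by (rule tri3E)
  then obtain t0 t1 t2 where gt: "c_class g0 t0" "c_class g1 t1" "c_class g2 t2" using c_class_ex by metis
  \<comment> \<open>The integer solution of t0 = j + k + d, t1 = - k + d, t2 = j + d with d = l j -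
    i k - m: t0 - t2 gives k, t2 - t1 gives j + k, and the last equation gives m. The unknown error
    of \<open>v\<close> against b, with exponents i and l, enters only through m.\<close>
  define k j where "k = t0 - t2" and "j = t2 - t1 - k"
  define m where "m = l * j - i * k + j - t2"
  let ?e = "zm j gc + zm k gu" and ?f = "zm m gu"
  have e_V: "cu_class ?e j k" using cu_class_add[OF cu_class_zm[OF cu_class_gc, of j] cu_class_zm[OF cu_class_gu, of k]] by simp
  have f_V: "cu_class ?f 0 m" using cu_class_zm[OF cu_class_gu, of m] by simp
  show "\<exists>e\<in>Gam2. \<forall>t\<in>tri3 Gam2. \<exists>w\<in>Gam2. \<forall>s\<in>Gam3. \<exists>f\<in>Gam3. \<forall>r\<in>tri3 Gam2.
     - g + (comm v (e + t) + comm (w + s) (f + r)) \<in> tri3 Gam3"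
  proof (rule bexI[of _ ?e], rule ballI, rule bexI[of _ gc], rule ballI, rule bexI[of _ ?f], rule ballI)
    show "?e \<in> Gam2"
      by (intro is_subgrp_add[OF is_subgrp_Gam2] zm_in is_subgrp_Gam2 gc_Gam2 Gam3_Gam2[OF gu_Gam3])
    show "gc \<in> Gam2" by (rule gc_Gam2)
    show "?f \<in> Gam3" by (intro zm_in is_subgrp_Gam3 gu_Gam3)
    fix t s r' assume t: "t \<in> tri3 Gam2" and s: "s \<in> Gam3" and r': "r' \<in> tri3 Gam2"
    obtain e0 e1 e2 where e: "?e + t = tri e0 e1 e2" "ab_class e0 (- j) (j + k)" "ab_class e1 (- j) k" "ab_class e2 (- j) (k - j)"
      using cu_class_add_tri3[OF e_V t] by (rule cu_classE)
    obtain f0 f1 f2 where f: "?f + r' = tri f0 f1 f2" "ab_class f0 (- 0) (0 + m)" "ab_class f1 (- 0) m" "ab_class f2 (- 0) (m - 0)"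
      using cu_class_add_tri3[OF f_V r'] by (rule cu_classE)
    obtain k' where "cu_class (gc + s) (1 + 0) (0 + k')" using cu_class_add[OF cu_class_gc] cu_class_ex_Gam3[OF s] by blast
    then obtain w0 w1 w2 where w: "gc + s = tri w0 w1 w2" "ab_class w0 (- (1 + 0)) (1 + 0 + (0 + k'))"
      "ab_class w1 (- (1 + 0)) (0 + k')" "ab_class w2 (- (1 + 0)) (0 + k' - (1 + 0))"
      by (rule cu_classE)
    have 0: "c_class (- g0 + (comm (ga + p) e0 + comm w0 f0)) 0"
      by (rule c_class_cong[OF c_class.add[OF c_class.neg[OF gt(1)] c_class.add[OF c_class_comm[OF v0 e(2)] c_class_comm[OF w(2) f(2)]]]])
        (simp add: k_def j_def m_def algebra_simps)
    have 1: "c_class (- g1 + (comm (- ga + q) e1 + comm w1 f1)) 0"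
      by (rule c_class_cong[OF c_class.add[OF c_class.neg[OF gt(2)] c_class.add[OF c_class_comm[OF v1 e(3)] c_class_comm[OF w(3) f(3)]]]])
        (simp add: k_def j_def m_def algebra_simps)
    have 2: "c_class (- g2 + (comm (gb + r) e2 + comm w2 f2)) 0"
      by (rule c_class_cong[OF c_class.add[OF c_class.neg[OF gt(3)] c_class.add[OF c_class_comm[OF v2 e(4)] c_class_comm[OF w(4) f(4)]]]])
        (simp add: k_def j_def m_def algebra_simps)
    show "- g + (comm v (?e + t) + comm (gc + s) (?f + r')) \<in> tri3 Gam3"
      unfolding e(1) f(1) w(1) v_eq g_eq
      by (simp only: tri_comm tri_add tri_neg tri_in_tri3 c_class_zero[OF 0] c_class_zero[OF 1] c_class_zero[OF 2] simp_thms)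
  qed
qed

text \<open>Sums, commutators and memberships of triples are coordinatewise, so the witnesses are
  chosen in each coordinate independently.\<close>

lemma J_step_tri3:
  assumes "J_step P Q K J K'" shows "J_step (tri3 P) (tri3 Q) (tri3 K) (tri3 J) (tri3 K')"
  unfolding J_step_def
proof (intro ballI)
  fix v g assume "v \<in> tri3 P" "g \<in> tri3 Q"
  then obtain v0 v1 v2 g0 g1 g2 where v: "v = tri v0 v1 v2" "v0 \<in> P" "v1 \<in> P" "v2 \<in> P"
    and g: "g = tri g0 g1 g2" "g0 \<in> Q" "g1 \<in> Q" "g2 \<in> Q" by (elim tri3E)
  note S = assms[unfolded J_step_def, rule_format]
  obtain e0 where e0: "e0 \<in> K" "\<And>t. t \<in> J \<Longrightarrow> - g0 + comm v0 (e0 + t) \<in> K'" using S[OF v(2) g(2)] by blast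
  obtain e1 where e1: "e1 \<in> K" "\<And>t. t \<in> J \<Longrightarrow> - g1 + comm v1 (e1 + t) \<in> K'" using S[OF v(3) g(3)] by blast
  obtain e2 where e2: "e2 \<in> K" "\<And>t. t \<in> J \<Longrightarrow> - g2 + comm v2 (e2 + t) \<in> K'" using S[OF v(4) g(4)] by blast
  show "\<exists>e\<in>tri3 K. \<forall>t\<in>tri3 J. - g + comm v (e + t) \<in> tri3 K'"
    by (rule bexI[of _ "tri e0 e1 e2"])
      (auto simp: v(1) g(1) e0 e1 e2 tri_add tri_neg tri_comm elim!: tri3E)
qed

lemma K_step_tri3:
  assumes "K_step P K J K' J'" shows "K_step (tri3 P) (tri3 K) (tri3 J) (tri3 K') (tri3 J')"
  unfolding K_step_def
proof (intro ballI)
  fix v g assume "v \<in> tri3 P" "g \<in> tri3 K'"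
  then obtain v0 v1 v2 g0 g1 g2 where v: "v = tri v0 v1 v2" "v0 \<in> P" "v1 \<in> P" "v2 \<in> P"
    and g: "g = tri g0 g1 g2" "g0 \<in> K'" "g1 \<in> K'" "g2 \<in> K'" by (elim tri3E)
  define R where "R g v e t w s f r \<longleftrightarrow> - g + (comm v (e + t) + comm (w + s) (f + r)) \<in> J'" for g v e t w s f r
  have S: "\<exists>e\<in>K. \<forall>t\<in>K'. \<exists>w\<in>K. \<forall>s\<in>J. \<exists>f\<in>J. \<forall>r\<in>K'. R g v e t w s f r" if "v \<in> P" "g \<in> K'" for v g
    using assms that unfolding K_step_def R_def by blast
  obtain e0 where e0: "e0 \<in> K" "\<And>t. t \<in> K' \<Longrightarrow> \<exists>w\<in>K. \<forall>s\<in>J. \<exists>f\<in>J. \<forall>r\<in>K'. R g0 v0 e0 t w s f r"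
    using S[OF v(2) g(2)] by blast
  obtain e1 where e1: "e1 \<in> K" "\<And>t. t \<in> K' \<Longrightarrow> \<exists>w\<in>K. \<forall>s\<in>J. \<exists>f\<in>J. \<forall>r\<in>K'. R g1 v1 e1 t w s f r"
    using S[OF v(3) g(3)] by blast
  obtain e2 where e2: "e2 \<in> K" "\<And>t. t \<in> K' \<Longrightarrow> \<exists>w\<in>K. \<forall>s\<in>J. \<exists>f\<in>J. \<forall>r\<in>K'. R g2 v2 e2 t w s f r"
    using S[OF v(4) g(4)] by blast
  show "\<exists>e\<in>tri3 K. \<forall>t\<in>tri3 K'. \<exists>w\<in>tri3 K. \<forall>s\<in>tri3 J. \<exists>f\<in>tri3 J. \<forall>r\<in>tri3 K'.
     - g + (comm v (e + t) + comm (w + s) (f + r)) \<in> tri3 J'"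
  proof (rule bexI[of _ "tri e0 e1 e2"], rule ballI)
    show "tri e0 e1 e2 \<in> tri3 K" using e0 e1 e2 by simp
    fix t assume "t \<in> tri3 K'"
    then obtain t0 t1 t2 where t: "t = tri t0 t1 t2" "t0 \<in> K'" "t1 \<in> K'" "t2 \<in> K'" by (elim tri3E)
    obtain w0 where w0: "w0 \<in> K" "\<And>s. s \<in> J \<Longrightarrow> \<exists>f\<in>J. \<forall>r\<in>K'. R g0 v0 e0 t0 w0 s f r" using e0(2)[OF t(2)] by blast
    obtain w1 where w1: "w1 \<in> K" "\<And>s. s \<in> J \<Longrightarrow> \<exists>f\<in>J. \<forall>r\<in>K'. R g1 v1 e1 t1 w1 s f r" using e1(2)[OF t(3)] by blast
    obtain w2 where w2: "w2 \<in> K" "\<And>s. s \<in> J \<Longrightarrow> \<exists>f\<in>J. \<forall>r\<in>K'. R g2 v2 e2 t2 w2 s f r" using e2(2)[OF t(4)] by blast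
    show "\<exists>w\<in>tri3 K. \<forall>s\<in>tri3 J. \<exists>f\<in>tri3 J. \<forall>r\<in>tri3 K'.
      - g + (comm v (tri e0 e1 e2 + t) + comm (w + s) (f + r)) \<in> tri3 J'"
    proof (rule bexI[of _ "tri w0 w1 w2"], rule ballI)
      show "tri w0 w1 w2 \<in> tri3 K" using w0 w1 w2 by simp
      fix s assume "s \<in> tri3 J"
      then obtain s0 s1 s2 where s: "s = tri s0 s1 s2" "s0 \<in> J" "s1 \<in> J" "s2 \<in> J" by (elim tri3E)
      obtain f0 where f0: "f0 \<in> J" "\<And>r. r \<in> K' \<Longrightarrow> R g0 v0 e0 t0 w0 s0 f0 r" using w0(2)[OF s(2)] by blast
      obtain f1 where f1: "f1 \<in> J" "\<And>r. r \<in> K' \<Longrightarrow> R g1 v1 e1 t1 w1 s1 f1 r" using w1(2)[OF s(3)] by blast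
      obtain f2 where f2: "f2 \<in> J" "\<And>r. r \<in> K' \<Longrightarrow> R g2 v2 e2 t2 w2 s2 f2 r" using w2(2)[OF s(4)] by blast
      show "\<exists>f\<in>tri3 J. \<forall>r\<in>tri3 K'.
        - g + (comm v (tri e0 e1 e2 + t) + comm (tri w0 w1 w2 + s) (f + r)) \<in> tri3 J'"
      proof (rule bexI[of _ "tri f0 f1 f2"], rule ballI)
        show "tri f0 f1 f2 \<in> tri3 J" using f0 f1 f2 by simp
        fix r assume "r \<in> tri3 K'"
        then obtain r0 r1 r2 where r: "r = tri r0 r1 r2" "r0 \<in> K'" "r1 \<in> K'" "r2 \<in> K'" by (elim tri3E)
        show "- g + (comm v (tri e0 e1 e2 + t) + comm (tri w0 w1 w2 + s) (tri f0 f1 f2 + r)) \<in> tri3 J'"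
          using f0(2)[OF r(2)] f1(2)[OF r(3)] f2(2)[OF r(4)]
          unfolding R_def by (simp add: v g t s r tri_add tri_neg tri_comm)
      qed
    qed
  qed
qed

section \<open>The steps and their seed elements at level m\<close>

abbreviation level2 :: "nat \<Rightarrow> tree_aut set" where "level2 m \<equiv> (tri3 ^^ m) Gam2"
abbreviation level3 :: "nat \<Rightarrow> tree_aut set" where "level3 m \<equiv> (tri3 ^^ m) Gam3"

lemma J_step_level: "J_step ((tri3 ^^ m) a_units) (level3 m) (level2 m) (level3 m) (level2 (Suc m))"
proof (induction m)
  case 0 then show ?case using J_step_base by simp
next
  case (Suc m)
  then show ?case using J_step_tri3[OF Suc] by simp
qed

lemma K_step_level: "K_step ((tri3 ^^ m) b_coset) (level2 m) (level3 m) (level2 (Suc m)) (level3 (Suc m))"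
proof (induction m)
  case 0 then show ?case using K_step_base by simp
next
  case (Suc m)
  then show ?case using K_step_tri3[OF Suc] by simp
qed

text \<open>A word that reaches the witness only modulo \<open>N\<close> is already an element of
  \<open>T\<close>; thus the words of one level provide the \<open>v\<close> of the next.\<close>

definition seed :: "tree_aut set \<Rightarrow> tree_aut set \<Rightarrow> tree_aut set \<Rightarrow> bool" where
  "seed P N T \<longleftrightarrow> (\<exists>v\<in>P. \<forall>t\<in>N. v + t \<in> T)"

lemma seed_tri3: "seed P N T \<Longrightarrow> seed (tri3 P) (tri3 N) (tri3 T)"
  unfolding seed_def
proof (elim bexE)
  fix v assume v: "v \<in> P" "\<forall>t\<in>N. v + t \<in> T"
  then show "\<exists>v\<in>tri3 P. \<forall>t\<in>tri3 N. v + t \<in> tri3 T"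
    by (intro bexI[of _ "tri v v v"]) (auto simp: tri_add elim!: tri3E)
qed

text \<open>Diagonal copies of c: each coordinate of c has the a-exponent -1 modulo 3, and an error
  in \<open>Gam3\<close> affects only the exponent of u.\<close>

lemma seed_a_units: "seed (level2 m) (level3 m) ((tri3 ^^ Suc m) a_units)"
proof (induction m)
  case 0
  have "gc + t \<in> tri3 a_units" if "t \<in> Gam3" for t
  proof -
    obtain k where "cu_class (gc + t) (1 + 0) (0 + k)" using cu_class_add[OF cu_class_gc] cu_class_ex_Gam3[OF \<open>t \<in> Gam3\<close>] by blast
    then show ?thesis by (rule cu_classE) (auto simp: a_units_def)
  qed
  then show ?case using gc_Gam2 by (auto simp: seed_def)
next
  case (Suc m)
  then show ?case using seed_tri3[OF Suc] by simp
qed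

text \<open>Diagonal copies of u, which is (b, b, b) modulo \<open>tri3 Gam2\<close>.\<close>

lemma seed_b_coset: "seed (level3 m) (level2 (Suc m)) ((tri3 ^^ Suc m) b_coset)"
proof (induction m)
  case 0
  have "gu + t \<in> tri3 b_coset" if "t \<in> tri3 Gam2" for t
    using cu_class_add_tri3[OF cu_class_gu that] by (rule cu_classE) (auto simp: b_coset_def)
  then show ?case using gu_Gam3 by (auto simp: seed_def)
next
  case (Suc m)
  then show ?case using seed_tri3[OF Suc] by simp
qed

section \<open>Geometric powers inside the lower central series\<close>

definition commgen :: "'a::group_add set \<Rightarrow> 'a set \<Rightarrow> 'a set" where
  "commgen A B = gen {comm x y |x y. x \<in> A \<and> y \<in> B}"

lemma commgenI: "x \<in> A \<Longrightarrow> y \<in> B \<Longrightarrow> comm x y \<in> commgen A B"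
  unfolding commgen_def by (rule gen.incl) blast

lemma is_subgrp_commgen: "is_subgrp (commgen A B)"
  by (simp add: commgen_def is_subgrp_gen)

lemma normal_sub_commgen:
  assumes G: "is_subgrp G" and A: "normal_sub G A" and B: "normal_sub G B"
  shows "normal_sub G (commgen A B)"
  unfolding commgen_def
proof (rule normal_sub_gen[OF G])
  show "{comm x y |x y. x \<in> A \<and> y \<in> B} \<subseteq> G"
    using normal_sub_subset[OF A] normal_sub_subset[OF B] is_subgrp_comm[OF G] by blast
  fix g z assume g: "g \<in> G" and "z \<in> {comm x y |x y. x \<in> A \<and> y \<in> B}"
  then obtain x y where z: "z = comm x y" "x \<in> A" "y \<in> B" by auto
  show "g + z - g \<in> gen {comm x y |x y. x \<in> A \<and> y \<in> B}"
    unfolding z(1) conj_comm commgen_def[symmetric]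
    by (intro commgenI normal_sub_conj[OF A g] normal_sub_conj[OF B g] z)
qed

lemma commgen_lcs:
  assumes "is_subgrp G" "i \<ge> 1" "j \<ge> 1" "A \<subseteq> lcs G i" "B \<subseteq> lcs G j"
  shows "commgen A B \<subseteq> lcs G (i + j)"
  unfolding commgen_def
  using assms comm_lcs[OF assms(1,2,3)] by (intro gen_least is_subgrp_lcs) auto

lemma normal_sub_tri3_Gam2: "normal_sub Gam (tri3 Gam2)"
proof -
  have "tri3 Gam2 \<subseteq> Gam" using tri3_Gam2_Gam2 Gam2_Gam by blast
  moreover have "g + n - g \<in> tri3 Gam2" if "g \<in> Gam" "n \<in> tri3 Gam2" for g n
    using cu_class0_conj[OF that(1)] that(2) by (simp add: cu_class_zero_iff[symmetric])
  ultimately show ?thesis by (simp add: normal_sub_def is_subgrp_tri3 is_subgrp_Gam2)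
qed

lemma gen_first_factor:
  assumes M: "is_subgrp M" and t: "t \<in> gen A" and A: "\<And>x. x \<in> A \<Longrightarrow> tri x 0 0 \<in> M"
  shows "tri t 0 0 \<in> M"
  using t
proof induction
  case zero
  then show ?case using is_subgrp_zero[OF M] by simp
next
  case (incl x)
  then show ?case by (rule A)
next
  case (add x y)
  then show ?case using is_subgrp_add[OF M add.IH] by (simp add: tri_add)
next
  case (neg x)
  then show ?case using is_subgrp_neg[OF M neg.IH] by (simp add: tri_neg)
qed

lemma first_Gam2: "x \<in> Gam2 \<Longrightarrow> tri x 0 0 \<in> tri3 Gam2"
  by (simp add: is_subgrp_zero[OF is_subgrp_Gam2])

text \<open>Among the first coordinates of c and its rotations are b - a and 2 a = - a, which
  generate \<open>Gam\<close>.\<close>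

lemma first_proj_Gam2: assumes "h \<in> Gam" shows "\<exists>y z. tri h y z \<in> Gam2"
proof -
  let ?H = "{x. \<exists>y z. tri x y z \<in> Gam2}"
  have H: "is_subgrp ?H" by (rule is_subgrp_first_proj[OF is_subgrp_Gam2])
  have c: "tri (gb - ga) (ga + ga) (- ga - gb) \<in> Gam2" using gc_Gam2 by (simp add: gc_eq)
  have "gb - ga \<in> ?H" using c by blast
  moreover have "ga + ga \<in> ?H" using rot_in[OF normal_sub_Gam2 rot_in[OF normal_sub_Gam2 c]] by blast
  then have "ga \<in> ?H" using is_subgrp_neg[OF H, of "ga + ga"] by (simp only: ga_double minus_minus)
  ultimately have "ga \<in> ?H" "gb \<in> ?H" using is_subgrp_add[OF H, of "gb - ga" ga] by simp_all
  then have "Gam \<subseteq> ?H" by (intro Gam_least H)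
  then show ?thesis using assms by blast
qed

text \<open>An element of \<open>Gam2\<close> with first coordinate h has the commutator ([h, x], 0,
  0) with (x, 0, 0). Since h is arbitrary in \<open>Gam\<close> and x in \<open>Gam2\<close>, these
  fill \<open>Gam3\<close> in the first coordinate.\<close>

lemma J_commgen_base: "tri3 Gam3 \<subseteq> commgen Gam2 (tri3 Gam2)"
proof (rule tri3_subset_if_first)
  show "normal_sub Gam (commgen Gam2 (tri3 Gam2))"
    by (rule normal_sub_commgen[OF is_subgrp_Gam normal_sub_Gam2 normal_sub_tri3_Gam2])
  fix t assume "t \<in> Gam3"
  then show "tri t 0 0 \<in> commgen Gam2 (tri3 Gam2)"
    unfolding Gam3_eq
  proof (rule gen_first_factor[OF is_subgrp_commgen], clarify)
    fix x h assume x: "x \<in> Gam2" and "h \<in> Gam"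
    then obtain y z where h: "tri h y z \<in> Gam2" using first_proj_Gam2 by blast
    have "- comm (tri h y z) (tri x 0 0) \<in> commgen Gam2 (tri3 Gam2)"
      by (intro is_subgrp_neg[OF is_subgrp_commgen] commgenI h first_Gam2 x)
    then show "tri (comm x h) 0 0 \<in> commgen Gam2 (tri3 Gam2)"
      by (simp add: tri_comm tri_neg comm_swap[of x h])
  qed
qed

lemma c_class_0_3: "c_class 0 3"
  using c_class_comm[OF ab_class_3_0 ab_class.b] by simp

text \<open>Two levels are descended at once. If \<open>B\<close> consists of the first coordinates
  of elements of \<open>Gam3\<close>, it suffices that \<open>tri3 Gam2\<close> lies in the
  commutator subgroup \<open>M\<close> of \<open>B\<close> and \<open>Gam2\<close>. First
  \<open>tri3 Gam3\<close> is placed in \<open>M\<close> as in \<open>J_commgen_base\<close>; then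
  [b, c] supplies the rest modulo \<open>tri3 Gam3\<close>.\<close>

lemma K_commgen_base: "tri3 (tri3 Gam2) \<subseteq> commgen Gam3 (tri3 Gam2)"
proof (rule tri3_subset_if_first)
  show "normal_sub Gam (commgen Gam3 (tri3 Gam2))"
    by (rule normal_sub_commgen[OF is_subgrp_Gam normal_sub_Gam3 normal_sub_tri3_Gam2])
  define B where "B = {h \<in> Gam. \<exists>y z. tri h y z \<in> Gam3}"
  define M where "M = commgen B Gam2"
  have B: "normal_sub Gam B"
  proof -
    have "is_subgrp B"
      using is_subgrp_first_proj[OF is_subgrp_Gam3] is_subgrp_Gam unfolding B_def is_subgrp_def by blast
    moreover have "g + h - g \<in> B" if g: "g \<in> Gam" and h: "h \<in> B" for g h
    proof -
      obtain y z where "tri h y z \<in> Gam3" using h by (auto simp: B_def)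
      moreover obtain y' z' where "tri g y' z' \<in> Gam2" using first_proj_Gam2[OF g] by blast
      ultimately have "tri g y' z' + tri h y z - tri g y' z' \<in> Gam3"
        using normal_sub_conj[OF normal_sub_Gam3] Gam2_Gam by blast
      then show ?thesis
        using g h normal_sub_conj[OF normal_sub_self[OF is_subgrp_Gam] g] by (auto simp: B_def tri_add tri_diff)
    qed
    ultimately show ?thesis by (auto simp: normal_sub_def B_def)
  qed
  \<comment> \<open>The middle coordinate of u is exactly b; two rotations bring it to the
    front.\<close>
  have "gb \<in> B"
    using rot_in[OF normal_sub_Gam3 rot_in[OF normal_sub_Gam3 gu_Gam3[unfolded gu_eq]]] gb_Gam
    by (auto simp: B_def)
  have M: "normal_sub Gam M" unfolding M_def by (rule normal_sub_commgen[OF is_subgrp_Gam B normal_sub_Gam2])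
  have 1: "tri3 Gam3 \<subseteq> M"
  proof (rule tri3_subset_if_first[OF M])
    fix t assume "t \<in> Gam3"
    then show "tri t 0 0 \<in> M"
      unfolding Gam3_eq
    proof (rule gen_first_factor[OF normal_sub_sub[OF M]], clarify)
      fix x h assume x: "x \<in> Gam2" and "h \<in> Gam"
      then obtain y z where h: "tri h y z \<in> B" using first_proj_onto[OF B \<open>gb \<in> B\<close>] by blast
      have "tri x 0 0 \<in> Gam2" using first_Gam2[OF x] tri3_Gam2_Gam2 by blast
      then have "- comm (tri h y z) (tri x 0 0) \<in> M"
        unfolding M_def by (intro is_subgrp_neg[OF is_subgrp_commgen] commgenI h)
      then show "tri (comm x h) 0 0 \<in> M"
        by (simp add: tri_comm tri_neg comm_swap[of x h])
    qed
  qed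
  have "tri gc 0 0 \<in> M"
  proof -
    let ?p = "comm ga (gb - ga)" and ?q = "comm (- ga) (ga + ga)" and ?r = "comm gb (- ga - gb)"
    have p: "c_class ?p 1" by (rule c_class_cong[OF c_class_comm[OF ab_class.a ab_class_diff[OF ab_class.b ab_class.a]]]) simp
    have q: "c_class ?q 0" by (rule c_class_cong[OF c_class_comm[OF ab_class.neg[OF ab_class.a] ab_class.add[OF ab_class.a ab_class.a]]]) simp
    have r: "c_class ?r 1" by (rule c_class_cong[OF c_class_comm[OF ab_class.b ab_class_diff[OF ab_class.neg[OF ab_class.a] ab_class.b]]]) simp
    have "comm gb gc \<in> M" unfolding M_def by (intro commgenI \<open>gb \<in> B\<close> gc_Gam2)
    moreover have "comm gb gc = tri ?p ?q ?r"
      by (subst gb_eq, subst gc_eq) (rule tri_comm)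
    ultimately have w: "tri ?p ?q ?r \<in> M" by simp
    \<comment> \<open>The c-exponents of [b, c] are (1, 0, 1). Adding the rotation (1, 1, 0) and
      subtracting the rotation (0, 1, 1) leaves (2, 0, 0), and 2 = -1 modulo 3, so adding c in the
      first coordinate cancels it.\<close>
    have "tri ?p ?q ?r + tri ?r ?p ?q - tri ?q ?r ?p \<in> M"
      by (intro is_subgrp_diff[OF normal_sub_sub[OF M]] is_subgrp_add[OF normal_sub_sub[OF M]] w rot_in[OF M])
    then have 2: "tri (?p + ?r - ?q) (?q + ?p - ?r) (?r + ?q - ?p) \<in> M"
      by (simp only: tri_add tri_diff)
    have "c_class (?q + ?p - ?r) 0" by (rule c_class_cong[OF c_class_diff[OF c_class.add[OF q p] r]]) simp
    moreover have "c_class (?r + ?q - ?p) 0" by (rule c_class_cong[OF c_class_diff[OF c_class.add[OF r q] p]]) simp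
    moreover have "c_class (?p + ?r - ?q + gc) 0"
      by (rule c_class_cong[OF c_class_diff[OF c_class.add[OF c_class_diff[OF c_class.add[OF p r] q] c_class.c] c_class_0_3, unfolded diff_0_right]]) simp
    ultimately have "tri (?p + ?r - ?q + gc) (?q + ?p - ?r) (?r + ?q - ?p) \<in> M"
      using 1 c_class_zero by auto
    from is_subgrp_add[OF normal_sub_sub[OF M] is_subgrp_neg[OF normal_sub_sub[OF M] 2] this]
    show ?thesis by (simp only: tri_neg tri_add minus_add_cancel left_minus)
  qed
  then have "Gam2 \<subseteq> {x \<in> Gam. tri x 0 0 \<in> M}"
    using gc_Gam2 Gam2_Gam by (intro Gam2_subset normal_sub_first_factor M) (simp add: gc_def)
  then have 3: "tri3 Gam2 \<subseteq> M" by (intro tri3_subset_if_first[OF M]) auto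
  \<comment> \<open>Now the outer level: t is built from commutators [h, x] with h in
    \<open>B\<close>, and h is the first coordinate of an element of \<open>Gam3\<close>.\<close>
  fix t assume "t \<in> tri3 Gam2"
  then have "t \<in> gen {comm x y |x y. x \<in> B \<and> y \<in> Gam2}" using 3 by (auto simp: M_def commgen_def)
  then show "tri t 0 0 \<in> commgen Gam3 (tri3 Gam2)"
  proof (rule gen_first_factor[OF is_subgrp_commgen], clarify)
    fix h x assume "h \<in> B" and x: "x \<in> Gam2"
    then obtain y z where "tri h y z \<in> Gam3" by (auto simp: B_def)
    then have "comm (tri h y z) (tri x 0 0) \<in> commgen Gam3 (tri3 Gam2)"
      by (intro commgenI first_Gam2 x)
    then show "tri (comm h x) 0 0 \<in> commgen Gam3 (tri3 Gam2)"
      by (simp add: tri_comm)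
  qed
qed

lemma commgen_tri3:
  assumes "A \<subseteq> commgen B C" "0 \<in> B" "0 \<in> C"
  shows "tri3 A \<subseteq> commgen (tri3 B) (tri3 C)"
proof
  let ?M = "commgen (tri3 B) (tri3 C)"
  have M: "is_subgrp ?M" by (rule is_subgrp_commgen)
  have *: "tri t 0 0 \<in> ?M \<and> tri 0 t 0 \<in> ?M \<and> tri 0 0 t \<in> ?M" if "t \<in> A" for t
  proof -
    have "t \<in> gen {comm x y |x y. x \<in> B \<and> y \<in> C}" using that assms by (auto simp: commgen_def)
    then show ?thesis
    proof induction
      case zero
      then show ?case using is_subgrp_zero[OF M] by simp
    next
      case (incl t)
      then obtain x y where t: "t = comm x y" "x \<in> B" "y \<in> C" by auto
      have "comm (tri x 0 0) (tri y 0 0) \<in> ?M" "comm (tri 0 x 0) (tri 0 y 0) \<in> ?M"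
        "comm (tri 0 0 x) (tri 0 0 y) \<in> ?M"
        by (rule commgenI; simp add: t assms)+
      then show ?case by (simp add: tri_comm t(1))
    next
      case (add x y)
      then show ?case
        using is_subgrp_add[OF M, of "tri x 0 0" "tri y 0 0"] is_subgrp_add[OF M, of "tri 0 x 0" "tri 0 y 0"]
          is_subgrp_add[OF M, of "tri 0 0 x" "tri 0 0 y"] by (simp add: tri_add)
    next
      case (neg x)
      then show ?case
        using is_subgrp_neg[OF M, of "tri x 0 0"] is_subgrp_neg[OF M, of "tri 0 x 0"]
          is_subgrp_neg[OF M, of "tri 0 0 x"] by (simp add: tri_neg)
    qed
  qed
  fix g assume "g \<in> tri3 A"
  then obtain x y z where g: "g = tri x y z" "x \<in> A" "y \<in> A" "z \<in> A" by (rule tri3E)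
  have "g = tri x 0 0 + (tri 0 y 0 + tri 0 0 z)" by (simp add: g(1) tri_add)
  then show "g \<in> ?M" using *[OF g(2)] *[OF g(3)] *[OF g(4)] by (simp add: is_subgrp_add[OF M])
qed

lemma is_subgrp_K: "is_subgrp (level2 m)" and is_subgrp_J: "is_subgrp (level3 m)"
  by (induction m) (simp_all add: is_subgrp_Gam2 is_subgrp_Gam3 is_subgrp_tri3)

lemma J_commgen: "level3 (Suc m) \<subseteq> commgen (level2 m) (level2 (Suc m))"
proof (induction m)
  case 0 then show ?case using J_commgen_base by simp
next
  case (Suc m)
  then show ?case
    using commgen_tri3[OF Suc is_subgrp_zero[OF is_subgrp_K] is_subgrp_zero[OF is_subgrp_K]] by simp
qed

lemma K_commgen: "level2 (Suc (Suc m)) \<subseteq> commgen (level3 m) (level2 (Suc m))"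
proof (induction m)
  case 0 then show ?case using K_commgen_base by simp
next
  case (Suc m)
  then show ?case
    using commgen_tri3[OF Suc is_subgrp_zero[OF is_subgrp_J] is_subgrp_zero[OF is_subgrp_K]] by simp
qed

text \<open>A tribonacci recursion, because \<open>level2 (m + 3)\<close> lies in
  [[\<open>level2 m\<close>, \<open>level2 (m + 1)\<close>], \<open>level2 (m + 2)\<close>]. The
  initial values 3 and 6 reflect that \<open>level2 1\<close> lies in \<open>Gam3\<close> and
  \<open>level2 2\<close> in [\<open>Gam3\<close>, \<open>level2 1\<close>].\<close>

fun depth :: "nat \<Rightarrow> nat" where
  "depth 0 = 2"
| "depth (Suc 0) = 3"
| "depth (Suc (Suc 0)) = 6"
| "depth (Suc (Suc (Suc m))) = depth m + depth (Suc m) + depth (Suc (Suc m))"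

lemma depth_ge_1: "depth m \<ge> 1"
  by (induction m rule: depth.induct) auto

lemma K_lcs: "level2 m \<subseteq> lcs Gam (depth m)"
proof (induction m rule: depth.induct)
  case 1 then show ?case by (simp add: Gam2_def)
next
  case 2 then show ?case using tri3_Gam2_Gam3 by (simp add: Gam3_def)
next
  case 3
  have "commgen (level3 0) (level2 (Suc 0)) \<subseteq> lcs Gam (3 + 3)"
    using tri3_Gam2_Gam3 by (intro commgen_lcs is_subgrp_Gam) (auto simp: Gam3_def)
  then show ?case using K_commgen[of 0] by simp
next
  case (4 m)
  have "level3 (Suc m) \<subseteq> lcs Gam (depth m + depth (Suc m))"
    using J_commgen[of m] commgen_lcs[OF is_subgrp_Gam depth_ge_1 depth_ge_1 4(1,2)] by blast
  then have "commgen (level3 (Suc m)) (level2 (Suc (Suc m)))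
    \<subseteq> lcs Gam ((depth m + depth (Suc m)) + depth (Suc (Suc m)))"
    using depth_ge_1 4(3) by (intro commgen_lcs is_subgrp_Gam) (auto intro: trans_le_add1)
  then show ?case using K_commgen[of "Suc m"] by simp
qed

text \<open>1.83 lies just below the tribonacci constant 1.839..., the real root of x^3 = x^2 + x +
  1, so that 1.83^3 <= 1 + 1.83 + 1.83^2.\<close>

lemma depth_growth: "(1.83::real) ^ m \<le> depth m"
proof (induction m rule: depth.induct)
  case (4 m)
  have "(1.83::real) ^ 3 * 1.83 ^ m \<le> (1 + 1.83 + 1.83\<^sup>2) * 1.83 ^ m"
    by (intro mult_right_mono) (simp_all add: power2_eq_square power3_eq_cube)
  then have "(1.83::real) ^ Suc (Suc (Suc m)) \<le> 1.83 ^ m + 1.83 ^ Suc m + 1.83 ^ Suc (Suc m)"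
    by (simp add: power2_eq_square power3_eq_cube algebra_simps)
  then show ?case using 4 by simp
qed (simp_all add: power2_eq_square)

section \<open>Word lengths\<close>

definition words :: "'a::group_add set \<Rightarrow> nat \<Rightarrow> 'a set" where
  "words S n = {sum_list xs |xs. length xs \<le> n \<and> set xs \<subseteq> S \<union> uminus ` S}"

lemma wordsI: "length xs \<le> n \<Longrightarrow> set xs \<subseteq> S \<union> uminus ` S \<Longrightarrow> sum_list xs \<in> words S n"
  by (auto simp: words_def)

lemma words_mono: "m \<le> n \<Longrightarrow> words S m \<subseteq> words S n"
  unfolding words_def by fastforce

lemma words_zero: "0 \<in> words S n"
  using wordsI[of "[]"] by simp

lemma words_one: "x \<in> S \<Longrightarrow> x \<in> words S 1"
  using wordsI[of "[x]"] by simp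

lemma words_add: "x \<in> words S m \<Longrightarrow> y \<in> words S n \<Longrightarrow> x + y \<in> words S (m + n)"
proof -
  assume "x \<in> words S m" "y \<in> words S n"
  then obtain xs ys where "x = sum_list xs" "length xs \<le> m" "set xs \<subseteq> S \<union> uminus ` S"
    "y = sum_list ys" "length ys \<le> n" "set ys \<subseteq> S \<union> uminus ` S" by (auto simp: words_def)
  then show ?thesis using wordsI[of "xs @ ys" "m + n" S] by simp
qed

lemma words_neg: assumes "x \<in> words S n" shows "- x \<in> words S n"
proof -
  obtain xs where xs: "x = sum_list xs" "length xs \<le> n" "set xs \<subseteq> S \<union> uminus ` S"
    using assms by (auto simp: words_def)
  have "- sum_list xs = sum_list (rev (map uminus xs))"
    by (induction xs) (simp_all add: minus_add del: add_uminus_conv_diff)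
  moreover have "set (rev (map uminus xs)) \<subseteq> S \<union> uminus ` S" using xs(3) by fastforce
  ultimately show ?thesis using wordsI[of "rev (map uminus xs)" n S] xs by simp
qed

lemma words_diff: "x \<in> words S m \<Longrightarrow> y \<in> words S n \<Longrightarrow> x - y \<in> words S (m + n)"
  unfolding diff_conv_add_uminus by (intro words_add words_neg)

lemma words_comm: "x \<in> words S m \<Longrightarrow> y \<in> words S n \<Longrightarrow> comm x y \<in> words S (2 * (m + n))"
  unfolding comm_def using words_diff[OF words_diff[OF words_add]] by (metis add.assoc mult_2)

section \<open>Covering the layers by short words\<close>

definition covers :: "'a::group_add set \<Rightarrow> 'a set \<Rightarrow> 'a set \<Rightarrow> nat \<Rightarrow> bool" where
  "covers S A N n \<longleftrightarrow> (\<forall>g\<in>A. \<exists>t\<in>N. g + t \<in> words S n)"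

lemma coversD: "covers S A N n \<Longrightarrow> g \<in> A \<Longrightarrow> \<exists>t\<in>N. g + t \<in> words S n"
  by (simp add: covers_def)

lemma covers_mono: "covers S A N m \<Longrightarrow> m \<le> n \<Longrightarrow> covers S A N n"
  unfolding covers_def using words_mono by blast

text \<open>The first approximation leaves the error t, and the second one approximates - t; hence
  the closure of \<open>N\<close> under negation.\<close>

lemma covers_trans:
  assumes "covers S A N m" "covers S N M n" and N: "\<And>x. x \<in> N \<Longrightarrow> - x \<in> N"
  shows "covers S A M (m + n)"
  unfolding covers_def
proof
  fix g assume "g \<in> A"
  then obtain t where t: "t \<in> N" "g + t \<in> words S m" using assms(1) coversD by blast
  then obtain t' where t': "t' \<in> M" "- t + t' \<in> words S n" using assms(2) N coversD by blast
  have "g + t' = (g + t) + (- t + t')" by (simp only: grp_norm)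
  then have "g + t' \<in> words S (m + n)" using words_add[OF t(2) t'(2)] by simp
  then show "\<exists>t'\<in>M. g + t' \<in> words S (m + n)" using t'(1) by blast
qed

text \<open>One commutator, in which a word for \<open>v\<close> and a word for an approximation of
  \<open>e\<close> occur twice each.\<close>

lemma covers_J:
  assumes v: "v \<in> (tri3 ^^ m) a_units" "v \<in> words S a" and c: "covers S (level2 m) (level3 m) p"
  shows "covers S (level3 m) (level2 (Suc m)) (2 * (a + p))"
  unfolding covers_def
proof
  fix g assume "g \<in> level3 m"
  then obtain e where e: "e \<in> level2 m" and *: "\<And>t. t \<in> level3 m \<Longrightarrow> - g + comm v (e + t) \<in> level2 (Suc m)"
    using J_step_level[of m] v(1) unfolding J_step_def by blast
  obtain t where t: "t \<in> level3 m" "e + t \<in> words S p" using c e coversD by blast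
  have "g + (- g + comm v (e + t)) \<in> words S (2 * (a + p))"
    using words_comm[OF v(2) t(2)] by (simp add: add.assoc[symmetric])
  then show "\<exists>t\<in>level2 (Suc m). g + t \<in> words S (2 * (a + p))" using *[OF t(1)] by blast
qed

text \<open>The element \<open>e\<close> is needed modulo \<open>level2 (Suc m)\<close> and costs p
  + q, whereas \<open>w\<close> is needed only modulo \<open>level3 m\<close> and costs p;
  \<open>f\<close> starts in \<open>level3 m\<close> and costs q.\<close>

lemma covers_K:
  assumes v: "v \<in> (tri3 ^^ m) b_coset" "v \<in> words S b"
    and p: "covers S (level2 m) (level3 m) p" and q: "covers S (level3 m) (level2 (Suc m)) q"
  shows "covers S (level2 (Suc m)) (level3 (Suc m)) (2 * (b + (p + q)) + 2 * (p + q))"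
  unfolding covers_def
proof
  fix g assume g: "g \<in> level2 (Suc m)"
  have pq: "covers S (level2 m) (level2 (Suc m)) (p + q)"
    by (rule covers_trans[OF p q is_subgrp_neg[OF is_subgrp_J]])
  define R where "R e t w s f r \<longleftrightarrow>
    - g + (comm v (e + t) + comm (w + s) (f + r)) \<in> level3 (Suc m)" for e t w s f r
  have "\<exists>e\<in>level2 m. \<forall>t\<in>level2 (Suc m). \<exists>w\<in>level2 m. \<forall>s\<in>level3 m. \<exists>f\<in>level3 m. \<forall>r\<in>level2 (Suc m). R e t w s f r"
    using K_step_level[of m] v(1) g unfolding K_step_def R_def by blast
  then obtain e where e: "e \<in> level2 m"
    "\<And>t. t \<in> level2 (Suc m) \<Longrightarrow> \<exists>w\<in>level2 m. \<forall>s\<in>level3 m. \<exists>f\<in>level3 m. \<forall>r\<in>level2 (Suc m). R e t w s f r" by blast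
  obtain t where t: "t \<in> level2 (Suc m)" "e + t \<in> words S (p + q)" using coversD[OF pq e(1)] by blast
  obtain w where w: "w \<in> level2 m" "\<And>s. s \<in> level3 m \<Longrightarrow> \<exists>f\<in>level3 m. \<forall>r\<in>level2 (Suc m). R e t w s f r"
    using e(2)[OF t(1)] by blast
  obtain s where s: "s \<in> level3 m" "w + s \<in> words S p" using coversD[OF p w(1)] by blast
  obtain f where f: "f \<in> level3 m" "\<And>r. r \<in> level2 (Suc m) \<Longrightarrow> R e t w s f r" using w(2)[OF s(1)] by blast
  obtain r where r: "r \<in> level2 (Suc m)" "f + r \<in> words S q" using coversD[OF q f(1)] by blast
  let ?z = "comm v (e + t) + comm (w + s) (f + r)"
  have "?z \<in> words S (2 * (b + (p + q)) + 2 * (p + q))"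
    by (intro words_add words_comm v t s r)
  then have "g + (- g + ?z) \<in> words S (2 * (b + (p + q)) + 2 * (p + q))"
    by (simp add: add.assoc[symmetric])
  then show "\<exists>t\<in>level3 (Suc m). g + t \<in> words S (2 * (b + (p + q)) + 2 * (p + q))"
    using f(2)[OF r(1)] unfolding R_def by blast
qed

lemma seed_covers:
  assumes "seed P N T" "covers S P N n" shows "\<exists>v\<in>T. v \<in> words S n"
  using assms coversD unfolding seed_def by metis

text \<open>The factors \<open>a = 13\<close>, \<open>b = 28\<close>, \<open>p = 169\<close>, \<open>q = 364\<close> of \<open>13 ^ m\<close> solve the inequalities
  \<open>q \<ge> 2 (a + p)\<close>, \<open>13 a \<ge> p\<close>, \<open>13 b \<ge> q\<close> and \<open>13 p \<ge> 2 (b + p + q) + 2 (p + q)\<close>.\<close>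

lemma covers_levels:
  assumes "\<exists>v\<in>a_units. v \<in> words S 13" "\<exists>v\<in>b_coset. v \<in> words S 28" "covers S Gam2 Gam3 169"
  shows "(\<exists>v\<in>(tri3 ^^ m) a_units. v \<in> words S (13 * 13 ^ m)) \<and>
    (\<exists>v\<in>(tri3 ^^ m) b_coset. v \<in> words S (28 * 13 ^ m)) \<and>
    covers S (level2 m) (level3 m) (169 * 13 ^ m)"
proof (induction m)
  case 0
  then show ?case using assms by simp
next
  case (Suc m)
  then obtain v w where v: "v \<in> (tri3 ^^ m) a_units" "v \<in> words S (13 * 13 ^ m)"
    and w: "w \<in> (tri3 ^^ m) b_coset" "w \<in> words S (28 * 13 ^ m)"
    and p: "covers S (level2 m) (level3 m) (169 * 13 ^ m)" by blast
  have q: "covers S (level3 m) (level2 (Suc m)) (364 * 13 ^ m)"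
    using covers_J[OF v p] by (rule covers_mono) simp
  have "\<exists>v\<in>(tri3 ^^ Suc m) a_units. v \<in> words S (13 * 13 ^ Suc m)"
    using seed_covers[OF seed_a_units p] by simp
  moreover have "\<exists>v\<in>(tri3 ^^ Suc m) b_coset. v \<in> words S (28 * 13 ^ Suc m)"
    using seed_covers[OF seed_b_coset q] by simp
  moreover have "covers S (level2 (Suc m)) (level3 (Suc m)) (169 * 13 ^ Suc m)"
    using covers_K[OF w p q] by (rule covers_mono) simp
  ultimately show ?case by blast
qed

text \<open>A geometric series over the layers: level m costs 169 + 364 = 533 times 13^m, and 45 is
  the least integer C with C + 533 <= 13 C.\<close>

lemma covers_Gam_K:
  assumes a: "\<exists>v\<in>a_units. v \<in> words S 13" and b: "\<exists>v\<in>b_coset. v \<in> words S 28"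
    and c: "covers S Gam2 Gam3 169" and "covers S Gam Gam2 45"
  shows "covers S Gam (level2 m) (45 * 13 ^ m)"
proof (induction m)
  case 0
  then show ?case using assms(4) by simp
next
  case (Suc m)
  have bound: "45 * x + (169 * x + 2 * (13 * x + 169 * x)) \<le> 45 * (13 * x)" for x :: nat
    by simp
  note L = covers_levels[OF a b c, of m]
  then obtain v where v: "v \<in> (tri3 ^^ m) a_units" "v \<in> words S (13 * 13 ^ m)"
    and p: "covers S (level2 m) (level3 m) (169 * 13 ^ m)" by blast
  have "covers S (level2 m) (level2 (Suc m)) (169 * 13 ^ m + 2 * (13 * 13 ^ m + 169 * 13 ^ m))"
    by (rule covers_trans[OF p covers_J[OF v p] is_subgrp_neg[OF is_subgrp_J]])
  from covers_mono[OF covers_trans[OF Suc this is_subgrp_neg[OF is_subgrp_K]] bound] show ?case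
    by simp
qed

section \<open>Arbitrary generating sets modulo the second term of the series\<close>

lemma mod3_rep: obtains n' :: int where "n' \<in> {- 1, 0, 1}" "3 dvd n' - n"
proof -
  have "3 dvd - 1 - n \<or> 3 dvd 0 - n \<or> 3 dvd 1 - n" by presburger
  then show thesis using that by blast
qed

lemma small_multiple:
  assumes "n \<in> {- 1, 0, 1}" "ab_class x i j" "x \<in> words S L"
  obtains x' where "x' \<in> words S L" "ab_class x' (n * i) (n * j)"
proof -
  consider "n = - 1" | "n = 0" | "n = 1" using assms(1) by blast
  then show thesis
  proof cases
    case 1
    then show ?thesis using that[of "- x"] words_neg[OF assms(3)] ab_class.neg[OF assms(2)] by simp
  next
    case 2
    then show ?thesis using that[of 0] words_zero[of S L] ab_class_zero_elem by simp
  next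
    case 3
    then show ?thesis using that[of x] assms by simp
  qed
qed

lemma Gam2_eq: "Gam2 = gen {comm x y |x y. x \<in> Gam \<and> y \<in> Gam}"
  unfolding Gam2_def numeral_2_eq_2 by simp

lemma ga_notin_tri3: "ga \<notin> tri3 UNIV"
proof
  assume "ga \<in> tri3 UNIV"
  then obtain x y z where "ga = tri x y z" by (rule tri3E)
  then have "app ga [L0] = app (tri x y z) [L0]" by simp
  then show False by simp
qed

text \<open>Both b and \<open>Gam2\<close> fix the first level, so only the exponent of a can move
  it.\<close>

lemma ab_class_0_tri3: assumes "ab_class p 0 j" shows "p \<in> tri3 UNIV"
proof -
  have T: "is_subgrp (tri3 UNIV)" by (rule is_subgrp_tri3) (simp add: is_subgrp_def)
  have "gb \<in> tri3 UNIV" by (subst gb_eq) simp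
  moreover have "- zm j gb + p \<in> Gam2" using ab_class_zm[OF assms] by simp
  then have "- zm j gb + p \<in> tri3 UNIV" using cu_class_ex by (fastforce elim: cu_classE)
  ultimately have "zm j gb + (- zm j gb + p) \<in> tri3 UNIV"
    using is_subgrp_add[OF T] zm_in[OF T] by blast
  then show ?thesis by simp
qed

text \<open>Some generator x has an invertible a-exponent, since otherwise a would fix the first
  level. Some generator z is independent of x modulo \<open>Gam2\<close>, since otherwise all
  determinants in \<open>c_class_comm\<close> vanish and \<open>Gam2\<close> lies in
  \<open>Gam3\<close>. Clearing the a-exponent of z with x leaves b up to sign.\<close>

lemma generators_mod_Gam2:
  assumes ne: "\<not> Gam2 \<subseteq> Gam3" and S: "S \<subseteq> Gam" "Gam \<subseteq> gen (S \<union> Gam2)"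
  obtains x b e y where "x \<in> S" "ab_class x e y" "e \<in> {- 1, 1}" "b \<in> words S 2" "ab_class b 0 1"
proof -
  have "\<exists>x\<in>S. x \<in> a_units"
  proof (rule ccontr)
    assume no: "\<not> (\<exists>x\<in>S. x \<in> a_units)"
    have "s \<in> tri3 UNIV" if "s \<in> S" for s
    proof -
      obtain i j where ab_class: "ab_class s i j" using ab_class_ex[of s] S(1) \<open>s \<in> S\<close> by blast
      obtain i' where i': "i' \<in> {- 1, 0, 1}" "3 dvd i' - i" by (rule mod3_rep)
      have "ab_class s i' j" using ab_class_mod[OF ab_class i'(2)] by simp
      then have "i' = 0" using no that i'(1) by (auto simp: a_units_def)
      then show ?thesis using ab_class_0_tri3 \<open>ab_class s i' j\<close> by blast
    qed
    moreover have "Gam2 \<subseteq> tri3 UNIV" using ab_class_0_tri3 ab_class.comm by blast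
    ultimately have "gen (S \<union> Gam2) \<subseteq> tri3 UNIV"
      by (intro gen_least is_subgrp_tri3) (auto simp: is_subgrp_def)
    then show False using S(2) ga_Gam ga_notin_tri3 by blast
  qed
  then obtain x e y where x: "x \<in> S" "ab_class x e y" "e \<in> {- 1, 1}" by (auto simp: a_units_def)
  then have e: "e * e = 1" by auto
  \<comment> \<open>The preimage of the cyclic subgroup that x generates modulo
    \<open>Gam2\<close>.\<close>
  define C where "C = {p. \<exists>n. ab_class p (n * e) (n * y)}"
  have C: "is_subgrp C"
  proof (rule is_subI)
    show "0 \<in> C" using ab_class_zero_elem unfolding C_def by (intro CollectI exI[of _ 0]) simp
    fix p q assume "p \<in> C" "q \<in> C"
    then obtain m n where "ab_class p (m * e) (m * y)" "ab_class q (n * e) (n * y)" by (auto simp: C_def)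
    from ab_class.add[OF this] show "p + q \<in> C"
      unfolding C_def by (intro CollectI exI[of _ "m + n"]) (simp add: distrib_right)
  next
    fix p assume "p \<in> C"
    then obtain m where "ab_class p (m * e) (m * y)" by (auto simp: C_def)
    from ab_class.neg[OF this] show "- p \<in> C"
      unfolding C_def by (intro CollectI exI[of _ "- m"]) simp
  qed
  have "\<not> S \<subseteq> C"
  proof
    assume "S \<subseteq> C"
    moreover have "Gam2 \<subseteq> C" unfolding C_def by (auto intro!: exI[of _ 0] ab_class.comm)
    ultimately have "gen (S \<union> Gam2) \<subseteq> C" by (intro gen_least C) auto
    then have GC: "Gam \<subseteq> C" using S(2) by blast
    have "comm p q \<in> Gam3" if p: "p \<in> Gam" and q: "q \<in> Gam" for p q
    proof -
      obtain m n where "ab_class p (m * e) (m * y)" "ab_class q (n * e) (n * y)"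
        using GC p q unfolding C_def by blast
      from c_class_comm[OF this] show ?thesis by (intro c_class_zero) (simp add: mult_ac)
    qed
    then have "Gam2 \<subseteq> Gam3" unfolding Gam2_eq by (intro gen_least is_subgrp_Gam3) blast
    then show False using ne by blast
  qed
  then obtain z where z: "z \<in> S" "z \<notin> C" by blast
  obtain i j where zD: "ab_class z i j" using ab_class_ex[of z] S(1) z(1) by blast
  \<comment> \<open>As e is its own inverse, this n solves n e = i modulo 3; keeping n in -1, 0, 1
    keeps the word for the multiple of x at length one.\<close>
  obtain n where n: "n \<in> {- 1, 0, 1}" "3 dvd n - i * e" by (rule mod3_rep)
  have "n * e - i = (n - i * e) * e" using e by (simp add: left_diff_distrib mult.assoc)
  then have ne: "3 dvd n * e - i" using n(2) by simp
  obtain x' where x': "x' \<in> words S 1" "ab_class x' (n * e) (n * y)"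
    using small_multiple[OF n(1) x(2) words_one[OF x(1)]] .
  obtain k where k: "k \<in> {- 1, 0, 1}" "3 dvd k - (j - n * y)" by (rule mod3_rep)
  have "ab_class (z - x') (i - n * e) (j - n * y)" by (rule ab_class_diff[OF zD x'(2)])
  then have w: "ab_class (z - x') 0 k" using ne k(2) by (elim ab_class_mod) (simp_all add: dvd_diff_commute)
  have "k \<noteq> 0"
  proof
    assume "k = 0"
    then have "3 dvd n * y - j" using k(2) by (simp add: dvd_diff_commute)
    then have "ab_class z (n * e) (n * y)" using zD ne by (elim ab_class_mod)
    then show False using z(2) by (auto simp: C_def)
  qed
  then have kk: "k * k = 1" using k(1) by auto
  have "z - x' \<in> words S (1 + 1)" by (intro words_diff words_one z x')
  then obtain b where "b \<in> words S (1 + 1)" "ab_class b (k * 0) (k * k)"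
    using small_multiple[OF k(1) w] by blast
  then show thesis using that[OF x] kk by (simp add: numeral_2_eq_2)
qed

lemma c_class_mod: assumes "c_class p x" "3 dvd x' - x" shows "c_class p x'"
proof -
  have "c_class 0 (3 * m)" for m
  proof (induction m rule: int_induct[of _ 0])
    case (step1 i)
    show ?case by (rule c_class_cong[OF c_class.add[OF step1(2) c_class_0_3, unfolded add_0_left]]) auto
  next
    case (step2 i)
    show ?case by (rule c_class_cong[OF c_class_diff[OF step2(2) c_class_0_3, unfolded diff_0_right]]) auto
  qed (use c_class.comm is_subgrp_zero[OF is_subgrp_Gam3] in simp)
  moreover obtain m where "x' - x = 3 * m" using assms(2) by (elim dvdE)
  ultimately show ?thesis
    by (intro c_class_cong[OF c_class.add[OF assms(1), of 0 "3 * m", unfolded add_0_right]]) auto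
qed

text \<open>Words of lengths 1, 2, 6 and 3 satisfy the premises of \<open>covers_Gam_K\<close>. They
  are counted as 13, 28, 169 and 45, the values for which the induction closes.\<close>

lemma covers_if_generates:
  assumes ne: "\<not> Gam2 \<subseteq> Gam3" and S: "S \<subseteq> Gam" "Gam \<subseteq> gen (S \<union> Gam2)"
  shows "covers S Gam (level2 m) (45 * 13 ^ m)"
proof -
  obtain x b e y where x: "x \<in> S" "ab_class x e y" "e \<in> {- 1, 1}" and b: "b \<in> words S 2" "ab_class b 0 1"
    using generators_mod_Gam2[OF assms] .
  have e: "e * e = 1" using x(3) by auto
  have x1: "x \<in> words S 1" by (rule words_one[OF x(1)])
  have "x \<in> a_units" using x(2,3) by (auto simp: a_units_def)
  moreover have "x \<in> words S 13" "b \<in> words S 28"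
    using words_mono[of 1 13 S] words_mono[of 2 28 S] x1 b(1) by auto
  moreover have "b \<in> b_coset" using b(2) by (simp add: b_coset_def)
  moreover have "covers S Gam Gam2 45"
    unfolding covers_def
  proof
    fix g assume "g \<in> Gam"
    then obtain i j where g: "ab_class g i j" using ab_class_ex by blast
    obtain n where n: "n \<in> {- 1, 0, 1}" "3 dvd n - i * e" by (rule mod3_rep)
    obtain k where k: "k \<in> {- 1, 0, 1}" "3 dvd k - (j - n * y)" by (rule mod3_rep)
    obtain x' where x': "x' \<in> words S 1" "ab_class x' (n * e) (n * y)"
      using small_multiple[OF n(1) x(2) x1] .
    obtain b' where b': "b' \<in> words S 2" "ab_class b' (k * 0) (k * 1)"
      using small_multiple[OF k(1) b(2,1)] .
    have "n * e - i = (n - i * e) * e" using e by (simp add: left_diff_distrib mult.assoc)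
    then have "3 dvd n * e - i" using n(2) by simp
    then have "3 dvd i - (n * e + k * 0)" by (simp add: dvd_diff_commute)
    moreover have "3 dvd j - (n * y + k * 1)" using k(2) by presburger
    ultimately have "ab_class (x' + b') i j" by (rule ab_class_mod[OF ab_class.add[OF x'(2) b'(2)]])
    then have "- g + (x' + b') \<in> Gam2" by (rule ab_class_unique[OF g])
    moreover have "x' + b' \<in> words S 45" using words_add[OF x'(1) b'(1)] words_mono[of "1 + 2" 45 S] by auto
    then have "g + (- g + (x' + b')) \<in> words S 45" by (simp add: add.assoc[symmetric])
    ultimately show "\<exists>t\<in>Gam2. g + t \<in> words S 45" by blast
  qed
  moreover have "covers S Gam2 Gam3 169"
    unfolding covers_def
  proof
    fix g assume "g \<in> Gam2"
    then obtain i where g: "c_class g i" using c_class_ex by blast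
    obtain n where n: "n \<in> {- 1, 0, 1}" "3 dvd n - i * e" by (rule mod3_rep)
    have c: "c_class (comm x b) e" using c_class_comm[OF x(2) b(2)] by simp
    have cw: "comm x b \<in> words S 169"
      using words_comm[OF x1 b(1)] words_mono[of "2 * (1 + 2)" 169 S] by auto
    have "\<exists>w. w \<in> words S 169 \<and> c_class w (n * e)"
      using n(1) words_neg[OF cw] c_class.neg[OF c] words_zero[of S 169] c_class.comm[OF is_subgrp_zero[OF is_subgrp_Gam3]] cw c
      by auto
    then obtain w where w: "w \<in> words S 169" "c_class w (n * e)" by blast
    have "n * e - i = (n - i * e) * e" using e by (simp add: left_diff_distrib mult.assoc)
    then have "3 dvd n * e - i" using n(2) by simp
    then have "c_class w i" using w(2) by (elim c_class_mod) (simp add: dvd_diff_commute)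
    then have "- g + w \<in> Gam3" using c_class.add[OF c_class.neg[OF g]] by (intro c_class_zero) fastforce
    moreover have "g + (- g + w) \<in> words S 169" using w(1) by (simp add: add.assoc[symmetric])
    ultimately show "\<exists>t\<in>Gam3. g + t \<in> words S 169" by blast
  qed
  ultimately show ?thesis by (intro covers_Gam_K) blast+
qed

section \<open>Strict decrease of the lower central series\<close>

fun val :: "letter \<Rightarrow> int" where
  "val L0 = 0" | "val L1 = 1" | "val L2 = 2"

lemma val_inj: "3 dvd val l - val l' \<Longrightarrow> l = l'"
  by (cases l; cases l') auto

definition act :: "tree_aut \<Rightarrow> vertex \<Rightarrow> letter \<Rightarrow> letter" where
  "act g w l = last (app g (w @ [l]))"

lemma app_snoc: "app g (w @ [l]) = app g w @ [act g w l]"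
proof -
  have "prefix (app g w) (app g (w @ [l]))"
    using app[of g] by (auto simp: AutT3_simps)
  then obtain v where v: "app g (w @ [l]) = app g w @ v" by (auto elim: prefixE)
  have "length v = 1" using arg_cong[OF v, of length] by simp
  then obtain x where "v = [x]" by (auto simp: length_Suc_conv)
  then show ?thesis using v by (simp add: act_def)
qed

text \<open>The element g permutes the children of w by a power of the 3-cycle underlying a, with
  exponent s modulo 3. A general tree automorphism may also act by transpositions; elements of
  \<open>Gam\<close> do not, by \<open>rot_ex\<close>.\<close>

definition rot :: "tree_aut \<Rightarrow> vertex \<Rightarrow> int \<Rightarrow> bool" where
  "rot g w s \<longleftrightarrow> (\<forall>l. 3 dvd val (act g w l) - val l - s)"

lemma act_add: "act (g + h) w l = act g (app h w) (act h w l)"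
proof -
  have "app g (app h w) @ [act (g + h) w l] = app (g + h) (w @ [l])"
    using app_snoc[of "g + h" w l] by (simp only: app_add)
  also have "\<dots> = app g (app h w) @ [act g (app h w) (act h w l)]"
    by (simp only: app_add app_snoc[of h] app_snoc[of g])
  finally show ?thesis by simp
qed

lemma rot_add: assumes "rot g (app h w) s" "rot h w t" shows "rot (g + h) w (s + t)"
  unfolding rot_def act_add
proof
  fix l
  have "3 dvd (val (act g (app h w) (act h w l)) - val (act h w l) - s) + (val (act h w l) - val l - t)"
    using assms unfolding rot_def by (intro dvd_add[of 3 "_ - _ - _" "_ - _ - _"]) blast+
  then show "3 dvd val (act g (app h w) (act h w l)) - val l - (s + t)" by (simp add: algebra_simps)
qed

lemma act_zero: "act 0 w l = l"
  by (simp add: act_def app_zero)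

lemma rot_zero: "rot 0 w 0"
  by (simp add: rot_def act_zero)

lemma rot_neg: assumes "rot g (app (- g) w) s" shows "rot (- g) w (- s)"
  unfolding rot_def
proof
  fix l
  have "act g (app (- g) w) (act (- g) w l) = l"
    using act_add[of g "- g" w l] by (simp add: act_zero)
  moreover have "3 dvd val (act g (app (- g) w) (act (- g) w l)) - val (act (- g) w l) - s"
    using assms unfolding rot_def by blast
  ultimately have "3 dvd val l - val (act (- g) w l) - s" by simp
  then have "3 dvd - (val l - val (act (- g) w l) - s)" by (simp only: dvd_minus_iff)
  moreover have "- (val l - val (act (- g) w l) - s) = val (act (- g) w l) - val l - - s" by simp
  ultimately show "3 dvd val (act (- g) w l) - val l - - s" by (simp only:)
qed

lemma act_Cons:
  "act (tri x y z) (L0 # w) l = act x w l" "act (tri x y z) (L1 # w) l = act y w l"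
  "act (tri x y z) (L2 # w) l = act z w l" "act (tri x y z) [] l = l"
proof -
  have "app g (w @ [l]) \<noteq> []" for g using app_snoc[of g w l] by simp
  then show "act (tri x y z) (L0 # w) l = act x w l" "act (tri x y z) (L1 # w) l = act y w l"
    "act (tri x y z) (L2 # w) l = act z w l"
    by (simp_all add: act_def)
  show "act (tri x y z) [] l = l" by (cases l) (simp_all add: act_def)
qed

lemma rot_ga: "\<exists>s. rot ga w s"
proof (cases w rule: vertex_cases)
  case 1
  have "val (act ga [] l) - val l - 1 \<in> {0, - 3}" for l by (cases l) (auto simp: act_def)
  then have "rot ga w 1" unfolding rot_def 1 by (metis dvd_0_right dvd_minus_iff dvd_refl insertE singletonD)
  then show ?thesis by blast
next
  case (2 v) then show ?thesis by (intro exI[of _ 0]) (simp add: rot_def act_def)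
next
  case (3 v) then show ?thesis by (intro exI[of _ 0]) (simp add: rot_def act_def)
next
  case (4 v) then show ?thesis by (intro exI[of _ 0]) (simp add: rot_def act_def)
qed

lemma rot_gb: "\<exists>s. rot gb w s"
proof (induction w)
  case Nil
  have "rot gb [] 0" by (subst gb_eq) (simp add: rot_def act_Cons)
  then show ?case by blast
next
  case (Cons x w)
  show ?case
  proof (cases x)
    case L0
    obtain s where "rot ga w s" using rot_ga by blast
    then show ?thesis unfolding L0 by (subst gb_eq) (auto simp: rot_def act_Cons)
  next
    case L1
    obtain s where "rot ga (app (- ga) w) s" using rot_ga by blast
    then have "rot (- ga) w (- s)" by (rule rot_neg)
    then show ?thesis unfolding L1 by (subst gb_eq, intro exI[of _ "- s"]) (simp add: rot_def act_Cons)
  next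
    case L2
    obtain s where "rot gb w s" using Cons by blast
    then show ?thesis unfolding L2 by (subst gb_eq) (auto simp: rot_def act_Cons)
  qed
qed

text \<open>As \<open>val L0\<close> is 0, the image of \<open>L0\<close> shows the exponent
  wherever \<open>rot\<close> holds.\<close>

definition sg :: "tree_aut \<Rightarrow> vertex \<Rightarrow> int" where "sg g w = val (act g w L0)"

lemma rot_ex: assumes "g \<in> Gam" shows "\<exists>s. rot g w s"
  using assms unfolding Gam_def
proof (induction arbitrary: w)
  case zero
  then show ?case using rot_zero by blast
next
  case (incl x)
  then show ?case using rot_ga rot_gb by auto
next
  case (add x y)
  obtain s where s: "rot y w s" using add.IH(2) by blast
  obtain t where "rot x (app y w) t" using add.IH(1) by blast
  from rot_add[OF this s] show ?case by blast
next
  case (neg x)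
  obtain s where "rot x (app (- x) w) s" using neg.IH by blast
  from rot_neg[OF this] show ?case by blast
qed

lemma rot_sg: "rot g w s \<Longrightarrow> 3 dvd sg g w - s"
  unfolding rot_def sg_def using val.simps(1) by (metis diff_zero)

lemma rot_cong: "rot g w s \<Longrightarrow> 3 dvd t - s \<Longrightarrow> rot g w t"
  unfolding rot_def
proof
  fix l assume "\<forall>l. 3 dvd val (act g w l) - val l - s" "3 dvd t - s"
  then have "3 dvd (val (act g w l) - val l - s) - (t - s)" by (intro dvd_diff[of 3 "_ - _ - _" "_ - _"]) blast+
  moreover have "(val (act g w l) - val l - s) - (t - s) = val (act g w l) - val l - t" by simp
  ultimately show "3 dvd val (act g w l) - val l - t" by (simp only:)
qed

lemma rot_sg_Gam: "g \<in> Gam \<Longrightarrow> rot g w (sg g w)"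
  using rot_ex rot_sg rot_cong by blast

text \<open>The cocycle rule. For h in \<open>Stab m\<close> and w on level m the twist by h
  disappears, which makes \<open>lin\<close> additive.\<close>

lemma sg_add:
  assumes "g \<in> Gam" "h \<in> Gam" shows "3 dvd sg (g + h) w - (sg g (app h w) + sg h w)"
  by (intro rot_sg rot_add rot_sg_Gam assms)

lemma sg_neg: assumes "g \<in> Gam" shows "3 dvd sg (- g) w + sg g (app (- g) w)"
  using rot_sg[OF rot_neg[OF rot_sg_Gam[OF assms]], of w] by simp

section \<open>Linear functionals on level stabilisers\<close>

definition Stab :: "nat \<Rightarrow> tree_aut set" where
  "Stab m = {g \<in> Gam. \<forall>w. length w = m \<longrightarrow> app g w = w}"

lemma is_subgrp_Stab: "is_subgrp (Stab m)"
proof (rule is_subI)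
  show "0 \<in> Stab m" by (simp add: Stab_def app_zero is_subgrp_zero[OF is_subgrp_Gam])
  show "x + y \<in> Stab m" if "x \<in> Stab m" "y \<in> Stab m" for x y
    using that by (auto simp: Stab_def app_add is_subgrp_add[OF is_subgrp_Gam])
  show "- x \<in> Stab m" if "x \<in> Stab m" for x
  proof -
    have "app (- x) w = w" if "length w = m" for w
      using \<open>x \<in> Stab m\<close> that app_neg[of x w] by (simp add: Stab_def)
    then show ?thesis using that is_subgrp_neg[OF is_subgrp_Gam] by (simp add: Stab_def)
  qed
qed

text \<open>Modulo 3 this is a homomorphism on \<open>Stab m\<close>; the weights f range over all
  linear combinations of the actions directly below level m.\<close>

definition lin :: "nat \<Rightarrow> (vertex \<Rightarrow> int) \<Rightarrow> tree_aut \<Rightarrow> int" where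
  "lin m f g = (\<Sum>w | length w = m. f w * sg g w)"

lemma finite_level: "finite {w :: vertex. length w = m}"
proof -
  have "UNIV = {L0, L1, L2}" using letter.exhaust by blast
  then have "finite (UNIV :: letter set)" by (metis finite.emptyI finite.insertI)
  then show ?thesis using finite_lists_length_eq[of "UNIV :: letter set" m] by simp
qed

lemma lin_add:
  assumes "g \<in> Stab m" "h \<in> Stab m" shows "3 dvd lin m f (g + h) - (lin m f g + lin m f h)"
proof -
  have "3 dvd f w * (sg (g + h) w - (sg g w + sg h w))" if "length w = m" for w
    using sg_add[of g h w] assms that by (intro dvd_mult) (simp add: Stab_def)
  then have "3 dvd (\<Sum>w | length w = m. f w * (sg (g + h) w - (sg g w + sg h w)))"
    by (intro dvd_sum) simp
  then show ?thesis
    by (simp add: lin_def right_diff_distrib distrib_left sum_subtractf sum.distrib)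
qed

lemma lin_neg:
  assumes "g \<in> Stab m" shows "3 dvd lin m f (- g) + lin m f g"
proof -
  have "3 dvd f w * (sg (- g) w + sg g w)" if "length w = m" for w
    using sg_neg[of g w] assms that is_subgrp_neg[OF is_subgrp_Stab assms] by (intro dvd_mult) (simp add: Stab_def)
  then have "3 dvd (\<Sum>w | length w = m. f w * (sg (- g) w + sg g w))"
    by (intro dvd_sum) simp
  then show ?thesis by (simp add: lin_def distrib_left sum.distrib)
qed

lemma conj_Stab: assumes "g \<in> Stab m" "h \<in> Gam" shows "h + g - h \<in> Stab m"
proof -
  have "app (h + g - h) w = w" if "length w = m" for w
  proof -
    have "app g (app (- h) w) = app (- h) w" using assms(1) that by (simp add: Stab_def)
    then show ?thesis
      using app_neg[of "- h" w] unfolding diff_conv_add_uminus app_add by (simp only: minus_minus)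
  qed
  moreover have "h + g - h \<in> Gam"
    using assms normal_sub_conj[OF normal_sub_self[OF is_subgrp_Gam]] by (simp add: Stab_def)
  ultimately show ?thesis by (simp add: Stab_def)
qed

text \<open>The shift of the conjugate at \<open>app h w\<close> equals the shift of g at w, as the
  contributions of h and - h cancel; the sum is then reindexed along \<open>app h\<close>.\<close>

lemma lin_conj:
  assumes g: "g \<in> Stab m" and h: "h \<in> Gam"
  shows "3 dvd lin m f (h + g - h) - lin m (\<lambda>w. f (app h w)) g"
proof -
  have gG: "g \<in> Gam" using g by (simp add: Stab_def)
  have "3 dvd f (app h w) * (sg (h + g - h) (app h w) - sg g w)" if w: "length w = m" for w
  proof -
    have 1: "3 dvd sg (h + (g + - h)) (app h w) - (sg h (app (g + - h) (app h w)) + sg (g + - h) (app h w))"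
      by (intro sg_add h is_subgrp_add[OF is_subgrp_Gam] gG is_subgrp_neg[OF is_subgrp_Gam])
    have 2: "3 dvd sg (g + - h) (app h w) - (sg g (app (- h) (app h w)) + sg (- h) (app h w))"
      by (intro sg_add h gG is_subgrp_neg[OF is_subgrp_Gam])
    have 3: "3 dvd sg (- h) (app h w) + sg h (app (- h) (app h w))" by (rule sg_neg[OF h])
    have a: "app (- h) (app h w) = w" by (rule app_neg)
    have b: "app (g + - h) (app h w) = w" using g w by (simp add: app_add a Stab_def del: add_uminus_conv_diff)
    have "3 dvd (sg (h + (g + - h)) (app h w) - (sg h w + sg (g + - h) (app h w)))
      + (sg (g + - h) (app h w) - (sg g w + sg (- h) (app h w))) + (sg (- h) (app h w) + sg h w)"
      by (rule dvd_add[OF dvd_add[OF 1[unfolded a] 2[unfolded a]] 3[unfolded a], unfolded b])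
    moreover have "h + (g + - h) = h + g - h" by (simp only: grp_norm)
    ultimately have "3 dvd sg (h + g - h) (app h w) - sg g w" by simp
    then show ?thesis by simp
  qed
  then have "3 dvd (\<Sum>w | length w = m. f (app h w) * (sg (h + g - h) (app h w) - sg g w))"
    by (intro dvd_sum) simp
  moreover have "bij_betw (app h) {w. length w = m} {w. length w = m}"
  proof (rule bij_betw_byWitness[of _ "app (- h)"])
    show "\<forall>w\<in>{w. length w = m}. app (- h) (app h w) = w" by (simp add: app_neg)
    show "\<forall>w\<in>{w. length w = m}. app h (app (- h) w) = w" using app_neg[of "- h"] by simp
  qed auto
  then have "(\<Sum>w | length w = m. f (app h w) * sg (h + g - h) (app h w)) = lin m f (h + g - h)"
    unfolding lin_def by (rule sum.reindex_bij_betw)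
  ultimately show ?thesis by (simp add: lin_def right_diff_distrib sum_subtractf)
qed

text \<open>[g, h] is g plus a conjugate of - g. So taking commutators with h dualises to a
  difference operator on the weight functions.\<close>

lemma lin_comm:
  assumes g: "g \<in> Stab m" and h: "h \<in> Gam"
  shows "3 dvd lin m f (comm g h) + lin m (\<lambda>w. f (app h w) - f w) g"
proof -
  have n: "- g \<in> Stab m" by (rule is_subgrp_neg[OF is_subgrp_Stab g])
  have c: "comm g h = g + (h + - g - h)" by (simp only: comm_def grp_norm)
  have "3 dvd (lin m f (g + (h + - g - h)) - (lin m f g + lin m f (h + - g - h)))
      + (lin m f (h + - g - h) - lin m (\<lambda>w. f (app h w)) (- g))
      + (lin m (\<lambda>w. f (app h w)) (- g) + lin m (\<lambda>w. f (app h w)) g)"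
    by (rule dvd_add[OF dvd_add[OF lin_add[OF g conj_Stab[OF n h]] lin_conj[OF n h]] lin_neg[OF g]])
  moreover have "lin m (\<lambda>w. f (app h w) - f w) g = lin m (\<lambda>w. f (app h w)) g - lin m f g"
    by (simp add: lin_def left_diff_distrib sum_subtractf)
  ultimately show ?thesis by (simp add: c)
qed

text \<open>Functions on level \<open>m\<close>, modulo \<open>3\<close>, that are killed by \<open>i\<close> successive differences \<open>f \<circ> h - f\<close>.
  By \<open>lin_comm\<close>, the functional \<open>lin m f\<close> of such a function vanishes on the \<open>(k + i)\<close>-th term of the
  lower central series once the \<open>k\<close>-th term fixes level \<open>m\<close>. Every function is of this kind, by
  induction on the level, since it is a quadratic polynomial in the last letter.\<close>

fun nilfun :: "nat \<Rightarrow> nat \<Rightarrow> (vertex \<Rightarrow> int) set" where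
  "nilfun m 0 = {f. \<forall>w. length w = m \<longrightarrow> 3 dvd f w}"
| "nilfun m (Suc i) = {f. \<forall>h\<in>Gam. (\<lambda>w. f (app h w) - f w) \<in> nilfun m i}"

lemma nilfun_add: "f \<in> nilfun m i \<Longrightarrow> f' \<in> nilfun m i \<Longrightarrow> (\<lambda>w. f w + f' w) \<in> nilfun m i"
proof (induction i arbitrary: f f')
  case (Suc i)
  have "(\<lambda>w. f (app h w) + f' (app h w) - (f w + f' w)) \<in> nilfun m i" if "h \<in> Gam" for h
  proof -
    have "(\<lambda>w. (f (app h w) - f w) + (f' (app h w) - f' w)) \<in> nilfun m i"
      using Suc.prems that by (intro Suc.IH) simp_all
    then show ?thesis by (simp add: add_diff_add)
  qed
  then show ?case by simp
qed simp

lemma nilfun_Suc: "f \<in> nilfun m i \<Longrightarrow> f \<in> nilfun m (Suc i)"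
proof (induction i arbitrary: f)
  case (Suc i)
  have "(\<lambda>w. f (app h w) - f w) \<in> nilfun m (Suc i)" if "h \<in> Gam" for h
    using Suc.prems that by (intro Suc.IH) simp
  then show ?case unfolding nilfun.simps(2)[of m "Suc i"] by blast
qed simp

lemma nilfun_mono: assumes "f \<in> nilfun m i" "i \<le> j" shows "f \<in> nilfun m j"
proof -
  have "nilfun m i \<subseteq> nilfun m j" by (rule lift_Suc_mono_le[OF _ assms(2)]) (use nilfun_Suc in blast)
  then show ?thesis using assms(1) by blast
qed

lemma nilfun_cong: assumes "f \<in> nilfun m i" "\<And>w. length w = m \<Longrightarrow> 3 dvd f' w - f w" shows "f' \<in> nilfun m i"
proof -
  have "(\<lambda>w. f' w - f w) \<in> nilfun m i" using assms(2) by (intro nilfun_mono[of _ m 0 i]) auto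
  from nilfun_add[OF assms(1) this] show ?thesis by simp
qed

lemma app_butlast: "butlast (app h w) = app h (butlast w)"
  by (cases w rule: rev_cases) (simp_all add: app_snoc)

lemma nilfun_butlast: "f \<in> nilfun m i \<Longrightarrow> (\<lambda>w. f (butlast w)) \<in> nilfun (Suc m) i"
proof (induction i arbitrary: f)
  case (Suc i)
  have "(\<lambda>w. f (app h (butlast w)) - f (butlast w)) \<in> nilfun (Suc m) i" if "h \<in> Gam" for h
    using Suc.IH[of "\<lambda>w. f (app h w) - f w"] Suc.prems that by simp
  then show ?case by (simp add: app_butlast)
qed simp

text \<open>A product rule: modulo 3 the last letter changes by \<open>sg h (butlast w)\<close>. The
  difference is therefore (difference of g) times the last letter, plus a function of
  \<open>butlast w\<close>, which i differences kill.\<close>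

lemma nilfun_linear:
  assumes all: "\<And>f. f \<in> nilfun m i" and g: "g \<in> nilfun m j"
  shows "(\<lambda>w. g (butlast w) * val (last w)) \<in> nilfun (Suc m) (i + j)"
  using g
proof (induction j arbitrary: g)
  case 0
  show ?case by (rule nilfun_mono[of _ "Suc m" 0]) (use 0 in auto)
next
  case (Suc j)
  have "(\<lambda>w. g (butlast (app h w)) * val (last (app h w)) - g (butlast w) * val (last w)) \<in> nilfun (Suc m) (i + j)"
    if h: "h \<in> Gam" for h
  proof (rule nilfun_cong)
    have "(\<lambda>w. g (app h (butlast w)) * sg h (butlast w)) \<in> nilfun (Suc m) (i + j)"
      using nilfun_butlast[OF all, of "\<lambda>w. g (app h w) * sg h w"] by (rule nilfun_mono) simp
    moreover have "(\<lambda>w. (g (app h (butlast w)) - g (butlast w)) * val (last w)) \<in> nilfun (Suc m) (i + j)"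
      using Suc.IH[of "\<lambda>w. g (app h w) - g w"] Suc.prems h by simp
    ultimately show "(\<lambda>w. (g (app h (butlast w)) - g (butlast w)) * val (last w)
      + g (app h (butlast w)) * sg h (butlast w)) \<in> nilfun (Suc m) (i + j)" by (intro nilfun_add)
    fix w :: vertex assume "length w = Suc m"
    then obtain u l where w: "w = u @ [l]" by (metis length_Suc_conv_rev)
    have "3 dvd val (act h u l) - val l - sg h u" using rot_sg_Gam[OF h] unfolding rot_def by blast
    then have "3 dvd g (app h u) * (val (act h u l) - val l - sg h u)" by simp
    then show "3 dvd (g (butlast (app h w)) * val (last (app h w)) - g (butlast w) * val (last w))
      - ((g (app h (butlast w)) - g (butlast w)) * val (last w) + g (app h (butlast w)) * sg h (butlast w))"
      by (simp add: w app_snoc algebra_simps)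
  qed
  then show ?case by simp
qed

text \<open>If the last letter x becomes x + s modulo 3, its square gains 2 s x + s^2, with s
  depending only on \<open>butlast w\<close>. These terms are at most linear in x, so 2 i
  differences kill them by \<open>nilfun_linear\<close>.\<close>

lemma nilfun_quadratic:
  assumes all: "\<And>f. f \<in> nilfun m i" and g: "g \<in> nilfun m j"
  shows "(\<lambda>w. g (butlast w) * (val (last w))\<^sup>2) \<in> nilfun (Suc m) (2 * i + j)"
  using g
proof (induction j arbitrary: g)
  case 0
  show ?case by (rule nilfun_mono[of _ "Suc m" 0]) (use 0 in auto)
next
  case (Suc j)
  have "(\<lambda>w. g (butlast (app h w)) * (val (last (app h w)))\<^sup>2 - g (butlast w) * (val (last w))\<^sup>2)
      \<in> nilfun (Suc m) (2 * i + j)" if h: "h \<in> Gam" for h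
  proof (rule nilfun_cong)
    have "(\<lambda>w. g (app h (butlast w)) * (sg h (butlast w))\<^sup>2) \<in> nilfun (Suc m) (2 * i + j)"
      using nilfun_butlast[OF all, of "\<lambda>w. g (app h w) * (sg h w)\<^sup>2"] by (rule nilfun_mono) simp
    moreover have "(\<lambda>w. (2 * g (app h (butlast w)) * sg h (butlast w)) * val (last w)) \<in> nilfun (Suc m) (2 * i + j)"
      using nilfun_linear[OF all all, of "\<lambda>w. 2 * g (app h w) * sg h w"] by (rule nilfun_mono) simp
    moreover have "(\<lambda>w. (g (app h (butlast w)) - g (butlast w)) * (val (last w))\<^sup>2) \<in> nilfun (Suc m) (2 * i + j)"
      using Suc.IH[of "\<lambda>w. g (app h w) - g w"] Suc.prems h by simp
    ultimately show "(\<lambda>w. (g (app h (butlast w)) - g (butlast w)) * (val (last w))\<^sup>2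
      + ((2 * g (app h (butlast w)) * sg h (butlast w)) * val (last w)
      + g (app h (butlast w)) * (sg h (butlast w))\<^sup>2)) \<in> nilfun (Suc m) (2 * i + j)" by (intro nilfun_add)
    fix w :: vertex assume "length w = Suc m"
    then obtain u l where w: "w = u @ [l]" by (metis length_Suc_conv_rev)
    let ?s = "sg h u" and ?x = "val l" and ?y = "val (act h u l)"
    have "3 dvd ?y - ?x - ?s" using rot_sg_Gam[OF h] unfolding rot_def by blast
    then have "3 dvd g (app h u) * (?y + ?x + ?s) * (?y - ?x - ?s)" by simp
    then show "3 dvd (g (butlast (app h w)) * (val (last (app h w)))\<^sup>2 - g (butlast w) * (val (last w))\<^sup>2)
      - ((g (app h (butlast w)) - g (butlast w)) * (val (last w))\<^sup>2
      + ((2 * g (app h (butlast w)) * sg h (butlast w)) * val (last w)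
      + g (app h (butlast w)) * (sg h (butlast w))\<^sup>2))"
      by (simp add: w app_snoc algebra_simps power2_eq_square)
  qed
  then show ?case by simp
qed

lemma nilfun_all: "\<exists>i. \<forall>f. f \<in> nilfun m i"
proof (induction m)
  case 0
  have "f \<in> nilfun 0 1" for f by simp
  then show ?case by blast
next
  case (Suc m)
  then obtain i where all: "\<And>f. f \<in> nilfun m i" by blast
  have "f \<in> nilfun (Suc m) (3 * i)" for f
  proof -
    define v where "v u l = f (u @ [l])" for u l
    \<comment> \<open>Interpolation at the values 0, 1, 2: the polynomial is exact at 0 and 1, and
      its defect at 2 is 3 (v0 - 2 v1 + v2).\<close>
    define k where "k u = v u L2 - v u L1" for u
    define q where "q u = v u L1 - v u L0 - k u" for u
    have "(\<lambda>w. v (butlast w) L0) \<in> nilfun (Suc m) (3 * i)"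
      using nilfun_butlast[OF all, of "\<lambda>u. v u L0"] by (rule nilfun_mono) simp
    moreover have "(\<lambda>w. k (butlast w) * val (last w)) \<in> nilfun (Suc m) (3 * i)"
      using nilfun_linear[OF all all, of k] by (rule nilfun_mono) simp
    moreover have "(\<lambda>w. q (butlast w) * (val (last w))\<^sup>2) \<in> nilfun (Suc m) (3 * i)"
      using nilfun_quadratic[OF all all, of q] by (rule nilfun_mono) simp
    ultimately have "(\<lambda>w. v (butlast w) L0 + (k (butlast w) * val (last w) + q (butlast w) * (val (last w))\<^sup>2))
      \<in> nilfun (Suc m) (3 * i)" by (intro nilfun_add)
    then show ?thesis
    proof (rule nilfun_cong)
      fix w :: vertex assume "length w = Suc m"
      then obtain u l where w: "w = u @ [l]" by (metis length_Suc_conv_rev)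
      have "v u l - (v u L0 + (k u * val l + q u * (val l)\<^sup>2)) = (if l = L2 then 3 * (v u L0 - 2 * v u L1 + v u L2) else 0)"
        by (cases l) (simp_all add: k_def q_def)
      then have "3 dvd v u l - (v u L0 + (k u * val l + q u * (val l)\<^sup>2))" by simp
      then show "3 dvd f w - (v (butlast w) L0 + (k (butlast w) * val (last w) + q (butlast w) * (val (last w))\<^sup>2))"
        by (simp add: w v_def)
    qed
  qed
  then show ?case by blast
qed

lemma lin_lcs:
  assumes "lcs Gam k \<subseteq> Stab m" "k \<ge> 1" "f \<in> nilfun m j" "g \<in> lcs Gam (k + j)"
  shows "3 dvd lin m f g"
  using assms(3,4)
proof (induction j arbitrary: f g)
  case 0
  then show ?case unfolding lin_def by (intro dvd_sum) auto
next
  case (Suc j)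
  let ?H = "{g \<in> Stab m. 3 dvd lin m f g}"
  have "is_subgrp ?H"
  proof (rule is_subI)
    show "0 \<in> ?H"
      by (simp add: is_subgrp_zero[OF is_subgrp_Stab] lin_def sg_def act_zero)
    show "x + y \<in> ?H" if "x \<in> ?H" "y \<in> ?H" for x y
      using that dvd_add[OF lin_add[of x m y f], of "lin m f x + lin m f y"] is_subgrp_add[OF is_subgrp_Stab]
      by simp
    show "- x \<in> ?H" if "x \<in> ?H" for x
      using that dvd_diff[OF lin_neg[of x m f], of "lin m f x"] is_subgrp_neg[OF is_subgrp_Stab]
      by simp
  qed
  moreover have "{comm x y |x y. x \<in> lcs Gam (k + j) \<and> y \<in> Gam} \<subseteq> ?H"
  proof clarify
    fix x h assume x: "x \<in> lcs Gam (k + j)" and h: "h \<in> Gam"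
    have xs: "x \<in> Stab m" using x assms(1) lcs_antimono[OF is_subgrp_Gam, of k "k + j"] by auto
    have "comm x h = x + (h + - x - h)" by (simp only: comm_def grp_norm)
    then have "comm x h \<in> Stab m"
      using is_subgrp_add[OF is_subgrp_Stab xs conj_Stab[OF is_subgrp_neg[OF is_subgrp_Stab xs] h]] by simp
    moreover have "3 dvd lin m (\<lambda>w. f (app h w) - f w) x"
      using Suc.IH[OF _ x] Suc.prems(1) h by simp
    from dvd_diff[OF lin_comm[OF xs h, of f] this] have "3 dvd lin m f (comm x h)" by simp
    ultimately show "comm x h \<in> Stab m \<and> 3 dvd lin m f (comm x h)" by blast
  qed
  moreover have "lcs Gam (k + Suc j) = gen {comm x y |x y. x \<in> lcs Gam (k + j) \<and> y \<in> Gam}"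
    using \<open>k \<ge> 1\<close> by (cases "k + j") auto
  ultimately show ?case using Suc.prems(2) gen_least by blast
qed

text \<open>With the indicator function of a single vertex as weight, the functional returns the
  shift at that vertex.\<close>

lemma Stab_SucI:
  assumes g: "g \<in> Stab m" and "\<And>f. 3 dvd lin m f g" shows "g \<in> Stab (Suc m)"
proof -
  have gG: "g \<in> Gam" using g by (simp add: Stab_def)
  have "app g v = v" if v: "length v = Suc m" for v
  proof -
    obtain w l where w: "v = w @ [l]" "length w = m" using v by (metis length_Suc_conv_rev)
    have "lin m (\<lambda>u. if u = w then 1 else 0) g = sg g w"
      unfolding lin_def using finite_level[of m] w(2)
      by (subst sum.remove[of _ w]) (auto intro!: sum.neutral)
    then have "3 dvd sg g w" using assms(2) by metis
    moreover have "3 dvd val (act g w l) - val l - sg g w"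
      using rot_sg_Gam[OF gG] unfolding rot_def by blast
    ultimately have "3 dvd (val (act g w l) - val l - sg g w) + sg g w" by (rule dvd_add[rotated])
    then have "act g w l = l" by (intro val_inj) simp
    then show ?thesis using g w by (simp add: app_snoc Stab_def)
  qed
  then show ?thesis using gG by (simp add: Stab_def)
qed

text \<open>Once a term fixes level m, a number of further commutators that is uniform in f kills
  every functional \<open>lin m f\<close>, by \<open>nilfun_all\<close>, and then level m + 1 is
  fixed too.\<close>

lemma lcs_Stab: "\<exists>k\<ge>1. lcs Gam k \<subseteq> Stab m"
proof (induction m)
  case 0
  then show ?case by (intro exI[of _ 1]) (auto simp: Stab_def)
next
  case (Suc m)
  then obtain k where k: "k \<ge> 1" "lcs Gam k \<subseteq> Stab m" by blast
  obtain i where i: "\<And>f. f \<in> nilfun m i" using nilfun_all by blast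
  have "lcs Gam (k + i) \<subseteq> Stab (Suc m)"
  proof
    fix g assume g: "g \<in> lcs Gam (k + i)"
    have "g \<in> Stab m" using g k(2) lcs_antimono[OF is_subgrp_Gam, of k "k + i"] by auto
    then show "g \<in> Stab (Suc m)" using lin_lcs[OF k(2,1) i g] by (rule Stab_SucI)
  qed
  then show ?case using k(1) by (intro exI[of _ "k + i"]) simp
qed

lemma gc_neq_0: "gc \<noteq> 0"
proof
  assume "gc = 0"
  then have "tri (gb - ga) (ga + ga) (- ga - gb) = tri 0 0 0" unfolding gc_eq tri_zero .
  then have "gb - ga = 0" by (simp only: tri_inject)
  then have "gb = ga" by simp
  then have "ga \<in> tri3 UNIV" using gb_eq by (metis UNIV_I tri_in_tri3)
  then show False using ga_notin_tri3 by blast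
qed

lemma K_nontrivial: "\<exists>g\<in>level2 m. g \<noteq> 0"
proof (induction m)
  case 0
  then show ?case using gc_Gam2 gc_neq_0 by auto
next
  case (Suc m)
  then obtain g where g: "g \<in> level2 m" "g \<noteq> 0" by blast
  then have "tri g 0 0 \<in> level2 (Suc m)" by (simp add: is_subgrp_zero[OF is_subgrp_K])
  moreover have "tri g 0 0 \<noteq> 0" using g(2) tri_inject[of g 0 0 0 0 0] by (simp del: tri_inject)
  ultimately show ?case by blast
qed

lemma depth_unbounded: "\<exists>m. n \<le> depth m"
proof -
  obtain m where "real n < 1.83 ^ m" using real_arch_pow[of "1.83 :: real" "real n"] by auto
  then have "real n < real (depth m)" using depth_growth[of m] by linarith
  then show ?thesis by (intro exI[of _ m]) simp
qed

text \<open>If two consecutive terms agree, the series is constant from there on, so the term lies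
  in every level stabiliser and is trivial. But each term contains some \<open>level2 m\<close>,
  which is not trivial.\<close>

theorem lcs_strict: assumes "k \<ge> 1" shows "\<not> lcs Gam k \<subseteq> lcs Gam (Suc k)"
proof
  assume "lcs Gam k \<subseteq> lcs Gam (Suc k)"
  then have eq: "lcs Gam (Suc k) = lcs Gam k" using lcs_Suc_subset[OF is_subgrp_Gam] by blast
  have const: "lcs Gam (k + j) = lcs Gam k" for j
  proof (induction j)
    case (Suc j)
    obtain k' where k': "k = Suc k'" using assms by (cases k) auto
    have "lcs Gam (Suc (Suc (k' + j))) = gen {comm x y |x y. x \<in> lcs Gam (Suc (k' + j)) \<and> y \<in> Gam}" by simp
    also have "\<dots> = lcs Gam (Suc k)" using Suc k' by simp
    finally show ?case using eq k' by simp
  qed simp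
  have triv: "g = 0" if g: "g \<in> lcs Gam k" for g
  proof (rule tree_aut_eqI)
    fix w :: vertex
    obtain i where i: "lcs Gam i \<subseteq> Stab (length w)" using lcs_Stab by blast
    have "g \<in> lcs Gam (k + i)" using const g by simp
    then have "g \<in> Stab (length w)" using i lcs_antimono[OF is_subgrp_Gam, of i "k + i"] by auto
    then show "app g w = app 0 w" by (simp add: Stab_def app_zero)
  qed
  obtain m where "k \<le> depth m" using depth_unbounded by blast
  then have "level2 m \<subseteq> lcs Gam k" using K_lcs[of m] lcs_antimono[OF is_subgrp_Gam] by blast
  then show False using K_nontrivial[of m] triv by blast
qed

lemma not_Gam2_Gam3: "\<not> Gam2 \<subseteq> Gam3"
  using lcs_strict[of 2] by (simp add: Gam2_def Gam3_def)

section \<open>Quotients of the Gupta-Sidki group\<close>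

lemma AutT3_mult_app: "app x \<otimes>\<^bsub>AutT3\<^esub> app y = app (x + y)"
  using AutT3_mult[OF app app] by (simp add: plus_tree_aut.rep_eq)

lemma AutT3_one: "\<one>\<^bsub>AutT3\<^esub> = app 0"
  by (simp add: zero_tree_aut.rep_eq AutT3_def BijGroup_def id_def restrict_def)

lemma AutT3_inv_app: "inv\<^bsub>AutT3\<^esub> app x = app (- x)"
  by (simp add: uminus_tree_aut.rep_eq)

lemma gs_mult_app: "app x \<otimes>\<^bsub>gupta_sidki\<^esub> app y = app (x + y)"
  and gs_one: "\<one>\<^bsub>gupta_sidki\<^esub> = app 0"
  by (simp_all add: gupta_sidki_def subgroup_generated_def AutT3_mult_app AutT3_one)

text \<open>Serves both \<open>AutT3\<close> and the Gupta-Sidki group. The inverse law is asked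
  only on \<open>gen A\<close>, because \<open>gs_inv_app\<close> gives it only for elements of
  \<open>Gam\<close>.\<close>

lemma generate_app:
  assumes "group H" and mult: "\<And>x y. app x \<otimes>\<^bsub>H\<^esub> app y = app (x + y)" and one: "\<one>\<^bsub>H\<^esub> = app 0"
    and inv: "\<And>x. x \<in> gen A \<Longrightarrow> inv\<^bsub>H\<^esub> app x = app (- x)" and A: "app ` A \<subseteq> carrier H"
  shows "generate H (app ` A) = app ` gen A"
proof
  show "generate H (app ` A) \<subseteq> app ` gen A"
  proof
    fix f assume "f \<in> generate H (app ` A)"
    then show "f \<in> app ` gen A"
    proof induction
      case (eng f g)
      then show ?case by (auto simp: mult intro!: imageI gen.add)
    next
      case inv': (inv f)
      then obtain x where "x \<in> A" "f = app x" by blast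
      then have "inv\<^bsub>H\<^esub> f = app (- x)" "- x \<in> gen A" by (auto simp: inv gen.incl gen.neg)
      then show ?case by simp
    qed (auto simp: one intro!: imageI intro: gen.zero gen.incl)
  qed
  have "app x \<in> generate H (app ` A)" if "x \<in> gen A" for x
    using that
  proof induction
    case zero
    then show ?case using generate.one[of H] by (simp add: one)
  next
    case (incl x)
    then show ?case by (auto intro: generate.incl)
  next
    case (add x y)
    then show ?case using generate.eng[of "app x" H "app ` A" "app y"] by (simp add: mult)
  next
    case (neg x)
    then show ?case using group.generate_m_inv_closed[OF \<open>group H\<close> A] inv by metis
  qed
  then show "app ` gen A \<subseteq> generate H (app ` A)" by blast
qed

lemma carrier_gs: "carrier gupta_sidki = app ` Gam"
proof -
  have "app ` {ga, gb} = {gs_a, gs_b}" by (simp add: ga.rep_eq gb.rep_eq)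
  then show ?thesis
    using generate_app[OF group_AutT3 AutT3_mult_app AutT3_one AutT3_inv_app, of "{ga, gb}"] app
    by (simp add: carrier_gupta_sidki Gam_def gs_a_in_AutT3 gs_b_in_AutT3)
qed

lemma gs_inv_app: assumes "x \<in> Gam" shows "inv\<^bsub>gupta_sidki\<^esub> app x = app (- x)"
proof (rule group.inv_equality[OF group_gupta_sidki])
  show "app (- x) \<otimes>\<^bsub>gupta_sidki\<^esub> app x = \<one>\<^bsub>gupta_sidki\<^esub>" by (simp add: gs_mult_app gs_one)
qed (use assms in \<open>simp_all add: carrier_gs is_subgrp_neg[OF is_subgrp_Gam]\<close>)

lemma generate_gs: assumes "A \<subseteq> Gam" shows "generate gupta_sidki (app ` A) = app ` gen A"
proof (rule generate_app[OF group_gupta_sidki gs_mult_app gs_one])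
  show "inv\<^bsub>gupta_sidki\<^esub> app x = app (- x)" if "x \<in> gen A" for x
    using that gen_least[OF is_subgrp_Gam assms] by (intro gs_inv_app) blast
qed (use assms in \<open>auto simp: carrier_gs\<close>)

lemma lower_central_gs: "lower_central gupta_sidki n = app ` lcs Gam n"
proof (induction n rule: induct_nat_012)
  case (ge2 n)
  let ?A = "{comm x y |x y. x \<in> lcs Gam (Suc n) \<and> y \<in> Gam}"
  have sub: "lcs Gam (Suc n) \<subseteq> Gam" by (rule lcs_subset[OF is_subgrp_Gam])
  have "(\<Union>f\<in>app ` lcs Gam (Suc n). \<Union>g\<in>app ` Gam.
      {f \<otimes>\<^bsub>gupta_sidki\<^esub> g \<otimes>\<^bsub>gupta_sidki\<^esub> inv\<^bsub>gupta_sidki\<^esub> f \<otimes>\<^bsub>gupta_sidki\<^esub> inv\<^bsub>gupta_sidki\<^esub> g})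
    = (\<Union>x\<in>lcs Gam (Suc n). \<Union>y\<in>Gam. {app (comm x y)})"
    unfolding image_image UN_simps
    using sub by (intro SUP_cong refl) (auto simp: gs_inv_app gs_mult_app comm_def subset_iff)
  also have "\<dots> = app ` ?A" by blast
  finally have "lower_central gupta_sidki (Suc (Suc n)) = generate gupta_sidki (app ` ?A)"
    by (simp only: lower_central.simps carrier_gs ge2.IH)
  also have "\<dots> = app ` gen ?A"
    using sub is_subgrp_comm[OF is_subgrp_Gam] by (intro generate_gs) blast
  finally show ?case by simp
qed (simp_all add: carrier_gs)

text \<open>Right cosets, to agree with \<open>#>\<close> in \<open>r_coset_gs\<close>.\<close>

definition coset :: "tree_aut set \<Rightarrow> tree_aut \<Rightarrow> tree_aut set" where
  "coset M x = (\<lambda>m. m + x) ` M"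

lemma coset_eq_iff: assumes "is_subgrp M" shows "coset M x = coset M y \<longleftrightarrow> x - y \<in> M"
proof
  assume "coset M x = coset M y"
  moreover have "x \<in> coset M x" using is_subgrp_zero[OF assms] by (force simp: coset_def)
  ultimately obtain m where "m \<in> M" "x = m + y" by (auto simp: coset_def)
  then show "x - y \<in> M" by simp
next
  assume d: "x - y \<in> M"
  have "m + x \<in> coset M y" if "m \<in> M" for m
  proof -
    have "m + x = (m + (x - y)) + y" by (simp only: grp_norm)
    then show ?thesis using is_subgrp_add[OF assms that d] by (simp add: coset_def)
  qed
  moreover have "m + y \<in> coset M x" if "m \<in> M" for m
  proof -
    have "m + y = (m - (x - y)) + x" by (simp only: grp_norm)
    then show ?thesis using is_subgrp_diff[OF assms that d] by (simp add: coset_def)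
  qed
  ultimately show "coset M x = coset M y" unfolding coset_def by blast
qed

lemma r_coset_gs: "app ` M #>\<^bsub>gupta_sidki\<^esub> app x = app ` coset M x"
  unfolding r_coset_def coset_def by (auto simp: gs_mult_app)

lemma normal_gs: assumes M: "normal_sub Gam M" shows "app ` M \<lhd> gupta_sidki"
proof -
  interpret group gupta_sidki by (rule group_gupta_sidki)
  have s: "subgroup (app ` M) gupta_sidki"
  proof (rule subgroupI)
    show "app ` M \<subseteq> carrier gupta_sidki" using normal_sub_subset[OF M] by (auto simp: carrier_gs)
    show "app ` M \<noteq> {}" using is_subgrp_zero[OF normal_sub_sub[OF M]] by blast
    show "inv\<^bsub>gupta_sidki\<^esub> f \<in> app ` M" if "f \<in> app ` M" for f
      using that normal_sub_subset[OF M] is_subgrp_neg[OF normal_sub_sub[OF M]] by (auto simp: gs_inv_app subset_iff)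
    show "f \<otimes>\<^bsub>gupta_sidki\<^esub> g \<in> app ` M" if "f \<in> app ` M" "g \<in> app ` M" for f g
      using that is_subgrp_add[OF normal_sub_sub[OF M]] by (auto simp: gs_mult_app)
  qed
  have "f \<otimes>\<^bsub>gupta_sidki\<^esub> h \<otimes>\<^bsub>gupta_sidki\<^esub> inv\<^bsub>gupta_sidki\<^esub> f \<in> app ` M"
    if "f \<in> carrier gupta_sidki" "h \<in> app ` M" for f h
    using that normal_sub_conj[OF M] by (auto simp: carrier_gs gs_inv_app gs_mult_app)
  with s show ?thesis by (simp add: normal_inv_iff)
qed

section \<open>Diameters of quotients\<close>

lemma (in group) word_ball_subset:
  assumes "S \<subseteq> carrier G" shows "word_ball G S n \<subseteq> carrier G"
proof -
  have "foldr (\<otimes>) xs \<one> \<in> carrier G" if "set xs \<subseteq> S \<union> (\<lambda>s. inv s) ` S" for xs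
    using that assms by (induction xs) auto
  then show ?thesis by (auto simp: word_ball_def)
qed

text \<open>The uniform bound makes the set under \<open>Max\<close> finite, and the carrier as a
  generating set makes it nonempty.\<close>

lemma (in group) diam_le:
  assumes "\<And>S. S \<subseteq> carrier G \<Longrightarrow> generate G S = carrier G \<Longrightarrow> carrier G \<subseteq> word_ball G S n"
  shows "diam G \<le> n"
proof -
  let ?D = "{diam_wrt G S | S. S \<subseteq> carrier G \<and> generate G S = carrier G}"
  have "diam_wrt G S \<le> n" if "S \<subseteq> carrier G" "generate G S = carrier G" for S
    unfolding diam_wrt_def using assms[OF that] word_ball_subset[OF that(1)]
    by (intro Least_le) blast
  then have D: "?D \<subseteq> {..n}" by blast
  have "generate G (carrier G) = carrier G"
    using generate_incl[of "carrier G"] generate.incl by fast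
  then have "?D \<noteq> {}" by blast
  then show ?thesis
    unfolding diam_def using D finite_subset[OF D] by (subst Max_le_iff) auto
qed

locale gs_quotient =
  fixes M assumes M: "normal_sub Gam M"
begin

abbreviation "Q \<equiv> gupta_sidki Mod (app ` M)"

definition proj :: "tree_aut \<Rightarrow> (vertex \<Rightarrow> vertex) set" where
  "proj x = app ` coset M x"

sublocale N: normal "app ` M" gupta_sidki by (rule normal_gs[OF M])

lemma group_Q: "group Q" by (rule N.factorgroup_is_group)

lemma carrier_Q: "carrier Q = proj ` Gam"
  by (simp add: carrier_FactGroup carrier_gs image_image r_coset_gs proj_def)

lemma proj_zero: "\<one>\<^bsub>Q\<^esub> = proj 0"
  by (simp add: proj_def coset_def)

lemma proj_add: assumes "x \<in> Gam" "y \<in> Gam" shows "proj x \<otimes>\<^bsub>Q\<^esub> proj y = proj (x + y)"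
  using N.rcos_sum[of "app x" "app y"] assms by (simp add: r_coset_gs carrier_gs gs_mult_app proj_def)

lemma proj_neg: assumes "x \<in> Gam" shows "inv\<^bsub>Q\<^esub> proj x = proj (- x)"
proof (rule group.inv_equality[OF group_Q])
  show "proj (- x) \<otimes>\<^bsub>Q\<^esub> proj x = \<one>\<^bsub>Q\<^esub>"
    using proj_add[of "- x" x] assms proj_zero by (simp add: is_subgrp_neg[OF is_subgrp_Gam])
qed (use assms in \<open>simp_all add: carrier_Q is_subgrp_neg[OF is_subgrp_Gam]\<close>)

lemma proj_eq_iff: "proj x = proj y \<longleftrightarrow> x - y \<in> M"
proof -
  have "inj app" by (simp add: inj_on_def app_inject)
  then show ?thesis by (simp add: proj_def inj_image_eq_iff coset_eq_iff normal_sub_sub[OF M])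
qed

lemma foldr_proj:
  "set xs \<subseteq> Gam \<Longrightarrow> sum_list xs \<in> Gam \<and> foldr (\<otimes>\<^bsub>Q\<^esub>) (map proj xs) \<one>\<^bsub>Q\<^esub> = proj (sum_list xs)"
proof (induction xs)
  case Nil
  then show ?case using proj_zero is_subgrp_zero[OF is_subgrp_Gam] by simp
next
  case (Cons x xs)
  then show ?case using proj_add[of x "sum_list xs"] is_subgrp_add[OF is_subgrp_Gam] by simp
qed

lemma gen_lift:
  assumes S: "S \<subseteq> Gam" and g: "generate Q (proj ` S) = carrier Q"
  shows "Gam \<subseteq> gen (S \<union> M)"
proof
  have G: "gen (S \<union> M) \<subseteq> Gam" using S normal_sub_subset[OF M] by (intro gen_least is_subgrp_Gam) blast
  have *: "\<exists>x\<in>gen (S \<union> M). q = proj x" if "q \<in> generate Q (proj ` S)" for q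
    using that
  proof induction
    case one
    then show ?case using proj_zero gen.zero by blast
  next
    case (incl q)
    then show ?case using gen.incl[of _ "S \<union> M"] by blast
  next
    case (inv q)
    then obtain x where x: "x \<in> S" "q = proj x" by blast
    have "- x \<in> gen (S \<union> M)" using x(1) by (intro gen.neg gen.incl) blast
    moreover have "inv\<^bsub>Q\<^esub> q = proj (- x)" using proj_neg S x by blast
    ultimately show ?case by blast
  next
    case (eng q r)
    then obtain x y where xy: "x \<in> gen (S \<union> M)" "y \<in> gen (S \<union> M)" "q = proj x" "r = proj y" by blast
    have "q \<otimes>\<^bsub>Q\<^esub> r = proj (x + y)" unfolding xy using xy(1,2) G by (intro proj_add) blast+
    then show ?case using gen.add[OF xy(1,2)] by blast
  qed
  fix x assume "x \<in> Gam"
  then have "proj x \<in> generate Q (proj ` S)" using g by (simp add: carrier_Q)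
  then obtain y where y: "y \<in> gen (S \<union> M)" "proj x = proj y" using * by blast
  then have "x - y \<in> M" by (simp add: proj_eq_iff)
  then have "(x - y) + y \<in> gen (S \<union> M)" using y(1) by (intro gen.add[OF gen.incl]) auto
  then show "x \<in> gen (S \<union> M)" by simp
qed

lemma word_ball_covers:
  assumes S: "S \<subseteq> Gam" and c: "covers S Gam N n" and N: "N \<subseteq> M"
  shows "carrier Q \<subseteq> word_ball Q (proj ` S) n"
proof
  fix q assume "q \<in> carrier Q"
  then obtain g where g: "g \<in> Gam" "q = proj g" by (auto simp: carrier_Q)
  obtain t where t: "t \<in> N" "g + t \<in> words S n" using coversD[OF c g(1)] by blast
  then obtain xs where xs: "g + t = sum_list xs" "length xs \<le> n" "set xs \<subseteq> S \<union> uminus ` S"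
    by (auto simp: words_def)
  have xG: "set xs \<subseteq> Gam" using xs(3) S is_subgrp_neg[OF is_subgrp_Gam] by blast
  have "- (g + - t - g) \<in> M"
    using normal_sub_conj[OF M g(1)] t(1) N is_subgrp_neg[OF normal_sub_sub[OF M]] by blast
  moreover have "- (g + - t - g) = (g + t) - g" by (simp only: grp_norm)
  ultimately have "proj (g + t) = q" using g(2) by (simp only: proj_eq_iff)
  then have "q = foldr (\<otimes>\<^bsub>Q\<^esub>) (map proj xs) \<one>\<^bsub>Q\<^esub>" using foldr_proj[OF xG] xs(1) by simp
  moreover have "set (map proj xs) \<subseteq> proj ` S \<union> (\<lambda>s. inv\<^bsub>Q\<^esub> s) ` proj ` S"
  proof
    fix r assume "r \<in> set (map proj xs)"
    then obtain x where x: "x \<in> set xs" "r = proj x" by auto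
    show "r \<in> proj ` S \<union> (\<lambda>s. inv\<^bsub>Q\<^esub> s) ` proj ` S"
    proof (cases "x \<in> S")
      case False
      then obtain y where "y \<in> S" "x = - y" using x(1) xs(3) by blast
      then show ?thesis using x(2) proj_neg[of y] S by blast
    qed (use x in blast)
  qed
  ultimately show "q \<in> word_ball Q (proj ` S) n"
    unfolding word_ball_def using xs(2) by (intro CollectI exI[of _ "map proj xs"]) simp
qed

text \<open>As \<open>M\<close> lies in \<open>Gam2\<close>, the preimage of a generating set
  generates \<open>Gam\<close> modulo \<open>Gam2\<close>, as \<open>covers_if_generates\<close>
  requires; as \<open>level2 m\<close> lies in \<open>M\<close>, the covering errors vanish in the
  quotient.\<close>

lemma diam_Q_le:
  assumes "M \<subseteq> Gam2" "level2 m \<subseteq> M"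
  shows "diam Q \<le> 45 * 13 ^ m"
proof (rule group.diam_le[OF group_Q])
  fix S' assume S': "S' \<subseteq> carrier Q" "generate Q S' = carrier Q"
  define S where "S = {x \<in> Gam. proj x \<in> S'}"
  have S: "S \<subseteq> Gam" by (auto simp: S_def)
  have eq: "S' = proj ` S" using S'(1) by (auto simp: S_def carrier_Q)
  have "Gam \<subseteq> gen (S \<union> M)" using gen_lift[OF S] S'(2) eq by simp
  also have "\<dots> \<subseteq> gen (S \<union> Gam2)" using assms(1) by (intro gen_mono) blast
  finally have "covers S Gam (level2 m) (45 * 13 ^ m)" by (rule covers_if_generates[OF not_Gam2_Gam3 S])
  then show "carrier Q \<subseteq> word_ball Q S' (45 * 13 ^ m)"
    unfolding eq using assms(2) by (rule word_ball_covers[OF S])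
qed

end

lemma gs_quotient_lcs: "gs_quotient (lcs Gam n)"
  by (simp add: gs_quotient_def normal_sub_lcs is_subgrp_Gam)

section \<open>The index of the terms of the series\<close>

lemma finite_words: "finite S \<Longrightarrow> finite (words S n)"
proof -
  assume "finite S"
  then have "finite {xs. set xs \<subseteq> S \<union> uminus ` S \<and> length xs \<le> n}"
    by (intro finite_lists_length_le) simp
  moreover have "words S n = sum_list ` {xs. set xs \<subseteq> S \<union> uminus ` S \<and> length xs \<le> n}"
    by (auto simp: words_def)
  ultimately show ?thesis by simp
qed

text \<open>Covering by words of bounded length in a and b already implies finite index.\<close>

lemma finite_cosets: "finite (coset (lcs Gam n) ` Gam)"
proof -
  let ?S = "{ga, gb}"
  obtain m where "n \<le> depth m" using depth_unbounded by blast
  then have K: "level2 m \<subseteq> lcs Gam n" using K_lcs[of m] lcs_antimono[OF is_subgrp_Gam] by blast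
  have S: "?S \<subseteq> Gam" using ga_Gam gb_Gam by blast
  have "Gam \<subseteq> gen (?S \<union> Gam2)" unfolding Gam_def by (intro gen_mono) blast
  then have c: "covers ?S Gam (level2 m) (45 * 13 ^ m)"
    by (rule covers_if_generates[OF not_Gam2_Gam3 S])
  have N: "normal_sub Gam (lcs Gam n)" by (rule normal_sub_lcs[OF is_subgrp_Gam])
  have "coset (lcs Gam n) ` Gam \<subseteq> coset (lcs Gam n) ` words ?S (45 * 13 ^ m)"
  proof clarify
    fix g assume g: "g \<in> Gam"
    obtain t where t: "t \<in> level2 m" "g + t \<in> words ?S (45 * 13 ^ m)" using coversD[OF c g] by blast
    have "g + - t - g \<in> lcs Gam n"
      using normal_sub_conj[OF N g] is_subgrp_neg[OF normal_sub_sub[OF N]] t(1) K by blast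
    moreover have "g + - t - g = g - (g + t)" by (simp only: grp_norm)
    ultimately have "coset (lcs Gam n) g = coset (lcs Gam n) (g + t)"
      by (simp only: coset_eq_iff[OF normal_sub_sub[OF N]])
    then show "coset (lcs Gam n) g \<in> coset (lcs Gam n) ` words ?S (45 * 13 ^ m)" using t(2) by blast
  qed
  then show ?thesis using finite_words[of ?S] finite_subset by blast
qed

text \<open>Strict decrease at least doubles the index: with z in one term but not in the next, each
  coset with representative r contains the distinct finer cosets of r and z + r.\<close>

lemma card_cosets: "2 ^ n \<le> card (coset (lcs Gam (Suc n)) ` Gam)"
proof (induction n)
  case 0
  have "coset Gam 0 \<in> coset Gam ` Gam" using is_subgrp_zero[OF is_subgrp_Gam] by blast
  then show ?case using finite_cosets[of 1] by (auto simp: Suc_le_eq card_gt_0_iff)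
next
  case (Suc n)
  let ?A = "lcs Gam (Suc n)" and ?B = "lcs Gam (Suc (Suc n))"
  have A: "is_subgrp ?A" and B: "is_subgrp ?B" by (rule is_subgrp_lcs[OF is_subgrp_Gam])+
  have BA: "?B \<subseteq> ?A" by (rule lcs_Suc_subset[OF is_subgrp_Gam])
  obtain z where z: "z \<in> ?A" "z \<notin> ?B" using lcs_strict[of "Suc n"] by auto
  have zG: "z \<in> Gam" using z(1) lcs_subset[OF is_subgrp_Gam] by blast
  define r where "r = (\<lambda>D. SOME x. x \<in> Gam \<and> coset ?A x = D)"
  have r: "r D \<in> Gam" "coset ?A (r D) = D" if "D \<in> coset ?A ` Gam" for D
    using someI_ex[of "\<lambda>x. x \<in> Gam \<and> coset ?A x = D"] that by (auto simp: r_def)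
  define f where "f = (\<lambda>(D, b :: bool). coset ?B (if b then z + r D else r D))"
  have fA: "coset ?A (if b then z + r D else r D) = D" if "D \<in> coset ?A ` Gam" for D b
  proof -
    have "coset ?A (z + r D) = coset ?A (r D)" using z(1) by (simp add: coset_eq_iff[OF A])
    then show ?thesis using r(2)[OF that] by simp
  qed
  have BtoA: "coset ?A x = coset ?A y" if "coset ?B x = coset ?B y" for x y
    using that BA unfolding coset_eq_iff[OF A] coset_eq_iff[OF B] by blast
  have ne: "coset ?B (z + r D) \<noteq> coset ?B (r D)" for D
    using z(2) unfolding coset_eq_iff[OF B] by (simp del: lcs.simps)
  have "inj_on f ((coset ?A ` Gam) \<times> UNIV)"
  proof (rule inj_onI)
    fix p p' assume "p \<in> coset ?A ` Gam \<times> UNIV" "p' \<in> coset ?A ` Gam \<times> UNIV" "f p = f p'"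
    then obtain D b D' b' where p: "p = (D, b)" "p' = (D', b')"
      and D: "D \<in> coset ?A ` Gam" "D' \<in> coset ?A ` Gam" "f (D, b) = f (D', b')" by (cases p, cases p') auto
    then have eq: "coset ?B (if b then z + r D else r D) = coset ?B (if b' then z + r D' else r D')"
      by (simp add: f_def)
    have DD: "D = D'" using BtoA[OF eq] fA[OF D(1), of b] fA[OF D(2), of b'] by simp
    have "b = b'" using eq ne[of D'] ne[of D', symmetric] unfolding DD by (cases b; cases b') auto
    with DD show "p = p'" by (simp add: p)
  qed
  moreover have "f ` ((coset ?A ` Gam) \<times> UNIV) \<subseteq> coset ?B ` Gam"
    using r(1) zG is_subgrp_add[OF is_subgrp_Gam] by (auto simp: f_def)
  ultimately have "card ((coset ?A ` Gam) \<times> (UNIV :: bool set)) \<le> card (coset ?B ` Gam)"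
    using finite_cosets by (rule card_inj_on_le)
  then show ?case using Suc by (simp add: card_cartesian_product)
qed

lemma card_rcosets_gs:
  "card (rcosets\<^bsub>gupta_sidki\<^esub> lower_central gupta_sidki n) = card (coset (lcs Gam n) ` Gam)"
proof -
  have "rcosets\<^bsub>gupta_sidki\<^esub> lower_central gupta_sidki n = image app ` coset (lcs Gam n) ` Gam"
    by (auto simp: RCOSETS_def lower_central_gs carrier_gs r_coset_gs)
  moreover have "inj app" by (simp add: inj_on_def app_inject)
  then have "inj_on (image app) A" for A by (metis inj_image_eq_iff inj_onI)
  ultimately show ?thesis by (simp add: card_image)
qed

section \<open>Exponents\<close>

text \<open>As 4.28 = 107 / 25, this amounts to 3^107 <= 111^25.\<close>

lemma exponent_ge: "4.28 \<le> ln 111 / ln (3::real)"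
proof -
  have "ln ((3::real) ^ 107) \<le> ln (111 ^ 25)" by (subst ln_le_cancel_iff) simp_all
  then have "107 * ln 3 \<le> 25 * ln (111::real)" by (simp only: ln_realpow zero_less_numeral of_nat_numeral)
  then show ?thesis by (simp add: field_simps)
qed

lemma exponent_mono: "ln 111 / ln 3 \<le> ln 111 / ln (1 + sqrt (2::real))"
proof (rule divide_left_mono)
  have "sqrt (2::real) \<le> 2" by (rule real_le_lsqrt) auto
  then show "ln (1 + sqrt 2) \<le> ln (3::real)" by (subst ln_le_cancel_iff) (auto intro: add_pos_nonneg)
qed (auto intro!: mult_pos_pos ln_gt_zero)

text \<open>The 25th root of the integer inequality 13^25 * 100^107 <= 183^107.\<close>

lemma thirteen_le: "13 \<le> (1.83::real) powr 4.28"
proof -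
  have "(13::real) = (13 ^ 25) powr (1 / 25)" by (simp add: powr_powr flip: powr_realpow)
  also have "\<dots> \<le> (1.83 ^ 107) powr (1 / 25)"
  proof (rule powr_mono2)
    have "(13::real) ^ 25 * 100 ^ 107 \<le> 183 ^ 107" by simp
    then have "(13::real) ^ 25 \<le> (183 / 100) ^ 107" unfolding power_divide by (simp only: pos_le_divide_eq zero_less_power zero_less_numeral)
    then show "(13::real) ^ 25 \<le> 1.83 ^ 107" by (simp only: power2_eq_square) simp
  qed simp_all
  also have "\<dots> = (1.83 powr real 107) powr (1 / 25)"
    by (subst powr_realpow) (rule zero_less_divide_iff[THEN iffD2], simp, rule refl)
  also have "\<dots> = 1.83 powr (real 107 * (1 / 25))" by (rule powr_powr)
  also have "real 107 * (1 / 25) = 4.28" by simp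
  finally show ?thesis .
qed

text \<open>Meant for the least m whose depth reaches n. The preceding level still has depth below
  n, so 1.83^(m - 1) <= n; the factor 13 pays for the last level.\<close>

lemma thirteen_power_le:
  assumes "n \<ge> 1" "\<And>k. k < m \<Longrightarrow> depth k < n"
  shows "13 ^ m \<le> 13 * real n powr 4.28"
proof (cases m)
  case 0
  have "1 \<le> real n powr 4.28" using assms(1) by (intro ge_one_powr_ge_zero) auto
  then show ?thesis using 0 by simp
next
  case (Suc k)
  have "real (depth k) < real n" using assms(2)[of k] Suc by simp
  then have k: "1.83 ^ k \<le> real n" using depth_growth[of k] by linarith
  have "(13::real) ^ k \<le> (1.83 powr 4.28) ^ k" using thirteen_le by (intro power_mono) auto
  also have "\<dots> = (1.83 ^ k) powr 4.28" by (simp add: powr_powr mult.commute flip: powr_realpow)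
  also have "\<dots> \<le> real n powr 4.28" using k by (intro powr_mono2) auto
  finally show ?thesis using Suc by simp
qed

text \<open>The constant 585 is 45 * 13. The trivial quotient n = 1 is treated apart, because
  \<open>diam_Q_le\<close> needs the divisor inside \<open>Gam2\<close>.\<close>

lemma diam_gs_bound:
  assumes "n \<ge> 1"
  shows "real (diam (gupta_sidki Mod lower_central gupta_sidki n)) \<le> 585 * real n powr 4.28"
    and "n = 1 \<Longrightarrow> diam (gupta_sidki Mod lower_central gupta_sidki n) = 0"
proof -
  interpret gs_quotient "lcs Gam n" by (rule gs_quotient_lcs)
  have one: "diam Q = 0" if "n = 1"
  proof -
    have "carrier Q \<subseteq> {\<one>\<^bsub>Q\<^esub>}"
    proof
      fix q assume "q \<in> carrier Q"
      then obtain x where "x \<in> Gam" "q = proj x" by (auto simp: carrier_Q)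
      then show "q \<in> {\<one>\<^bsub>Q\<^esub>}" using proj_eq_iff[of x 0] proj_zero that by simp
    qed
    moreover have "\<one>\<^bsub>Q\<^esub> \<in> word_ball Q S 0" for S by (auto simp: word_ball_def)
    ultimately have "diam Q \<le> 0" by (intro group.diam_le[OF group_Q]) blast
    then show ?thesis by simp
  qed
  then show "n = 1 \<Longrightarrow> diam (gupta_sidki Mod lower_central gupta_sidki n) = 0"
    unfolding lower_central_gs .
  show "real (diam (gupta_sidki Mod lower_central gupta_sidki n)) \<le> 585 * real n powr 4.28"
  proof (cases "n = 1")
    case True
    then show ?thesis unfolding lower_central_gs by (subst one) simp_all
  next
    case False
    define m where "m = (LEAST m. n \<le> depth m)"
    have m: "n \<le> depth m" unfolding m_def using depth_unbounded by (rule LeastI_ex)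
    have "\<not> n \<le> depth k" if "k < m" for k using not_less_Least that unfolding m_def by blast
    then have "13 ^ m \<le> 13 * real n powr 4.28"
      using assms by (intro thirteen_power_le) (auto simp: not_le)
    moreover have "diam Q \<le> 45 * 13 ^ m"
    proof (rule diam_Q_le)
      show "lcs Gam n \<subseteq> Gam2" using lcs_antimono[OF is_subgrp_Gam, of 2 n] False assms by (simp add: Gam2_def)
      show "level2 m \<subseteq> lcs Gam n" using K_lcs[of m] lcs_antimono[OF is_subgrp_Gam m] by blast
    qed
    then have "real (diam Q) \<le> 45 * 13 ^ m" by (metis of_nat_le_iff of_nat_mult of_nat_numeral of_nat_power)
    ultimately show ?thesis by (simp add: lower_central_gs)
  qed
qed

text \<open>With n = k + 1 the index is at least 2^k; the factor 4 comes from n <= 2 k and ln 2 >=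
  1/2.\<close>

lemma ln_index_ge:
  assumes "n \<ge> 2"
  shows "real n \<le> 4 * ln (real (card (rcosets\<^bsub>gupta_sidki\<^esub> lower_central gupta_sidki n)))"
proof -
  obtain k where k: "n = Suc k" "k \<ge> 1" using assms by (cases n) auto
  have "2 ^ k \<le> card (coset (lcs Gam n) ` Gam)" unfolding k(1) by (rule card_cosets)
  then have "(2::real) ^ k \<le> real (card (rcosets\<^bsub>gupta_sidki\<^esub> lower_central gupta_sidki n))"
    unfolding card_rcosets_gs by (metis of_nat_le_iff of_nat_numeral of_nat_power)
  then have "ln (2 ^ k) \<le> ln (real (card (rcosets\<^bsub>gupta_sidki\<^esub> lower_central gupta_sidki n)))"
    by (intro ln_mono) auto
  then have "real k * ln 2 \<le> ln (real (card (rcosets\<^bsub>gupta_sidki\<^esub> lower_central gupta_sidki n)))"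
    by (simp only: ln_realpow zero_less_numeral)
  moreover have "real k * (1 / 2) \<le> real k * ln 2"
    using ln_ge_iff[of 2 "1 / 2"] exp_half_le2 by (intro mult_left_mono) auto
  moreover have "real n = real k + 1" "1 \<le> real k" using k by simp_all
  ultimately show ?thesis by linarith
qed

theorem theorem1p5:
  shows "(\<exists>C::real. \<forall>n::nat. n \<ge> 1 \<longrightarrow>
            real (diam (gupta_sidki Mod lower_central gupta_sidki n))
              \<le> C * real n powr (ln 111 / ln (1 + sqrt 2)))
       \<and> (\<exists>C::real. \<forall>n::nat. n \<ge> 1 \<longrightarrow>
            real (diam (gupta_sidki Mod lower_central gupta_sidki n))
              \<le> C * ln (real (card (rcosets\<^bsub>gupta_sidki\<^esub> lower_central gupta_sidki n)))
                    powr (ln 111 / ln 3))"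
proof (intro conjI)
  let ?d = "\<lambda>n. real (diam (gupta_sidki Mod lower_central gupta_sidki n))"
  have d: "?d n \<le> 585 * real n powr e" if "n \<ge> 1" "4.28 \<le> e" for n e
  proof -
    have "?d n \<le> 585 * real n powr 4.28" by (rule diam_gs_bound(1)[OF that(1)])
    also have "\<dots> \<le> 585 * real n powr e" using that by (intro mult_left_mono powr_mono) auto
    finally show ?thesis .
  qed
  show "\<exists>C. \<forall>n\<ge>1. ?d n \<le> C * real n powr (ln 111 / ln (1 + sqrt 2))"
    using d exponent_ge exponent_mono by (intro exI[of _ 585] allI impI d) linarith+
  let ?e = "ln 111 / ln 3 :: real"
  let ?l = "\<lambda>n. ln (real (card (rcosets\<^bsub>gupta_sidki\<^esub> lower_central gupta_sidki n)))"
  have "?d n \<le> (585 * 4 powr ?e) * ?l n powr ?e" if "n \<ge> 1" for n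
  proof (cases "n = 1")
    \<comment> \<open>Here the index is 1 and its logarithm 0, so the right-hand side is 0 for every
      constant: the diameter has to be exactly 0.\<close>
    case True
    then show ?thesis using diam_gs_bound(2)[OF that] by simp
  next
    case False
    then have n: "real n \<le> 4 * ?l n" using that by (intro ln_index_ge) simp
    then have l: "0 \<le> ?l n" by linarith
    have "?d n \<le> 585 * real n powr ?e" by (rule d[OF that exponent_ge])
    also have "\<dots> \<le> 585 * (4 * ?l n) powr ?e"
      using n exponent_ge by (intro mult_left_mono powr_mono2) auto
    also have "\<dots> = (585 * 4 powr ?e) * ?l n powr ?e" using l by (simp add: powr_mult)
    finally show ?thesis .
  qed
  then show "\<exists>C. \<forall>n\<ge>1. ?d n \<le> C * ?l n powr ?e" by blast
qed

end
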